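(* Let $X$ be a one-dimensional Lévy process starting at $0$ with Lévy–Khinchin exponent $\varPsi$, and write $\theta=\operatorname{Re}\varPsi$, $\omega=\operatorname{Im}\varPsi$. Suppose that $$\int_0^\infty \frac{1}{|q+\varPsi(\lambda)|}\,d\lambda<\infty\quad\text{for every } q>0,\qquad\text{and}\qquad \int_0^1\left|\operatorname{Im}\left(\frac{\lambda}{\varPsi(\lambda)}\right)\right|d\lambda<\infty .$$ Suppose, in addition, that there exist a slowly varying function $L$ at $\infty$ and constants $\alpha\in(1,2)$, $c_\theta>0$ and $c_\omega\in\mathbb{R}$ such that $$\theta(\lambda)\sim c_\theta\lambda^\alpha L(\lambda),\qquad \omega(\lambda)\sim c_\omega\lambda^\alpha L(\lambda)\qquad\text{as }\lambda\to\infty .$$ Then the renormalized zero resolvent $h$ of $X$ satisfies $$h(x)\sim c_\pm\,|x|^{\alpha-1}L\left(\frac{1}{|x|}\right)^{-1}\qquad\text{as }x\to0\pm,$$ where $$c_\pm=\frac{C_\alpha}{c_\theta^2+c_\omega^2}\left(c_\theta\pm c_\omega\cot\frac{\pi\alpha}{2}\right),\qquad C_\alpha=\frac1\pi\int_0^\infty\frac{1-\cos x}{x^\alpha}\,dx=\frac{1}{2\Gamma(\alpha)\sin\frac{\pi(\alpha-1)}{2}} .$$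
   Context: Lévy–Khinchin exponent: for a one-dimensional Lévy process $X$ starting at $0$, $$\varPsi(\lambda):=-\log\mathbb{E}[e^{i\lambda X_1}]=a\lambda^2+ib\lambda+\int_{\mathbb{R}}\left(1-e^{i\lambda x}+i\lambda x\,1_{\{|x|<1\}}\right)\nu(dx),\quad\lambda\in\mathbb{R},$$ where $a\ge0$ is the Gaussian coefficient, $b\in\mathbb{R}$, and $\nu$ is the Lévy measure (a measure on $\mathbb{R}$ with $\nu(\{0\})=0$ and $\int_{\mathbb{R}}(x^2\wedge1)\,\nu(dx)<\infty$). Thus $$\theta(\lambda)=a\lambda^2+\int_{\mathbb{R}}(1-\cos\lambda x)\,\nu(dx),\qquad \omega(\lambda)=b\lambda+\int_{\mathbb{R}}\left(\lambda x\,1_{\{|x|<1\}}-\sin\lambda x\right)\nu(dx).$$ Resolvent density and renormalized zero resolvent: if $\int_0^\infty|q+\varPsi(\lambda)|^{-1}d\lambda<\infty$ for every $q>0$, then for every $q>0$ the $q$-resolvent density $r_q$, characterized by $\mathbb{E}\left[\int_0^\infty e^{-qt}f(X_t+x)\,dt\right]=\int_{\mathbb{R}}f(y)r_q(y-x)\,dy$ for all non-negative measurable $f$, exists, and its continuous version is $$r_q(x)=\frac1\pi\int_0^\infty\operatorname{Re}\left(\frac{e^{-i\lambda x}}{q+\varPsi(\lambda)}\right)d\lambda .$$ The renormalized zero resolvent is $$h(x):=\lim_{q\to0+}\left(r_q(0)-r_q(-x)\right),\quad x\in\mathbb{R};$$ under the same integrability condition this limit is known to exist and to be finite. A function $L:(0,\infty)\to[0,\infty)$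 is slowly varying at $\infty$ if $L(kx)/L(x)\to1$ as $x\to\infty$ for all $k>0$. Convention on $\sim$: for a constant $c\in\mathbb{R}$, possibly $c=0$, "$f\sim c\,g$" means $f/g\to c$ in the indicated limit. The symbol $\pm$ is read consistently: upper signs for $x\to0+$ and lower signs for $x\to0-$. *)

theory Defs
  imports "HOL-Probability.Probability"
begin

definition cadlag :: "(real \<Rightarrow> real) \<Rightarrow> bool" where
  "cadlag f \<longleftrightarrow>
     (\<forall>t\<ge>0. (f \<longlongrightarrow> f t) (at_right t)) \<and>
     (\<forall>t>0. \<exists>l. (f \<longlongrightarrow> l) (at_left t))"

text \<open>Time is modelled by the non-negative reals; the values of \<open>X t\<close> for \<open>t < 0\<close> play no role.
  The starting point and the path regularity are required almost surely.\<close>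

definition levy_process :: "'a measure \<Rightarrow> (real \<Rightarrow> 'a \<Rightarrow> real) \<Rightarrow> bool" where
  "levy_process M X \<longleftrightarrow>
     prob_space M \<and>
     (\<forall>t\<ge>0. X t \<in> borel_measurable M) \<and>
     (AE w in M. X 0 w = 0) \<and>
     (\<forall>n (t :: nat \<Rightarrow> real). 0 \<le> t 0 \<and> (\<forall>i<n. t i < t (Suc i)) \<longrightarrow>
        prob_space.indep_vars M (\<lambda>_. borel) (\<lambda>i w. X (t (Suc i)) w - X (t i) w) {..<n}) \<and>
     (\<forall>s\<ge>0. \<forall>t\<ge>0. distr M borel (\<lambda>w. X (s + t) w - X s w) = distr M borel (X t)) \<and>
     (AE w in M. cadlag (\<lambda>t. X t w))"

definition levy_measure :: "real measure \<Rightarrow> bool" where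
  "levy_measure \<nu> \<longleftrightarrow>
     sets \<nu> = sets borel \<and> emeasure \<nu> {0} = 0 \<and>
     (\<integral>\<^sup>+ x. ennreal (min (x\<^sup>2) 1) \<partial>\<nu>) < \<infinity>"

definition levy_khinchin :: "real \<Rightarrow> real \<Rightarrow> real measure \<Rightarrow> real \<Rightarrow> complex" where
  "levy_khinchin a b \<nu> l =
     of_real (a * l\<^sup>2) + \<i> * of_real (b * l) +
     (\<integral> x. (1 - exp (\<i> * of_real (l * x)) + \<i> * of_real (l * x * indicator {-1<..<1} x)) \<partial>\<nu>)"

text \<open>In \<open>\<Psi>(l) = - log E[exp (i l X\<^sub>1)]\<close> the logarithm is the distinguished one, that is, the
  continuous branch vanishing at \<open>l = 0\<close>. As the right-hand side of the Levy-Khinchin formula is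
  continuous in \<open>l\<close> and vanishes at \<open>0\<close>, at most one function satisfies the following predicate
  (and the Levy-Khinchin theorem asserts that one exists for every Levy process).\<close>

definition levy_exponent :: "'a measure \<Rightarrow> (real \<Rightarrow> 'a \<Rightarrow> real) \<Rightarrow> (real \<Rightarrow> complex) \<Rightarrow> bool" where
  "levy_exponent M X \<Psi> \<longleftrightarrow>
     (\<exists>a b \<nu>. 0 \<le> a \<and> levy_measure \<nu> \<and> \<Psi> = levy_khinchin a b \<nu>) \<and>
     (\<forall>l. char (distr M borel (X 1)) l = exp (- \<Psi> l))"

text \<open>The defining property of a density determines it only almost everywhere;
  continuity singles out the version that is meant.\<close>

definition is_resolvent_density ::
    "'a measure \<Rightarrow> (real \<Rightarrow> 'a \<Rightarrow> real) \<Rightarrow> real \<Rightarrow> (real \<Rightarrow> real) \<Rightarrow> bool" where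
  "is_resolvent_density M X q r \<longleftrightarrow>
     continuous_on UNIV r \<and> (\<forall>x. 0 \<le> r x) \<and>
     (\<forall>f \<in> borel_measurable borel. \<forall>x.
        (\<integral>\<^sup>+ w. (\<integral>\<^sup>+ t\<in>{0..}. ennreal (exp (- q * t)) * f (X t w + x) \<partial>lborel) \<partial>M) =
        (\<integral>\<^sup>+ y. f y * ennreal (r (y - x)) \<partial>lborel))"

definition resolvent_density ::
    "'a measure \<Rightarrow> (real \<Rightarrow> 'a \<Rightarrow> real) \<Rightarrow> real \<Rightarrow> real \<Rightarrow> real" where
  "resolvent_density M X q = (THE r. is_resolvent_density M X q r)"

definition renormalized_zero_resolvent ::
    "'a measure \<Rightarrow> (real \<Rightarrow> 'a \<Rightarrow> real) \<Rightarrow> real \<Rightarrow> real" where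
  "renormalized_zero_resolvent M X x =
     Lim (at_right 0) (\<lambda>q. resolvent_density M X q 0 - resolvent_density M X q (- x))"

text \<open>Only the values on the positive half-line matter.\<close>

definition slowly_varying :: "(real \<Rightarrow> real) \<Rightarrow> bool" where
  "slowly_varying L \<longleftrightarrow>
     (\<forall>x>0. 0 \<le> L x) \<and> (\<forall>k>0. ((\<lambda>x. L (k * x) / L x) \<longlongrightarrow> 1) at_top)"

text \<open>\<open>f \<sim> c g\<close>, where \<open>c = 0\<close> is allowed; for \<open>c = 0\<close> this is not the asymptotic equivalence
  of \<open>f\<close> with the zero function.\<close>

definition asymp_const ::
    "('b \<Rightarrow> real) \<Rightarrow> real \<Rightarrow> ('b \<Rightarrow> real) \<Rightarrow> 'b filter \<Rightarrow> bool" where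
  "asymp_const f c g F \<longleftrightarrow> ((\<lambda>x. f x / g x) \<longlongrightarrow> c) F"

definition C_const :: "real \<Rightarrow> real" where
  "C_const \<alpha> = 1 / pi * (LBINT x:{0<..}. (1 - cos x) / x powr \<alpha>)"

end

theory Submission
  imports Defs "HOL-Real_Asymp.Real_Asymp"
begin

text \<open>Since \<open>E[exp (i l X\<^sub>t)] = exp (- t \<Psi>(l))\<close>, the law of \<open>X\<close> at an independent exponential time
  of rate \<open>q\<close> has the characteristic function \<open>q / (q + \<Psi>)\<close>, which is integrable; Fourier inversion
  yields the resolvent density, and letting \<open>q \<rightarrow> 0\<close> by dominated convergence yields
  \<open>\<pi> h(x) = \<integral>\<^sub>0\<^sup>\<infinity> Re ((1 - exp (i l x)) / \<Psi>(l)) dl\<close>. The frequencies below a fixed bound contribute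
  only \<open>O(x)\<close>, which is negligible because \<open>\<alpha> < 2\<close>. In the remaining part put \<open>u = l \<bar>x\<bar>\<close>: after
  multiplication by \<open>\<bar>x\<bar> \<theta>(1/\<bar>x\<bar>)\<close> the integrand converges to a multiple of \<open>(1 - exp (\<plusminus> i u)) u\<^bsup>-\<alpha>\<^esup>\<close>,
  dominated by means of Potter bounds for the continuous regularly varying function \<open>\<theta>\<close> (no
  measurability of \<open>L\<close> is available), and \<open>\<integral>\<^sub>0\<^sup>\<infinity> (1 - exp (i u)) u\<^bsup>-\<alpha>\<^esup> du\<close> is computed from
  \<open>\<Gamma>(\<alpha>) u\<^bsup>-\<alpha>\<^esup> = \<integral>\<^sub>0\<^sup>\<infinity> t\<^bsup>\<alpha>-1\<^esup> exp (- u t) dt\<close> and Euler's reflection formula.\<close>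

section \<open>The Levy-Khinchin exponent\<close>

text \<open>The two ends of the frequency axis need different arguments, because regular variation
  says nothing near the origin. There the real part of
  \<open>(1 - iexp (l * x)) / (q + \<Psi> l)\<close> is bounded by a cosine term quadratic in
  \<open>l * x\<close> and a sine term linear in \<open>l * x\<close> and weighted by
  \<open>Im (1 / \<Psi> l)\<close>. The first is controlled by a lower bound \<open>m * l^2\<close>
  for \<open>Re (\<Psi> l)\<close>, which comes from the fact that doubling the frequency at most
  quadruples the real part. The second is controlled by the integrability of
  \<open>Im (l / \<Psi> l)\<close>. Adding \<open>q \<ge> 0\<close> does not spoil either bound, so
  one dominating function serves every \<open>q\<close>, and taken at \<open>q = 0\<close> the same
  estimates give the linear bound in \<open>x\<close> for the low frequencies. Normalising by
  \<open>Re (\<Psi> s)\<close> with \<open>s = 1 / \<bar>x\<bar>\<close> keeps \<open>L\<close> out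
  of the analysis until the last division. Since the resolvent density is a definite description,
  its existence must be accompanied by a uniqueness proof.\<close>

lemma levy_khinchin_integrand_bound:
  fixes l x :: real
  shows "cmod (1 - iexp (l * x) + \<i> * of_real (l * x * indicator {-1<..<1} x)) \<le> (2 + l\<^sup>2) * min (x\<^sup>2) 1"
proof (cases "\<bar>x\<bar> < 1")
  case True
  \<comment> \<open>For \<open>\<bar>x\<bar> < 1\<close> the compensator cancels the linear Taylor
    term and leaves a quadratic remainder; elsewhere the trivial bound 2 suffices. The constant
    \<open>2 + l\<^sup>2\<close> covers both cases.\<close>
  have "cmod (iexp (l * x) - (\<Sum>k\<le>1. (\<i> * (l * x)) ^ k / fact k)) \<le> \<bar>l * x\<bar> ^ Suc 1 / fact (Suc 1)"
    by (rule iexp_approx1)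
  then have "cmod (iexp (l * x) - 1 - \<i> * (l * x)) \<le> (l * x)\<^sup>2 / 2"
    by (simp add: power2_eq_square abs_mult algebra_simps)
  moreover have "(l * x)\<^sup>2 / 2 \<le> (2 + l\<^sup>2) * x\<^sup>2"
    by (simp add: power_mult_distrib algebra_simps)
  moreover have "x\<^sup>2 \<le> 1"
    using True by (simp add: abs_square_le_1)
  moreover have "indicator {-1<..<1} x = (1::real)"
    using True by (auto simp: indicator_def)
  moreover have "cmod (1 - iexp (l * x) + \<i> * of_real (l * x)) = cmod (iexp (l * x) - 1 - \<i> * (l * x))"
    by (subst norm_minus_cancel[symmetric]) (simp add: algebra_simps)
  ultimately show ?thesis
    by (simp add: min_absorb1)
next
  case False
  then have "x\<^sup>2 \<ge> 1"
    by (metis abs_le_square_iff abs_one linorder_not_less one_power2)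
  moreover have "cmod (1 - iexp (l * x)) \<le> 2"
    by (rule norm_triangle_le_diff) simp
  moreover have "indicator {-1<..<1} x = (0::real)"
    using False by (auto simp: indicator_def)
  moreover have "(2::real) \<le> 2 + l\<^sup>2" by simp
  ultimately show ?thesis
    by (simp add: order_trans min_def)
qed

lemma levy_measure_integrable_min:
  assumes "levy_measure \<nu>"
  shows "integrable \<nu> (\<lambda>x. min (x\<^sup>2) 1)"
  using assms unfolding levy_measure_def
  by (auto intro!: integrableI_nonneg cong: measurable_cong_sets)

lemma levy_khinchin_integrable:
  assumes "levy_measure \<nu>"
  shows "integrable \<nu> (\<lambda>x. 1 - iexp (l * x) + \<i> * of_real (l * x * indicator {-1<..<1} x))"
proof (rule Bochner_Integration.integrable_bound)
  show "integrable \<nu> (\<lambda>x. (2 + l\<^sup>2) * min (x\<^sup>2) 1)"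
    using levy_measure_integrable_min[OF assms] by (rule integrable_mult_right)
  have "sets \<nu> = sets borel" using assms by (simp add: levy_measure_def)
  then show "(\<lambda>x. 1 - iexp (l * x) + \<i> * of_real (l * x * indicator {-1<..<1} x)) \<in> borel_measurable \<nu>"
    by (simp cong: measurable_cong_sets)
  show "AE x in \<nu>. norm (1 - iexp (l * x) + \<i> * of_real (l * x * indicator {-1<..<1} x))
      \<le> norm ((2 + l\<^sup>2) * min (x\<^sup>2) 1)"
    using levy_khinchin_integrand_bound by (auto simp del: norm_mult intro!: AE_I2 intro: order_trans[OF _ abs_ge_self])
qed

lemma Re_levy_khinchin:
  assumes "levy_measure \<nu>"
  shows "integrable \<nu> (\<lambda>x. 1 - cos (l * x))"
    and "Re (levy_khinchin a b \<nu> l) = a * l\<^sup>2 + (\<integral>x. 1 - cos (l * x) \<partial>\<nu>)"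
proof -
  note I = levy_khinchin_integrable[OF assms, of l]
  show "integrable \<nu> (\<lambda>x. 1 - cos (l * x))"
    using integrable_Re[OF I] by (simp add: Re_exp)
  show "Re (levy_khinchin a b \<nu> l) = a * l\<^sup>2 + (\<integral>x. 1 - cos (l * x) \<partial>\<nu>)"
    using integral_Re[OF I] by (simp add: levy_khinchin_def Re_exp)
qed

lemma Re_levy_khinchin_nonneg:
  assumes "levy_measure \<nu>" "0 \<le> a"
  shows "0 \<le> Re (levy_khinchin a b \<nu> l)"
  using assms by (simp add: Re_levy_khinchin)

text \<open>Integrate the pointwise bound \<open>1 - cos (2 * y) \<le> 4 * (1 - cos y)\<close>; the
  Gaussian term is multiplied by exactly 4. Iterated, this yields quadratic lower bounds near the
  origin.\<close>

lemma Re_levy_khinchin_double: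
  assumes "levy_measure \<nu>" "0 \<le> a"
  shows "Re (levy_khinchin a b \<nu> (2 * l)) \<le> 4 * Re (levy_khinchin a b \<nu> l)"
proof -
  have "1 - cos (2 * l * x) \<le> 4 * (1 - cos (l * x))" for x
  proof -
    have "1 - cos (2 * (l * x)) = 2 * (1 - cos (l * x)) * (1 + cos (l * x))"
      by (simp only: cos_double_cos) (simp add: power2_eq_square algebra_simps)
    also have "\<dots> \<le> 2 * (1 - cos (l * x)) * 2"
      by (intro mult_left_mono) auto
    finally show ?thesis by (simp add: mult.assoc)
  qed
  then have "(\<integral>x. 1 - cos (2 * l * x) \<partial>\<nu>) \<le> (\<integral>x. 4 * (1 - cos (l * x)) \<partial>\<nu>)"
    by (intro integral_mono Re_levy_khinchin(1)[OF assms(1)] integrable_mult_right) auto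
  then have "(\<integral>x. 1 - cos (2 * l * x) \<partial>\<nu>) \<le> 4 * (\<integral>x. 1 - cos (l * x) \<partial>\<nu>)"
    by (simp only: integral_mult_right_zero)
  then show ?thesis
    using assms by (simp add: Re_levy_khinchin power2_eq_square)
qed

lemma levy_khinchin_uminus: "levy_khinchin a b \<nu> (- l) = cnj (levy_khinchin a b \<nu> l)"
proof -
  have "(\<integral>x. cnj (1 - iexp (l * x) + \<i> * of_real (l * x * indicator {-1<..<1} x)) \<partial>\<nu>)
      = cnj (\<integral>x. 1 - iexp (l * x) + \<i> * of_real (l * x * indicator {-1<..<1} x) \<partial>\<nu>)"
    by (rule Bochner_Integration.integral_cnj)
  then show ?thesis
    by (simp add: levy_khinchin_def exp_cnj)
qed

lemma levy_khinchin_0 [simp]: "levy_khinchin a b \<nu> 0 = 0"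
  by (simp add: levy_khinchin_def)

text \<open>Along a convergent sequence the frequencies stay bounded, so the quadratic bound on the
  integrand provides a single dominating function.\<close>

lemma continuous_levy_khinchin:
  assumes "levy_measure \<nu>"
  shows "continuous_on UNIV (levy_khinchin a b \<nu>)"
proof (intro continuous_at_imp_continuous_on ballI)
  fix l :: real
  have S: "sets \<nu> = sets borel" using assms by (simp add: levy_measure_def)
  have "isCont (\<lambda>l. \<integral>x. 1 - iexp (l * x) + \<i> * of_real (l * x * indicator {-1<..<1} x) \<partial>\<nu>) l"
    unfolding continuous_at_sequentially comp_def
  proof (intro allI impI)
    fix u :: "nat \<Rightarrow> real" assume u: "u \<longlonglongrightarrow> l"
    then have "bounded (range u)"
      by (rule convergent_imp_bounded)
    then obtain K where K: "\<And>n. \<bar>u n\<bar> \<le> K"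
      by (force simp: bounded_iff)
    show "(\<lambda>n. \<integral>x. 1 - iexp (u n * x) + \<i> * of_real (u n * x * indicator {-1<..<1} x) \<partial>\<nu>)
        \<longlonglongrightarrow> (\<integral>x. 1 - iexp (l * x) + \<i> * of_real (l * x * indicator {-1<..<1} x) \<partial>\<nu>)"
    proof (rule integral_dominated_convergence)
      show "integrable \<nu> (\<lambda>x. (2 + K\<^sup>2) * min (x\<^sup>2) 1)"
        using levy_measure_integrable_min[OF assms] by (rule integrable_mult_right)
      show "AE x in \<nu>. cmod (1 - iexp (u n * x) + \<i> * of_real (u n * x * indicator {-1<..<1} x))
         \<le> (2 + K\<^sup>2) * min (x\<^sup>2) 1" for n
      proof (rule AE_I2)
        fix x
        have "(u n)\<^sup>2 \<le> K\<^sup>2" using K[of n] by (simp add: abs_le_square_iff[symmetric])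
        then have "(2 + (u n)\<^sup>2) * min (x\<^sup>2) 1 \<le> (2 + K\<^sup>2) * min (x\<^sup>2) 1"
          by (intro mult_right_mono) auto
        then show "cmod (1 - iexp (u n * x) + \<i> * of_real (u n * x * indicator {-1<..<1} x))
           \<le> (2 + K\<^sup>2) * min (x\<^sup>2) 1"
          using levy_khinchin_integrand_bound[of "u n" x] by linarith
      qed
      show "AE x in \<nu>. (\<lambda>n. 1 - iexp (u n * x) + \<i> * of_real (u n * x * indicator {-1<..<1} x))
        \<longlonglongrightarrow> 1 - iexp (l * x) + \<i> * of_real (l * x * indicator {-1<..<1} x)"
        by (intro AE_I2 tendsto_intros u)
    qed (use S in \<open>simp_all cong: measurable_cong_sets\<close>)
  qed
  then show "isCont (levy_khinchin a b \<nu>) l"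
    unfolding levy_khinchin_def by (intro continuous_intros) auto
qed

section \<open>Characteristic functions of a Levy process\<close>

lemma char_levy_process_0:
  assumes "levy_process M X"
  shows "char (distr M borel (X 0)) l = 1"
proof -
  interpret prob_space M using assms by (simp add: levy_process_def)
  have [measurable]: "X 0 \<in> borel_measurable M"
    using assms by (simp add: levy_process_def)
  have "(\<integral>w. iexp (l * X 0 w) \<partial>M) = (\<integral>w. 1 \<partial>M)"
    using assms by (intro integral_cong_AE) (auto simp: levy_process_def)
  then show ?thesis
    by (simp add: char_def integral_distr prob_space)
qed

lemma char_levy_process_add:
  assumes X: "levy_process M X" and st: "0 \<le> s" "0 \<le> t"
  shows "char (distr M borel (X (s + t))) l = char (distr M borel (X s)) l * char (distr M borel (X t)) l"
proof (cases "s = 0 \<or> t = 0")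
  \<comment> \<open>\<open>levy_process\<close> grants independent increments only along strictly
    increasing times, so vanishing time steps are treated separately.\<close>
  case True
  then show ?thesis using char_levy_process_0[OF X] by auto
next
  case False
  interpret prob_space M using X by (simp add: levy_process_def)
  define u :: "nat \<Rightarrow> real" where "u i = (if i = 0 then 0 else if i = 1 then s else s + t)" for i
  have "0 \<le> u 0 \<and> (\<forall>i<2. u i < u (Suc i))"
    using st False by (auto simp: u_def less_2_cases_iff)
  then have "indep_vars (\<lambda>_. borel) (\<lambda>i w. X (u (Suc i)) w - X (u i) w) {..<2}"
    using X unfolding levy_process_def by blast
  from char_distr_sum[OF this, of l]
  have "char (distr M borel (\<lambda>w. X (s + t) w - X 0 w)) l =
     char (distr M borel (\<lambda>w. X s w - X 0 w)) l * char (distr M borel (\<lambda>w. X (s + t) w - X s w)) l"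
    by (simp add: u_def numeral_2_eq_2)
  \<comment> \<open>Stationarity replaces each increment by a value of \<open>X\<close> in law; the
    case \<open>a = 0\<close> covers the increments that start at time 0.\<close>
  moreover have "distr M borel (\<lambda>w. X (a + b) w - X a w) = distr M borel (X b)" if "0 \<le> a" "0 \<le> b" for a b
    using X that unfolding levy_process_def by blast
  from this[of 0 "s + t"] this[of 0 s] this[of s t] st
  have "distr M borel (\<lambda>w. X (s + t) w - X 0 w) = distr M borel (X (s + t))"
     "distr M borel (\<lambda>w. X s w - X 0 w) = distr M borel (X s)"
     "distr M borel (\<lambda>w. X (s + t) w - X s w) = distr M borel (X t)"
    by simp_all
  ultimately show ?thesis by simp
qed

lemma char_levy_process_mult:
  assumes X: "levy_process M X" and "0 \<le> t"
  shows "char (distr M borel (X (real n * t))) l = char (distr M borel (X t)) l ^ n"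
proof (induction n)
  case 0
  then show ?case using char_levy_process_0[OF X] by simp
next
  case (Suc n)
  have "char (distr M borel (X (real n * t + t))) l = char (distr M borel (X t)) l ^ Suc n"
    using char_levy_process_add[OF X, of "real n * t" t l] Suc \<open>0 \<le> t\<close> by simp
  then show ?case by (simp add: algebra_simps)
qed

lemma levy_exponentD:
  assumes "levy_exponent M X \<Psi>"
  obtains a b \<nu> where "0 \<le> a" "levy_measure \<nu>" "\<Psi> = levy_khinchin a b \<nu>"
  using assms unfolding levy_exponent_def by auto

text \<open>The quotient of the two sides is continuous in \<open>l\<close>, equals 1 at 0 and has values in the \<open>n\<close>-th
  roots of unity; this excludes a jump of the logarithm by a multiple of \<open>2 \<pi> i\<close>.\<close>

lemma char_levy_process_inverse_nat:
  assumes X: "levy_process M X" and \<Psi>: "levy_exponent M X \<Psi>" and n: "0 < n"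
  shows "char (distr M borel (X (1 / real n))) l = exp (- \<Psi> l / of_nat n)"
proof -
  interpret prob_space M using X by (simp add: levy_process_def)
  interpret D: real_distribution "distr M borel (X (1 / real n))"
    using X by (intro real_distribution_distr) (simp add: levy_process_def)
  define g where "g l = char (distr M borel (X (1 / real n))) l * exp (\<Psi> l / of_nat n)" for l
  obtain a b \<nu> where LK: "levy_measure \<nu>" "\<Psi> = levy_khinchin a b \<nu>"
    using levy_exponentD[OF \<Psi>] by metis
  then have "continuous_on UNIV \<Psi>"
    using continuous_levy_khinchin by blast
  then have "continuous_on UNIV g"
    unfolding g_def using n
    by (intro continuous_intros continuous_at_imp_continuous_on[OF ballI[OF D.isCont_char]]) auto
  moreover have gn: "g l ^ n = 1" for l
  proof -
    have "char (distr M borel (X (1 / real n))) l ^ n = exp (- \<Psi> l)"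
      using char_levy_process_mult[OF X, of "1 / real n" n l] n \<Psi>
      by (simp add: levy_exponent_def)
    then show ?thesis
      using n by (simp add: g_def power_mult_distrib exp_of_nat_mult[symmetric] exp_minus)
  qed
  then have "range g \<subseteq> {z. z ^ n = 1}" by auto
  then have "finite (range g)"
    using finite_roots_unity[of n] n by (auto intro: finite_subset)
  ultimately have "g constant_on UNIV"
    by (intro continuous_finite_range_constant) auto
  moreover have "g 0 = 1"
    using LK D.char_zero by (simp add: g_def)
  ultimately have "g l = 1"
    by (metis UNIV_I constant_on_def)
  then show ?thesis
    by (simp add: g_def exp_minus field_simps)
qed

text \<open>The grid point is the first multiple of \<open>1 / (k + 1)\<close> strictly to the right
  of \<open>t\<close>. The \<open>+ 1\<close> after the floor makes the inequality strict, so that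
  the sequence converges along \<open>at_right t\<close> and right-continuity of the paths
  applies.\<close>

lemma right_grid_approximation:
  fixes t :: real
  assumes "0 \<le> t"
  shows "filterlim (\<lambda>k. real (nat \<lfloor>t * real (Suc k)\<rfloor> + 1) / real (Suc k)) (at_right t) sequentially"
proof -
  let ?q = "\<lambda>k. real (nat \<lfloor>t * real (Suc k)\<rfloor> + 1) / real (Suc k)"
  have q: "?q k > t" "?q k \<le> t + 1 / real (Suc k)" for k
  proof -
    have "real (nat \<lfloor>t * real (Suc k)\<rfloor>) = of_int \<lfloor>t * real (Suc k)\<rfloor>"
      using assms by simp
    then have "t * real (Suc k) < real (nat \<lfloor>t * real (Suc k)\<rfloor> + 1)"
       "real (nat \<lfloor>t * real (Suc k)\<rfloor> + 1) \<le> t * real (Suc k) + 1"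
      by linarith+
    then show "?q k > t" "?q k \<le> t + 1 / real (Suc k)"
      by (simp_all add: field_simps del: of_nat_Suc)
  qed
  have "?q \<longlonglongrightarrow> t"
  proof (rule tendsto_sandwich)
    show "(\<lambda>k. t) \<longlonglongrightarrow> t" by simp
    show "(\<lambda>k. t + 1 / real (Suc k)) \<longlonglongrightarrow> t"
      using tendsto_add[OF tendsto_const[of t] LIMSEQ_inverse_real_of_nat] by (simp add: inverse_eq_divide)
  qed (use q in \<open>auto intro!: always_eventually less_imp_le\<close>)
  moreover have "\<forall>\<^sub>F k in sequentially. ?q k \<in> {t<..} \<and> ?q k \<noteq> t"
    by (intro always_eventually allI) (metis q(1) greaterThan_iff less_irrefl)
  ultimately show ?thesis
    by (simp only: filterlim_at simp_thms)
qed

text \<open>Powers of the characteristic function at time \<open>1 / n\<close> settle rational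
  times. Approximation from the right and dominated convergence, the integrands having modulus 1,
  then settle all times.\<close>

lemma char_levy_process:
  assumes X: "levy_process M X" and \<Psi>: "levy_exponent M X \<Psi>" and t: "0 \<le> t"
  shows "char (distr M borel (X t)) l = exp (- of_real t * \<Psi> l)"
proof -
  interpret prob_space M using X by (simp add: levy_process_def)
  have Xm[measurable]: "X t \<in> borel_measurable M" if "0 \<le> t" for t
    using X that by (simp add: levy_process_def)
  have rat: "char (distr M borel (X (real m / real n))) l = exp (- of_real (real m / real n) * \<Psi> l)"
    if "0 < n" for m n
    using char_levy_process_mult[OF X, of "1 / real n" m l] char_levy_process_inverse_nat[OF X \<Psi> that, of l]
    by (simp add: exp_of_nat_mult[symmetric])
  define q where "q k = real (nat \<lfloor>t * real (Suc k)\<rfloor> + 1) / real (Suc k)" for k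
  have q: "filterlim q (at_right t) sequentially"
    unfolding q_def using right_grid_approximation[OF t] .
  then have q': "q \<longlonglongrightarrow> t" by (simp add: filterlim_at)
  have q0: "0 \<le> q k" for k by (simp add: q_def)
  have "(\<lambda>k. \<integral>w. iexp (l * X (q k) w) \<partial>M) \<longlonglongrightarrow> (\<integral>w. iexp (l * X t w) \<partial>M)"
  proof (rule integral_dominated_convergence[where w = "\<lambda>_. 1"])
    have "AE w in M. cadlag (\<lambda>t. X t w)"
      using X by (simp add: levy_process_def)
    then show "AE w in M. (\<lambda>k. iexp (l * X (q k) w)) \<longlonglongrightarrow> iexp (l * X t w)"
    proof eventually_elim
      case (elim w)
      then have "((\<lambda>t. X t w) \<longlongrightarrow> X t w) (at_right t)"
        using t by (simp add: cadlag_def)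
      then have "(\<lambda>k. X (q k) w) \<longlonglongrightarrow> X t w"
        using q by (rule filterlim_compose)
      then show ?case by (intro tendsto_intros)
    qed
  qed (use t q0 in auto)
  then have "(\<lambda>k. char (distr M borel (X (q k))) l) \<longlonglongrightarrow> char (distr M borel (X t)) l"
    using t q0 by (simp add: char_def integral_distr)
  moreover have "char (distr M borel (X (q k))) l = exp (- of_real (q k) * \<Psi> l)" for k
    unfolding q_def by (rule rat) simp
  ultimately have "(\<lambda>k. exp (- of_real (q k) * \<Psi> l)) \<longlonglongrightarrow> char (distr M borel (X t)) l"
    by simp
  moreover have "(\<lambda>k. exp (- of_real (q k) * \<Psi> l)) \<longlonglongrightarrow> exp (- of_real t * \<Psi> l)"
    by (intro tendsto_intros q')
  ultimately show ?thesis by (rule LIMSEQ_unique)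
qed

text \<open>The paths are cadlag only almost surely and \<open>M\<close> need not be complete, so \<open>X\<close> itself need not
  be jointly measurable.\<close>

lemma levy_process_measurable_version:
  assumes X: "levy_process M X"
  obtains Y where "(\<lambda>(t, w). Y t w) \<in> borel_measurable (borel \<Otimes>\<^sub>M M)"
    and "AE w in M. \<forall>t\<ge>0. Y t w = X t w"
proof -
  have Xm[measurable]: "X t \<in> borel_measurable M" if "0 \<le> t" for t
    using X that by (simp add: levy_process_def)
  have "AE w in M. cadlag (\<lambda>t. X t w)"
    using X by (simp add: levy_process_def)
  then obtain N where N: "{w \<in> space M. \<not> cadlag (\<lambda>t. X t w)} \<subseteq> N" "N \<in> sets M" "emeasure M N = 0"
    by (auto elim: AE_E)
  \<comment> \<open>The set of bad paths need not be measurable, hence the passage to the measurable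
    null set \<open>N\<close> containing it. Negative times are clamped to 0.\<close>
  define Y where "Y t w = (if w \<in> N then 0 else X (max t 0) w)" for t w
  define q where "q t k = real (nat \<lfloor>t * real (Suc k)\<rfloor> + 1) / real (Suc k)" for t k
  have "(\<lambda>z. if snd z \<in> N then 0 else X (q (fst z) k) (snd z)) \<in> borel_measurable (borel \<Otimes>\<^sub>M M)" for k
  proof -
    \<comment> \<open>At a fixed grid size only countably many time indices occur, and each fixed
      index gives a measurable function of the path. The version \<open>Y\<close> is the limit of
      these step processes.\<close>
    have "(\<lambda>z. (\<lambda>i z. X (real (i + 1) / real (Suc k)) (snd z)) (nat \<lfloor>fst z * real (Suc k)\<rfloor>) z)
        \<in> borel_measurable (borel \<Otimes>\<^sub>M M)"
    proof (rule measurable_compose_countable[where f = "\<lambda>i z. X (real (i + 1) / real (Suc k)) (snd z)"])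
      show "(\<lambda>z. X (real (i + 1) / real (Suc k)) (snd z)) \<in> borel_measurable (borel \<Otimes>\<^sub>M M)" for i
        by (rule measurable_compose[OF measurable_snd Xm]) simp
    qed measurable
    then show ?thesis
      unfolding q_def using N(2) by simp
  qed
  moreover have "(\<lambda>k. if snd z \<in> N then 0 else X (q (fst z) k) (snd z)) \<longlonglongrightarrow> Y (fst z) (snd z)"
    if "z \<in> space (borel \<Otimes>\<^sub>M M)" for z
  proof (cases "snd z \<in> N")
    case True
    then show ?thesis by (simp add: Y_def)
  next
    case False
    then have "cadlag (\<lambda>t. X t (snd z))"
      using N(1) that by (auto simp: space_pair_measure)
    then have "((\<lambda>t. X t (snd z)) \<longlongrightarrow> X (max (fst z) 0) (snd z)) (at_right (max (fst z) 0))"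
      by (simp add: cadlag_def)
    \<comment> \<open>For a negative time the floor is negative and \<open>nat\<close> sends it to
      0, exactly as at time 0.\<close>
    moreover have "q (fst z) = q (max (fst z) 0)"
      by (auto simp: q_def fun_eq_iff max_def intro!: le_less_trans[OF mult_nonpos_nonneg])
    then have "filterlim (q (fst z)) (at_right (max (fst z) 0)) sequentially"
      using right_grid_approximation[of "max (fst z) 0"] by (simp add: q_def[abs_def])
    ultimately have "(\<lambda>k. X (q (fst z) k) (snd z)) \<longlonglongrightarrow> X (max (fst z) 0) (snd z)"
      by (rule filterlim_compose)
    then show ?thesis using False by (simp add: Y_def)
  qed
  ultimately have "(\<lambda>z. Y (fst z) (snd z)) \<in> borel_measurable (borel \<Otimes>\<^sub>M M)"
    by (rule borel_measurable_LIMSEQ_real[rotated])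
  moreover have "AE w in M. w \<notin> N"
    using N by (auto intro!: AE_not_in)
  then have "AE w in M. \<forall>t\<ge>0. Y t w = X t w"
    by eventually_elim (simp add: Y_def max_absorb1)
  ultimately show ?thesis using that by (simp add: case_prod_unfold)
qed

section \<open>Fourier inversion\<close>

context real_distribution
begin

text \<open>The classical inversion integral. Taking the real part gives a real-valued function
  without a prior proof that the integral is real.\<close>

definition inversion_density :: "real \<Rightarrow> real" where
  "inversion_density x = 1 / (2 * pi) * Re (\<integral>t. iexp (- (t * x)) * char M t \<partial>lborel)"

context
  assumes int: "integrable lborel (char M)"
begin

lemma integrable_iexp_char: "integrable lborel (\<lambda>t. iexp (- (t * x)) * char M t)"
  by (rule Bochner_Integration.integrable_bound[OF int]) (auto simp: norm_mult)

lemma continuous_inversion_density: "continuous_on UNIV inversion_density"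
proof (intro continuous_at_imp_continuous_on ballI)
  fix x :: real
  have "isCont (\<lambda>x. \<integral>t. iexp (- (t * x)) * char M t \<partial>lborel) x"
    unfolding continuous_at_sequentially comp_def
  proof (intro allI impI)
    fix u :: "nat \<Rightarrow> real" assume u: "u \<longlonglongrightarrow> x"
    show "(\<lambda>n. \<integral>t. iexp (- (t * u n)) * char M t \<partial>lborel) \<longlonglongrightarrow> (\<integral>t. iexp (- (t * x)) * char M t \<partial>lborel)"
      by (rule integral_dominated_convergence[where w = "\<lambda>t. cmod (char M t)"])
         (use int in \<open>auto simp: norm_mult intro!: tendsto_intros u\<close>)
  qed
  then show "isCont inversion_density x"
    unfolding inversion_density_def by (intro continuous_intros) auto
qed

lemma borel_measurable_inversion_density [measurable]: "inversion_density \<in> borel_measurable borel"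
  by (rule borel_measurable_continuous_onI[OF continuous_inversion_density])

lemma inversion_density_bound: "\<bar>inversion_density x\<bar> \<le> (\<integral>t. cmod (char M t) \<partial>lborel)"
proof -
  have "cmod (\<integral>t. iexp (- (t * x)) * char M t \<partial>lborel) \<le> (\<integral>t. cmod (iexp (- (t * x)) * char M t) \<partial>lborel)"
    by (rule integral_norm_bound)
  then have "\<bar>Re (\<integral>t. iexp (- (t * x)) * char M t \<partial>lborel)\<bar> \<le> (\<integral>t. cmod (char M t) \<partial>lborel)"
    using abs_Re_le_cmod order_trans by (fastforce simp: norm_mult)
  moreover have "1 / (2 * pi) \<le> 1"
    using pi_gt3 by simp
  then have "1 / (2 * pi) * \<bar>Re (\<integral>t. iexp (- (t * x)) * char M t \<partial>lborel)\<bar>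
      \<le> 1 * \<bar>Re (\<integral>t. iexp (- (t * x)) * char M t \<partial>lborel)\<bar>"
    by (rule mult_right_mono) simp
  ultimately show ?thesis
    by (simp add: inversion_density_def abs_mult)
qed

lemma integrable_indicator_Icc_mult: "integrable lborel (\<lambda>x::real. indicator {a..b} x * (c::real))"
  by (intro integrable_mult_left integrable_real_indicator) (auto simp: emeasure_lborel_Icc_eq)

text \<open>In Levy's inversion formula the truncated integrals converge to the full one, because
  the kernel \<open>?F\<close> is bounded by \<open>b - a\<close> and the characteristic function is
  integrable. Since \<open>?F t\<close> is the integral of \<open>iexp (- (t * x))\<close> over
  \<open>x\<close> in \<open>{a..b}\<close>, Fubini's theorem then turns the formula into an
  integral of the density. Levy's formula requires endpoints without mass; this restriction is
  removed once atoms are excluded.\<close>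

lemma measure_Ioc_eq_inversion_density_aux:
  assumes ab: "a \<le> b" "measure M {a} = 0" "measure M {b} = 0"
  shows "measure M {a<..b} = (\<integral>x. indicator {a..b} x * inversion_density x \<partial>lborel)"
proof -
  let ?F = "\<lambda>t. (iexp (- (t * a)) - iexp (- (t * b))) / (\<i> * t)"
  have Fb: "cmod (?F t * char M t) \<le> (b - a) * cmod (char M t)" for t
  proof (cases "t = 0")
    case False
    have "cmod (?F t) \<le> b - a"
      using Levy_Inversion_aux2[of "- b" "- a" t] ab(1) False by simp
    then show ?thesis by (simp only: norm_mult mult_right_mono norm_ge_zero)
  \<comment> \<open>At \<open>t = 0\<close> the quotient \<open>?F t\<close> is
    \<open>0 / 0\<close>, which has the value 0.\<close>
  qed (use ab in simp)
  have "(\<lambda>T. 1 / (2 * pi) * (CLBINT t=- real T..real T. ?F t * char M t)) \<longlonglongrightarrow> of_real (measure M {a<..b})"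
    using Levy_Inversion[OF ab] by simp
  moreover have "(\<lambda>T. CLBINT t=- real T..real T. ?F t * char M t) \<longlonglongrightarrow> (\<integral>t. ?F t * char M t \<partial>lborel)"
  proof -
    have "(\<lambda>T::nat. \<integral>t. indicator {-real T..real T} t *\<^sub>R (?F t * char M t) \<partial>lborel) \<longlonglongrightarrow> (\<integral>t. ?F t * char M t \<partial>lborel)"
    proof (rule integral_dominated_convergence[where w = "\<lambda>t. (b - a) * cmod (char M t)"])
      show "AE t in lborel. (\<lambda>T. indicator {-real T..real T} t *\<^sub>R (?F t * char M t)) \<longlonglongrightarrow> ?F t * char M t"
      proof (rule AE_I2)
        fix t :: real
        have "\<forall>\<^sub>F T::nat in sequentially. indicator {-real T..real T} t *\<^sub>R (?F t * char M t) = ?F t * char M t"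
          using eventually_ge_at_top[of "nat \<lceil>\<bar>t\<bar>\<rceil>"]
        proof eventually_elim
          case (elim T)
          then have "\<bar>t\<bar> \<le> real T" by linarith
          then have "t \<in> {-real T..real T}" by auto
          then show ?case by simp
        qed
        then show "(\<lambda>T. indicator {-real T..real T} t *\<^sub>R (?F t * char M t)) \<longlonglongrightarrow> ?F t * char M t"
          by (rule tendsto_eventually)
      qed
      show "AE t in lborel. norm (indicator {-real T..real T} t *\<^sub>R (?F t * char M t)) \<le> (b - a) * cmod (char M t)" for T
      proof (rule AE_I2)
        fix t
        have "norm (indicator {-real T..real T} t *\<^sub>R (?F t * char M t)) \<le> cmod (?F t * char M t)"
          by (simp add: indicator_def)
        then show "norm (indicator {-real T..real T} t *\<^sub>R (?F t * char M t)) \<le> (b - a) * cmod (char M t)"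
          using Fb[of t] by linarith
      qed
      show "integrable lborel (\<lambda>t. (b - a) * cmod (char M t))"
        using int by simp
    qed measurable
    then show ?thesis
      using interval_integral_Icc[of "- real T" "real T" "\<lambda>t. ?F t * char M t" for T]
      by (simp add: set_lebesgue_integral_def)
  qed
  then have "(\<lambda>T. 1 / (2 * pi) * (CLBINT t=- real T..real T. ?F t * char M t)) \<longlonglongrightarrow> 1 / (2 * pi) * (\<integral>t. ?F t * char M t \<partial>lborel)"
    by (intro tendsto_intros)
  ultimately have M: "of_real (measure M {a<..b}) = 1 / (2 * pi) * (\<integral>t. ?F t * char M t \<partial>lborel)"
    using LIMSEQ_unique by blast
  have inner: "(\<integral>x. indicator {a..b} x *\<^sub>R iexp (- (t * x)) \<partial>lborel) = ?F t" if "t \<noteq> 0" for t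
  proof -
    have "(\<integral>x. indicator {a..b} x *\<^sub>R iexp (- (t * x)) \<partial>lborel)
      = \<i> / t * iexp (- (t * b)) - \<i> / t * iexp (- (t * a))"
      using that by (intro integral_FTC_atLeastAtMost ab(1))
        (auto intro!: continuous_intros derivative_eq_intros simp: has_vector_derivative_complex_iff Re_exp Im_exp)
    also have "\<dots> = ?F t"
      using that by (simp add: field_simps)
    finally show ?thesis .
  qed
  have prod: "integrable (lborel \<Otimes>\<^sub>M lborel) (\<lambda>(x, t). indicator {a..b} x *\<^sub>R (iexp (- (t * x)) * char M t))"
  proof (rule lborel_pair.Fubini_integrable)
    have "(\<integral>t. norm (case (x, t) of (x, t) \<Rightarrow> indicator {a..b} x *\<^sub>R (iexp (- (t * x)) * char M t)) \<partial>lborel)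
       = indicator {a..b} x * (\<integral>t. cmod (char M t) \<partial>lborel)" for x
      by (simp add: norm_mult)
    then show "integrable lborel (\<lambda>x. \<integral>t. norm (case (x, t) of (x, t) \<Rightarrow> indicator {a..b} x *\<^sub>R (iexp (- (t * x)) * char M t)) \<partial>lborel)"
      using integrable_indicator_Icc_mult by presburger
    show "AE x in lborel. integrable lborel (\<lambda>t. case (x, t) of (x, t) \<Rightarrow> indicator {a..b} x *\<^sub>R (iexp (- (t * x)) * char M t))"
      using integrable_iexp_char by simp
  qed (simp add: case_prod_unfold)
  have "(\<integral>t. ?F t * char M t \<partial>lborel)
     = (\<integral>t. (\<integral>x. indicator {a..b} x *\<^sub>R (iexp (- (t * x)) * char M t) \<partial>lborel) \<partial>lborel)"
  proof (rule integral_cong_AE)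
    have "AE t in lborel. t \<noteq> (0::real)" by (rule AE_lborel_singleton)
    then show "AE t in lborel. ?F t * char M t = (\<integral>x. indicator {a..b} x *\<^sub>R (iexp (- (t * x)) * char M t) \<partial>lborel)"
    proof eventually_elim
      case (elim t)
      have "(\<integral>x. (indicator {a..b} x *\<^sub>R iexp (- (t * x))) * char M t \<partial>lborel)
          = (\<integral>x. indicator {a..b} x *\<^sub>R iexp (- (t * x)) \<partial>lborel) * char M t"
        by (rule integral_mult_left_zero)
      then show ?case using inner[OF elim] by simp
    qed
    show "(\<lambda>t. ?F t * char M t) \<in> borel_measurable lborel" by simp
    show "(\<lambda>t. \<integral>x. indicator {a..b} x *\<^sub>R (iexp (- (t * x)) * char M t) \<partial>lborel) \<in> borel_measurable lborel"
      by (rule lborel.borel_measurable_lebesgue_integral) (simp add: case_prod_unfold)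
  qed
  also have "\<dots> = (\<integral>x. (\<integral>t. indicator {a..b} x *\<^sub>R (iexp (- (t * x)) * char M t) \<partial>lborel) \<partial>lborel)"
    by (rule lborel_pair.Fubini_integral[OF prod])
  also have "\<dots> = (\<integral>x. indicator {a..b} x *\<^sub>R (\<integral>t. iexp (- (t * x)) * char M t \<partial>lborel) \<partial>lborel)"
    by simp
  finally have M2: "of_real (measure M {a<..b})
     = 1 / (2 * pi) * (\<integral>x. indicator {a..b} x *\<^sub>R (\<integral>t. iexp (- (t * x)) * char M t \<partial>lborel) \<partial>lborel)"
    using M by simp
  have I: "integrable lborel (\<lambda>x. indicator {a..b} x *\<^sub>R (\<integral>t. iexp (- (t * x)) * char M t \<partial>lborel))"
    using lborel_pair.integrable_fst'[OF prod] by simp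
  have "measure M {a<..b} = Re (of_real (measure M {a<..b}))" by simp
  also have "\<dots> = 1 / (2 * pi) * Re (\<integral>x. indicator {a..b} x *\<^sub>R (\<integral>t. iexp (- (t * x)) * char M t \<partial>lborel) \<partial>lborel)"
    unfolding M2 by (simp add: Re_divide_of_real)
  also have "\<dots> = (\<integral>x. 1 / (2 * pi) * Re (indicator {a..b} x *\<^sub>R (\<integral>t. iexp (- (t * x)) * char M t \<partial>lborel)) \<partial>lborel)"
    using integral_Re[OF I] by simp
  also have "\<dots> = (\<integral>x. indicator {a..b} x * inversion_density x \<partial>lborel)"
    by (intro Bochner_Integration.integral_cong refl) (simp add: inversion_density_def)
  finally show ?thesis .
qed

lemma integrable_inversion_density_Icc: "integrable lborel (\<lambda>x. indicator {a..b} x * inversion_density x)"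
  using borel_integrable_compact[of "{a..b}" inversion_density] continuous_inversion_density
  by (auto simp: mult.commute intro: continuous_on_subset)

text \<open>There are only countably many atoms, so \<open>x\<close> can be enclosed between
  massless points that are arbitrarily close to it. The density is bounded, so the mass of the
  enclosing interval is at most proportional to its length.\<close>

lemma measure_singleton_eq_0: "measure M {x} = 0"
proof -
  define K where "K = (\<integral>t. cmod (char M t) \<partial>lborel)"
  have K: "0 \<le> K" unfolding K_def by simp
  have "measure M {x} \<le> 0 + e" if "0 < e" for e
  proof -
    \<comment> \<open>The interval has length at most \<open>2 * d\<close> and the density is at
      most \<open>K\<close>; \<open>K + 1\<close> avoids a division by 0.\<close>
    define d where "d = e / (2 * (K + 1))"
    have d: "0 < d" using that K by (simp add: d_def)
    have ex: "\<exists>z\<in>{u<..<v}. measure M {z} = 0" if "u < v" for u v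
    proof (rule ccontr)
      assume "\<not> ?thesis"
      then have "{u<..<v} \<subseteq> {z. measure M {z} \<noteq> 0}" by auto
      then have "countable {u<..<v}"
        using countable_support countable_subset by blast
      then show False using uncountable_open_interval[of u v] that by simp
    qed
    obtain a b where ab: "x - d < a" "a < x" "x < b" "b < x + d" "measure M {a} = 0" "measure M {b} = 0"
      using ex[of "x - d" x] ex[of x "x + d"] d by auto
    have "measure M {x} \<le> measure M {a<..b}"
      using ab by (intro finite_measure_mono) auto
    also have "\<dots> = (\<integral>x. indicator {a..b} x * inversion_density x \<partial>lborel)"
      using ab by (intro measure_Ioc_eq_inversion_density_aux) auto
    also have "\<dots> \<le> (\<integral>x. indicator {a..b} x * K \<partial>lborel)"
    proof (rule integral_mono[OF integrable_inversion_density_Icc])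
      show "indicator {a..b} y * inversion_density y \<le> indicator {a..b} y * K" for y
        using inversion_density_bound[of y] by (auto simp: indicator_def K_def)
    qed (rule integrable_indicator_Icc_mult)
    also have "\<dots> = (b - a) * K" using ab by simp
    also have "\<dots> \<le> (2 * d) * K" using ab K by (intro mult_right_mono) auto
    also have "\<dots> \<le> e" using that K by (simp add: d_def field_simps)
    finally show ?thesis by simp
  qed
  then have "measure M {x} \<le> 0" by (rule field_le_epsilon)
  then show ?thesis by (simp add: antisym)
qed

lemma measure_Ioc_eq_inversion_density:
  "a \<le> b \<Longrightarrow> measure M {a<..b} = (\<integral>x. indicator {a..b} x * inversion_density x \<partial>lborel)"
  by (intro measure_Ioc_eq_inversion_density_aux measure_singleton_eq_0)

text \<open>By continuity a negative value would persist on a short interval, which would then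
  receive negative mass.\<close>

lemma inversion_density_nonneg: "0 \<le> inversion_density x"
proof (rule ccontr)
  assume neg: "\<not> ?thesis"
  have "isCont inversion_density x"
    using continuous_inversion_density by (simp add: continuous_on_eq_continuous_at)
  then obtain d where d: "0 < d" "\<And>y. \<bar>y - x\<bar> < d \<Longrightarrow> \<bar>inversion_density y - inversion_density x\<bar> < - inversion_density x / 2"
    using neg unfolding continuous_at_eps_delta dist_real_def
    by (metis half_gt_zero linorder_not_le neg_0_less_iff_less)
  have "measure M {x - d / 2<..x} = (\<integral>y. indicator {x - d / 2..x} y * inversion_density y \<partial>lborel)"
    using d by (intro measure_Ioc_eq_inversion_density) auto
  also have "\<dots> \<le> (\<integral>y. indicator {x - d / 2..x} y * (inversion_density x / 2) \<partial>lborel)"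
  proof (rule integral_mono[OF integrable_inversion_density_Icc])
    fix y
    show "indicator {x - d / 2..x} y * inversion_density y \<le> indicator {x - d / 2..x} y * (inversion_density x / 2)"
      using d(1) d(2)[of y] by (auto simp: indicator_def)
  qed (rule integrable_indicator_Icc_mult)
  also have "\<dots> = d / 2 * (inversion_density x / 2)" using d by simp
  also have "\<dots> < 0" using neg d by (intro mult_pos_neg) auto
  finally show False using measure_nonneg[of M] by (simp add: not_less)
qed

text \<open>Agreement on bounded half-open intervals extends to the half-lines \<open>{x<..}\<close>
  by monotone exhaustion, and these have finite mass and determine the measure.\<close>

lemma eq_density_inversion_density: "M = density lborel (\<lambda>x. ennreal (inversion_density x))"
proof (rule measure_eqI_lessThan)
  let ?N = "density lborel (\<lambda>x. ennreal (inversion_density x))"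
  have Ioc: "emeasure M {a<..b} = emeasure ?N {a<..b}" if "a \<le> b" for a b
  proof -
    have "emeasure ?N {a<..b} = (\<integral>\<^sup>+x. ennreal (inversion_density x) * indicator {a<..b} x \<partial>lborel)"
      by (simp add: emeasure_density)
    also have "\<dots> = (\<integral>\<^sup>+x. ennreal (indicator {a..b} x * inversion_density x) \<partial>lborel)"
    proof (rule nn_integral_cong_AE)
      have "AE x in lborel. x \<noteq> a" by (rule AE_lborel_singleton)
      then show "AE x in lborel. ennreal (inversion_density x) * indicator {a<..b} x
          = ennreal (indicator {a..b} x * inversion_density x)"
        by eventually_elim (auto simp: indicator_def)
    qed
    also have "\<dots> = ennreal (\<integral>x. indicator {a..b} x * inversion_density x \<partial>lborel)"
      by (rule nn_integral_eq_integral[OF integrable_inversion_density_Icc]) (simp add: inversion_density_nonneg)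
    also have "\<dots> = emeasure M {a<..b}"
      using measure_Ioc_eq_inversion_density[OF that] by (simp add: emeasure_eq_measure)
    finally show ?thesis by simp
  qed
  fix x :: real
  have U: "{x<..} = (\<Union>n. {x<..x + real n})"
  proof (intro equalityI subsetI)
    fix y assume "y \<in> {x<..}"
    moreover obtain n where "y - x \<le> real n" using real_arch_simple by blast
    ultimately show "y \<in> (\<Union>n. {x<..x + real n})" by (auto intro!: exI[of _ n])
  qed auto
  have inc: "incseq (\<lambda>n. {x<..x + real n})"
    by (auto simp: incseq_def)
  have "emeasure M {x<..} = (SUP n. emeasure M {x<..x + real n})"
    unfolding U by (rule SUP_emeasure_incseq[symmetric]) (use inc in auto)
  also have "\<dots> = (SUP n. emeasure ?N {x<..x + real n})"
    by (simp add: Ioc)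
  also have "\<dots> = emeasure ?N {x<..}"
    unfolding U by (rule SUP_emeasure_incseq) (use inc in auto)
  finally show "emeasure M {x<..} = emeasure ?N {x<..}" .
qed (auto simp: less_top[symmetric])

end

end

section \<open>The resolvent density\<close>

lemma integral_exponential_density_exp:
  fixes z :: complex
  assumes q: "0 < q" and z: "0 \<le> Re z"
  shows "(\<integral>t. exponential_density q t *\<^sub>R exp (- of_real t * z) \<partial>lborel) = q / (q + z)"
proof -
  let ?f = "\<lambda>t::real. of_real q * exp (- of_real t * (q + z))"
  let ?F = "\<lambda>t::real. - (q / (q + z)) * exp (- of_real t * (q + z))"
  have aux: "((\<lambda>t::real. - (c / w) * exp (- of_real t * w)) has_vector_derivative c * exp (- of_real t * w)) (at t)"
    if "w \<noteq> 0" for w c :: complex and t :: real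
    by (rule has_vector_derivative_real_field) (use that in \<open>auto intro!: derivative_eq_intros\<close>)
  have nz: "q + z \<noteq> 0"
    using q z by (auto simp: complex_eq_iff)
  have eq: "exponential_density q t *\<^sub>R exp (- of_real t * z) = indicator {0..} t *\<^sub>R ?f t" for t
  proof -
    have "of_real (exp (- t * q)) * exp (- of_real t * z) = exp (- of_real t * (q + z))"
      by (simp add: exp_of_real[symmetric] exp_add[symmetric] algebra_simps)
    then show ?thesis
      by (simp add: exponential_density_def scaleR_conv_of_real indicator_def mult.assoc)
  qed
  have "(\<integral>\<^sup>+ t. ennreal (exponential_density q t) \<partial>lborel) = 1"
    using prob_space.emeasure_space_1[OF prob_space_exponential_density[OF q]]
    by (simp add: emeasure_density)
  then have "integrable lborel (exponential_density q)"
    using q by (intro integrableI_nonneg) (auto simp: exponential_density_nonneg)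
  then have I: "integrable lborel (\<lambda>t. exponential_density q t *\<^sub>R exp (- of_real t * z))"
  proof (rule Bochner_Integration.integrable_bound)
    show "AE t in lborel. norm (exponential_density q t *\<^sub>R exp (- of_real t * z)) \<le> norm (exponential_density q t)"
      using z q by (auto simp: exponential_density_def mult_nonneg_nonneg intro!: AE_I2)
  qed measurable
  have "(LBINT t=0..\<infinity>. ?f t) = 0 - ?F 0"
  proof (rule interval_integral_FTC_integrable)
    show "(?F has_vector_derivative ?f t) (at t)" for t
      by (rule aux[OF nz])
    show "isCont ?f t" for t by (intro continuous_intros)
    have "set_integrable lborel {0..} ?f"
      using I unfolding eq by (simp add: set_integrable_def)
    then show "set_integrable lborel (einterval 0 \<infinity>) ?f"
      by (rule set_integrable_subset) (auto simp: einterval_def zero_ereal_def)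
    have "isCont ?F 0" by (intro continuous_intros)
    then have "(?F \<longlongrightarrow> ?F 0) (at_right 0)" by (simp add: isCont_def filterlim_at_split)
    then show "((?F \<circ> real_of_ereal) \<longlongrightarrow> ?F 0) (at_right 0)"
      by (simp add: zero_ereal_def ereal_tendsto_simps)
    have "((\<lambda>t::real. exp (- t * q)) \<longlongrightarrow> 0) at_top"
      using q by real_asymp
    then have "((\<lambda>t. q / cmod (q + z) * exp (- t * q)) \<longlongrightarrow> 0) at_top"
      by (rule tendsto_mult_right_zero)
    then have "((\<lambda>t. q / cmod (q + z) * exp (- t * (q + Re z))) \<longlongrightarrow> 0) at_top"
    proof (rule tendsto_sandwich[rotated 3])
      show "\<forall>\<^sub>F t in at_top. q / cmod (q + z) * exp (- t * (q + Re z)) \<le> q / cmod (q + z) * exp (- t * q)"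
        using eventually_ge_at_top[of 0] by eventually_elim (rule mult_left_mono, use q z in \<open>auto simp: algebra_simps\<close>)
    qed (use q in auto)
    then have "(?F \<longlongrightarrow> 0) at_top"
      using q by (subst tendsto_norm_zero_iff[symmetric]) (simp add: norm_mult norm_divide)
    then show "((?F \<circ> real_of_ereal) \<longlongrightarrow> 0) (at_left \<infinity>)"
      by (simp add: ereal_tendsto_simps)
  qed simp
  moreover have "(LBINT t=0..\<infinity>. ?f t) = (LBINT t:{0..}. ?f t)"
  proof -
    have "(LBINT t=0..\<infinity>. ?f t) = (LBINT t:{0<..}. ?f t)"
      using interval_integral_to_infinity_eq[where M = lborel and a = 0 and f = ?f] by (simp add: zero_ereal_def)
    also have "\<dots> = (LBINT t:{0..}. ?f t)"
      by (rule set_integral_discrete_difference[where X="{0}"]) auto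
    finally show ?thesis .
  qed
  ultimately have "(LBINT t:{0..}. ?f t) = q / (q + z)"
    by simp
  then show ?thesis
    unfolding eq by (simp only: set_lebesgue_integral_def)
qed

text \<open>Up to the factor \<open>q\<close>, the resolvent kernel is the law of the process at an
  independent exponential time. That time is realised as the first coordinate of a product space,
  which requires the jointly measurable version \<open>Y\<close>. As a probability measure,
  \<open>\<mu>\<close> is accessible to Fourier inversion.\<close>

lemma levy_process_occupation_distribution:
  assumes X: "levy_process M X" and \<Psi>: "levy_exponent M X \<Psi>" and q: "0 < q"
  shows "\<exists>\<mu>. real_distribution \<mu> \<and> (\<forall>l. char \<mu> l = q / (q + \<Psi> l)) \<and>
    (\<forall>f \<in> borel_measurable borel. \<forall>x.
      (\<integral>\<^sup>+ w. (\<integral>\<^sup>+ t\<in>{0..}. ennreal (exp (- q * t)) * f (X t w + x) \<partial>lborel) \<partial>M) =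
        ennreal (1 / q) * (\<integral>\<^sup>+ y. f (y + x) \<partial>\<mu>))"
proof -
  interpret prob_space M using X by (simp add: levy_process_def)
  have Xm[measurable]: "X t \<in> borel_measurable M" if "0 \<le> t" for t
    using X that by (simp add: levy_process_def)
  obtain a b \<nu> where "0 \<le> a" "levy_measure \<nu>" "\<Psi> = levy_khinchin a b \<nu>"
    using levy_exponentD[OF \<Psi>] .
  then have Re\<Psi>: "0 \<le> Re (\<Psi> l)" for l
    by (simp add: Re_levy_khinchin_nonneg)
  obtain Y where Ym: "(\<lambda>(t, w). Y t w) \<in> borel_measurable (borel \<Otimes>\<^sub>M M)"
    and YX: "AE w in M. \<forall>t\<ge>0. Y t w = X t w"
    using levy_process_measurable_version[OF X] .
  define E where "E = density lborel (exponential_density q)"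
  interpret E: prob_space E unfolding E_def by (rule prob_space_exponential_density[OF q])
  interpret P: pair_prob_space E M ..
  have Ym'[measurable]: "(\<lambda>z. Y (fst z) (snd z)) \<in> borel_measurable (E \<Otimes>\<^sub>M M)"
    using Ym by (simp add: E_def case_prod_unfold cong: measurable_cong_sets)
  have [measurable]: "(\<lambda>z. Y (snd z) (fst z)) \<in> borel_measurable (M \<Otimes>\<^sub>M E)"
    using measurable_pair_swap[OF Ym'] by (simp add: case_prod_unfold)
  define \<mu> where "\<mu> = distr (E \<Otimes>\<^sub>M M) borel (\<lambda>z. Y (fst z) (snd z))"
  show ?thesis
  proof (intro exI conjI allI ballI)
    show "real_distribution \<mu>"
      unfolding \<mu>_def by (rule P.real_distribution_distr) simp
    show "char \<mu> l = q / (q + \<Psi> l)" for l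
    proof -
      have int: "integrable (E \<Otimes>\<^sub>M M) (\<lambda>(t, w). iexp (l * Y t w))"
        by (rule P.integrable_const_bound[where B = 1]) (auto simp: case_prod_unfold)
      have "char \<mu> l = (\<integral>z. iexp (l * Y (fst z) (snd z)) \<partial>(E \<Otimes>\<^sub>M M))"
        unfolding \<mu>_def char_def by (rule integral_distr) auto
      also have "\<dots> = (\<integral>t. (\<integral>w. iexp (l * Y t w) \<partial>M) \<partial>E)"
        using P.integral_fst'[OF int[unfolded case_prod_unfold]] by simp
      also have "\<dots> = (\<integral>t. exponential_density q t *\<^sub>R (\<integral>w. iexp (l * Y t w) \<partial>M) \<partial>lborel)"
        unfolding E_def
      proof (rule integral_density)
        have "(\<lambda>t. \<integral>w. iexp (l * Y t w) \<partial>M) \<in> borel_measurable E"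
          by (rule borel_measurable_lebesgue_integral) (simp add: case_prod_unfold)
        then show "(\<lambda>t. \<integral>w. iexp (l * Y t w) \<partial>M) \<in> borel_measurable lborel"
          by (simp add: E_def)
      qed (use q in \<open>auto simp: exponential_density_nonneg\<close>)
      also have "\<dots> = (\<integral>t. exponential_density q t *\<^sub>R exp (- of_real t * \<Psi> l) \<partial>lborel)"
      proof (rule Bochner_Integration.integral_cong[OF refl])
        fix t :: real
        have "(\<integral>w. iexp (l * Y t w) \<partial>M) = exp (- of_real t * \<Psi> l)" if "0 \<le> t"
        proof -
          have [measurable]: "Y t \<in> borel_measurable M"
            using measurable_Pair2[OF Ym, of t] by simp
          have "(\<integral>w. iexp (l * Y t w) \<partial>M) = (\<integral>w. iexp (l * X t w) \<partial>M)"
            using YX that by (intro integral_cong_AE) auto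
          also have "\<dots> = char (distr M borel (X t)) l"
            using that by (simp add: char_def integral_distr)
          finally show ?thesis using char_levy_process[OF X \<Psi> that] by simp
        qed
        then show "exponential_density q t *\<^sub>R (\<integral>w. iexp (l * Y t w) \<partial>M) = exponential_density q t *\<^sub>R exp (- of_real t * \<Psi> l)"
          by (cases "0 \<le> t") (auto simp: exponential_density_def)
      qed
      also have "\<dots> = q / (q + \<Psi> l)"
        using Re\<Psi> by (intro integral_exponential_density_exp q)
      finally show ?thesis .
    qed
    fix f :: "real \<Rightarrow> ennreal" and x :: real
    assume f[measurable]: "f \<in> borel_measurable borel"
    \<comment> \<open>The weight of the resolvent is \<open>1 / q\<close> times the exponential
      density.\<close>
    have *: "ennreal (exp (- q * t)) * c * indicator {0..} t = ennreal (1 / q) * (ennreal (exponential_density q t) * c)" for t c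
    proof -
      have "ennreal (exp (- q * t)) = ennreal (1 / q) * ennreal (q * exp (- t * q))"
        using q by (subst ennreal_mult[symmetric]) (auto simp: mult.commute)
      then show ?thesis
        by (cases "0 \<le> t") (simp_all add: exponential_density_def mult.assoc)
    qed
    have "(\<integral>\<^sup>+ w. (\<integral>\<^sup>+ t\<in>{0..}. ennreal (exp (- q * t)) * f (X t w + x) \<partial>lborel) \<partial>M)
       = (\<integral>\<^sup>+ w. (\<integral>\<^sup>+ t\<in>{0..}. ennreal (exp (- q * t)) * f (Y t w + x) \<partial>lborel) \<partial>M)"
    proof (rule nn_integral_cong_AE)
      show "AE w in M. (\<integral>\<^sup>+ t\<in>{0..}. ennreal (exp (- q * t)) * f (X t w + x) \<partial>lborel)
         = (\<integral>\<^sup>+ t\<in>{0..}. ennreal (exp (- q * t)) * f (Y t w + x) \<partial>lborel)"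
        using YX by eventually_elim (auto intro!: nn_integral_cong simp: indicator_def)
    qed
    also have "\<dots> = (\<integral>\<^sup>+ w. ennreal (1 / q) * (\<integral>\<^sup>+ t. f (Y t w + x) \<partial>E) \<partial>M)"
    proof (rule nn_integral_cong)
      fix w assume w: "w \<in> space M"
      have [measurable]: "(\<lambda>t. Y t w) \<in> borel_measurable borel"
        using measurable_Pair1[OF Ym w] by simp
      show "(\<integral>\<^sup>+ t\<in>{0..}. ennreal (exp (- q * t)) * f (Y t w + x) \<partial>lborel) = ennreal (1 / q) * (\<integral>\<^sup>+ t. f (Y t w + x) \<partial>E)"
        unfolding * E_def by (simp add: nn_integral_cmult nn_integral_density)
    qed
    also have "\<dots> = ennreal (1 / q) * (\<integral>\<^sup>+ w. (\<integral>\<^sup>+ t. f (Y t w + x) \<partial>E) \<partial>M)"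
      by (rule nn_integral_cmult) (rule E.borel_measurable_nn_integral, simp add: case_prod_unfold)
    also have "(\<integral>\<^sup>+ w. (\<integral>\<^sup>+ t. f (Y t w + x) \<partial>E) \<partial>M) = (\<integral>\<^sup>+ z. f (Y (fst z) (snd z) + x) \<partial>(E \<Otimes>\<^sub>M M))"
      using P.nn_integral_snd[of "\<lambda>z. f (Y (fst z) (snd z) + x)"] by simp
    also have "\<dots> = (\<integral>\<^sup>+ y. f (y + x) \<partial>\<mu>)"
      unfolding \<mu>_def by (simp add: nn_integral_distr)
    finally show "(\<integral>\<^sup>+ w. (\<integral>\<^sup>+ t\<in>{0..}. ennreal (exp (- q * t)) * f (X t w + x) \<partial>lborel) \<partial>M) =
        ennreal (1 / q) * (\<integral>\<^sup>+ y. f (y + x) \<partial>\<mu>)" .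
  qed
qed

text \<open>The set of disagreement is open and a null set, hence empty.\<close>

lemma continuous_AE_lborel_eq:
  fixes f g :: "real \<Rightarrow> real"
  assumes "continuous_on UNIV f" "continuous_on UNIV g" "AE x in lborel. f x = g x"
  shows "f = g"
proof -
  let ?S = "{x. f x \<noteq> g x}"
  have "open ?S" using assms by (intro open_Collect_neq)
  moreover have "?S \<in> null_sets lborel"
    using assms(3) \<open>open ?S\<close> by (subst AE_iff_null_sets) auto
  then have "negligible ?S"
    by (simp add: negligible_iff_null_sets null_sets_completionI)
  ultimately have "?S = {}" using open_not_negligible by blast
  then show ?thesis by auto
qed

text \<open>The inversion density of \<open>\<mu>\<close>, divided by \<open>q\<close>, has the
  defining property. For \<open>THE\<close> it must also be the only such function: testing with
  indicators identifies two candidates almost everywhere, and continuity identifies them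
  everywhere.\<close>

lemma resolvent_density_eq:
  assumes X: "levy_process M X" and \<Psi>: "levy_exponent M X \<Psi>" and q: "0 < q"
    and int: "integrable lborel (\<lambda>l. 1 / (q + \<Psi> l))"
  shows "resolvent_density M X q x = 1 / (2 * pi) * Re (\<integral>l. iexp (- (l * x)) / (q + \<Psi> l) \<partial>lborel)"
proof -
  obtain \<mu> where \<mu>: "real_distribution \<mu>" "\<And>l. char \<mu> l = q / (q + \<Psi> l)"
    "\<And>f x. f \<in> borel_measurable borel \<Longrightarrow>
      (\<integral>\<^sup>+ w. (\<integral>\<^sup>+ t\<in>{0..}. ennreal (exp (- q * t)) * f (X t w + x) \<partial>lborel) \<partial>M) =
        ennreal (1 / q) * (\<integral>\<^sup>+ y. f (y + x) \<partial>\<mu>)"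
    using levy_process_occupation_distribution[OF X \<Psi> q] by auto
  interpret \<mu>: real_distribution \<mu> by fact
  have "char \<mu> = (\<lambda>l. q * (1 / (q + \<Psi> l)))" using \<mu>(2) by auto
  then have intc: "integrable lborel (char \<mu>)"
    using integrable_mult_right[OF int, of "of_real q"] by (simp only:)
  define d where "d = \<mu>.inversion_density"
  define r where "r x = d x / q" for x
  have d: "continuous_on UNIV d" "\<And>x. 0 \<le> d x" "\<mu> = density lborel (\<lambda>x. ennreal (d x))"
    unfolding d_def using \<mu>.continuous_inversion_density[OF intc] \<mu>.inversion_density_nonneg[OF intc]
      \<mu>.eq_density_inversion_density[OF intc] by simp_all
  then have [measurable]: "d \<in> borel_measurable borel"
    by (intro borel_measurable_continuous_onI)
  have r: "continuous_on UNIV r" "\<And>x. 0 \<le> r x"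
    unfolding r_def using d q by (auto intro!: continuous_intros)
  then have [measurable]: "r \<in> borel_measurable borel"
    by (intro borel_measurable_continuous_onI)
  have r_eq: "(\<integral>\<^sup>+ w. (\<integral>\<^sup>+ t\<in>{0..}. ennreal (exp (- q * t)) * f (X t w + x) \<partial>lborel) \<partial>M) =
        (\<integral>\<^sup>+ y. f y * ennreal (r (y - x)) \<partial>lborel)" if [measurable]: "f \<in> borel_measurable borel" for f x
  proof -
    have "ennreal (1 / q) * (\<integral>\<^sup>+ y. f (y + x) \<partial>\<mu>) = ennreal (1 / q) * (\<integral>\<^sup>+ y. ennreal (d y) * f (y + x) \<partial>lborel)"
      by (subst d(3)) (simp add: nn_integral_density)
    also have "\<dots> = (\<integral>\<^sup>+ y. ennreal (1 / q) * (ennreal (d y) * f (y + x)) \<partial>lborel)"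
      by (rule nn_integral_cmult[symmetric]) simp
    \<comment> \<open>Writing \<open>y + x\<close> as \<open>x + 1 * y\<close> exhibits the
      translation as an affine substitution of slope 1.\<close>
    also have "\<dots> = (\<integral>\<^sup>+ y. f (x + 1 * y) * ennreal (r (x + 1 * y - x)) \<partial>lborel)"
    proof (rule nn_integral_cong)
      fix y
      have "ennreal (r y) = ennreal (1 / q) * ennreal (d y)"
        using q d by (simp add: r_def ennreal_mult[symmetric])
      then show "ennreal (1 / q) * (ennreal (d y) * f (y + x)) = f (x + 1 * y) * ennreal (r (x + 1 * y - x))"
        by (simp add: ac_simps)
    qed
    also have "\<dots> = (\<integral>\<^sup>+ y. f y * ennreal (r (y - x)) \<partial>lborel)"
      by (subst nn_integral_real_affine[of "\<lambda>y. f y * ennreal (r (y - x))" 1 x]) simp_all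
    finally show ?thesis using \<mu>(3)[OF that] by simp
  qed
  have isr: "is_resolvent_density M X q r"
    unfolding is_resolvent_density_def using r r_eq by blast
  moreover have "r' = r" if r': "is_resolvent_density M X q r'" for r'
  proof (rule continuous_AE_lborel_eq)
    show "continuous_on UNIV r'" using r' by (simp add: is_resolvent_density_def)
    then have [measurable]: "r' \<in> borel_measurable borel"
      by (intro borel_measurable_continuous_onI)
    have "density lborel (\<lambda>x. ennreal (r' x)) = density lborel (\<lambda>x. ennreal (r x))"
    proof (rule measure_eqI)
      fix A assume "A \<in> sets (density lborel (\<lambda>x. ennreal (r' x)))"
      then have A[measurable]: "A \<in> sets borel" by simp
      have "(\<integral>\<^sup>+ y. indicator A y * ennreal (r' (y - 0)) \<partial>lborel)
          = (\<integral>\<^sup>+ w. (\<integral>\<^sup>+ t\<in>{0..}. ennreal (exp (- q * t)) * indicator A (X t w + 0) \<partial>lborel) \<partial>M)"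
        using r' unfolding is_resolvent_density_def by (elim conjE, drule_tac bspec[where x = "indicator A"], simp, drule_tac spec[where x = 0], simp)
      also have "\<dots> = (\<integral>\<^sup>+ y. indicator A y * ennreal (r (y - 0)) \<partial>lborel)"
        by (rule r_eq) simp
      finally have "(\<integral>\<^sup>+ y. indicator A y * ennreal (r' (y - 0)) \<partial>lborel) = (\<integral>\<^sup>+ y. indicator A y * ennreal (r (y - 0)) \<partial>lborel)" .
      then show "emeasure (density lborel (\<lambda>x. ennreal (r' x))) A = emeasure (density lborel (\<lambda>x. ennreal (r x))) A"
        by (simp add: emeasure_density mult.commute)
    qed simp
    then have "AE x in lborel. ennreal (r' x) = ennreal (r x)"
      by (subst (asm) sigma_finite_measure.density_unique_iff[OF lborel.sigma_finite_measure_axioms]) auto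
    then show "AE x in lborel. r' x = r x"
      by eventually_elim (use r r' in \<open>simp add: is_resolvent_density_def\<close>)
  qed (rule r)
  ultimately have "resolvent_density M X q = r"
    unfolding resolvent_density_def by (rule the_equality)
  moreover have "(\<integral>l. iexp (- (l * x)) * char \<mu> l \<partial>lborel) = q * (\<integral>l. iexp (- (l * x)) / (q + \<Psi> l) \<partial>lborel)"
    unfolding \<mu>(2) by (subst integral_mult_right_zero[symmetric]) (simp add: ac_simps)
  ultimately show ?thesis
    using q by (simp add: r_def d_def \<mu>.inversion_density_def)
qed

section \<open>Potter bounds\<close>

text \<open>The Baire category theorem takes the place of Steinhaus' theorem in the usual proof of the uniform
  convergence theorem for regularly varying functions.\<close>

lemma locally_bounded_increments:
  fixes f :: "real \<Rightarrow> real"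
  assumes cont: "continuous_on {T0..} f"
    and lim: "\<And>s. 0 \<le> s \<Longrightarrow> ((\<lambda>t. f (t + s) - f t) \<longlongrightarrow> \<alpha> * s) at_top"
  obtains T K where "T0 \<le> T" "\<And>t s. T \<le> t \<Longrightarrow> 0 \<le> s \<Longrightarrow> s \<le> 1 \<Longrightarrow> \<bar>f (t + s) - f t\<bar> \<le> K"
proof -
  \<comment> \<open>For \<open>s\<close> in \<open>{0..1}\<close> the limit
    \<open>\<alpha> * s\<close> of the increments lies strictly inside \<open>{- k..k}\<close>, so
    every such \<open>s\<close> eventually satisfies the bound \<open>k\<close>.\<close>
  define k where "k = \<bar>\<alpha>\<bar> + 1"
  define A where "A n = {s\<in>{0..1}. \<forall>t\<ge>T0 + real n. \<bar>f (t + s) - f t\<bar> \<le> k}" for n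
  have A_eq: "A n = (\<Inter>t\<in>{T0 + real n..}. {s\<in>{0..1}. \<bar>f (t + s) - f t\<bar> \<le> k})" for n
    by (auto simp: A_def)
  have closedA: "closed (A n)" for n
    unfolding A_eq
  proof (rule closed_INT, rule ballI)
    fix t assume t: "t \<in> {T0 + real n..}"
    have "continuous_on {0..1} (\<lambda>s. f (t + s))"
      using t by (intro continuous_on_compose2[OF cont] continuous_intros) auto
    then have "continuous_on {0..1} (\<lambda>s. \<bar>f (t + s) - f t\<bar>)"
      by (intro continuous_intros)
    then show "closed {s\<in>{0..1}. \<bar>f (t + s) - f t\<bar> \<le> k}"
      by (rule continuous_on_closed_Collect_le) auto
  qed
  have cover: "\<exists>n. s \<in> A n" if s: "s \<in> {0..1}" for s
  proof -
    have "\<bar>\<alpha> * s\<bar> \<le> \<bar>\<alpha>\<bar> * 1" using s unfolding abs_mult by (intro mult_left_mono) auto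
    then have "\<bar>\<alpha> * s\<bar> < k" by (simp add: k_def)
    then have "\<forall>\<^sub>F t in at_top. \<bar>f (t + s) - f t\<bar> < k"
      using s by (intro order_tendstoD(2)[OF tendsto_rabs[OF lim]]) auto
    then obtain t0 where t0: "\<And>t. t0 \<le> t \<Longrightarrow> \<bar>f (t + s) - f t\<bar> < k"
      by (auto simp: eventually_at_top_linorder)
    obtain n where "t0 - T0 \<le> real n" using real_arch_simple by blast
    then have "s \<in> A n" using t0 s by (auto simp: A_def less_imp_le)
    then show ?thesis ..
  qed
  \<comment> \<open>The closed sets \<open>A n\<close> cover \<open>{0..1}\<close>. If every
    complement were dense in it, their intersection would be dense by Baire's theorem, but it is
    empty. Hence some \<open>A n\<close> contains an interval \<open>{c..d}\<close>.\<close>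
  have "\<exists>n. \<not> {0..1} \<subseteq> closure ({0..1::real} - A n)"
  proof (rule ccontr)
    assume neg: "\<not> ?thesis"
    have "{0..1} \<subseteq> closure (\<Inter>(range (\<lambda>n. {0..1} - A n)))"
    proof (rule Baire)
      fix T assume "T \<in> range (\<lambda>n. {0..1} - A n)"
      then obtain n where T: "T = {0..1} - A n" by auto
      have "openin (top_of_set {0..1}) T"
        unfolding T using closedA[of n]
        by (intro openin_diff) (auto simp: A_def intro!: closed_subset)
      then show "openin (top_of_set {0..1}) T \<and> {0..1} \<subseteq> closure T"
        using neg T by auto
    qed auto
    moreover have "(\<Inter>n. {0..1} - A n) = {}" using cover by auto
    ultimately have "{0..1::real} \<subseteq> {}" by (simp only: closure_empty)
    then show False by auto
  qed
  then obtain n where "\<not> {0..1} \<subseteq> closure ({0..1} - A n)" ..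
  then obtain p where p: "p \<in> {0..1}" "p \<notin> closure ({0..1} - A n)" by blast
  then obtain e where e: "0 < e" "\<And>s. s \<in> {0..1} \<Longrightarrow> \<bar>s - p\<bar> < e \<Longrightarrow> s \<in> A n"
    by (force simp: closure_approachable dist_real_def)
  define c where "c = max 0 (p - e / 2)"
  define d where "d = min 1 (p + e / 2)"
  have cd: "0 \<le> c" "c < d" "d \<le> 1" using p e by (auto simp: c_def d_def)
  have inA: "s \<in> A n" if "c \<le> s" "s \<le> d" for s
    using that e(1) by (intro e(2)) (auto simp: c_def d_def)
  \<comment> \<open>As \<open>c \<le> 1\<close>, the extra 1 keeps \<open>t - c\<close> in the range
    of \<open>A n\<close>. Both \<open>t\<close> and \<open>t + r\<close> are then reached from
    \<open>t - c\<close> by shifts in \<open>{c..d}\<close>, and each of the two increments costs at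
    most \<open>k\<close>.\<close>
  define T where "T = T0 + real n + 1"
  have small: "\<bar>f (t + r) - f t\<bar> \<le> 2 * k" if "T \<le> t" "0 \<le> r" "r \<le> d - c" for t r
  proof -
    have t: "T0 + real n \<le> t - c" using that cd by (simp add: T_def)
    have "\<bar>f ((t - c) + (c + r)) - f (t - c)\<bar> \<le> k" "\<bar>f ((t - c) + c) - f (t - c)\<bar> \<le> k"
      using inA[of "c + r"] inA[of c] that cd t unfolding A_def by auto
    then show ?thesis by simp
  qed
  \<comment> \<open>An increment \<open>s \<le> 1\<close> is cut into \<open>N\<close> equal pieces,
    each of length at most \<open>d - c\<close>.\<close>
  obtain N :: nat where N: "1 / (d - c) \<le> real N" using real_arch_simple by blast
  have N0: "0 < N" using N cd by (metis diff_gt_0_iff_gt divide_pos_pos gr0I not_less of_nat_0 zero_less_one)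
  have "T0 \<le> T" by (simp add: T_def)
  moreover have "\<bar>f (t + s) - f t\<bar> \<le> real N * (2 * k)" if s: "T \<le> t" "0 \<le> s" "s \<le> 1" for t s
  proof -
    define r where "r = s / real N"
    have r: "0 \<le> r" "r \<le> d - c"
    proof -
      have "1 \<le> real N * (d - c)" using N cd by (simp add: field_simps)
      then have "s \<le> real N * (d - c)" using s by simp
      then show "0 \<le> r" "r \<le> d - c" using s N0 by (auto simp: r_def field_simps)
    qed
    have "\<bar>f (t + real m * r) - f t\<bar> \<le> real m * (2 * k)" for m
    proof (induction m)
      case (Suc m)
      have "\<bar>f ((t + real m * r) + r) - f (t + real m * r)\<bar> \<le> 2 * k"
        using s r by (intro small) (auto intro: order_trans)
      then show ?case using Suc by (simp add: algebra_simps)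
    qed simp
    from this[of N] show ?thesis using N0 by (simp add: r_def)
  qed
  ultimately show ?thesis using that by blast
qed

text \<open>Far out, every unit step changes \<open>f\<close> by \<open>\<alpha>\<close> up to an
  error \<open>\<delta>\<close>. The integer part of \<open>s\<close> therefore costs at most
  \<open>\<delta> * s\<close>, and the fractional part is absorbed by the local bound
  \<open>K\<close> and by \<open>\<bar>\<alpha>\<bar>\<close>.\<close>

lemma additive_potter_bound:
  fixes f :: "real \<Rightarrow> real"
  assumes cont: "continuous_on {T0..} f"
    and lim: "\<And>s. 0 \<le> s \<Longrightarrow> ((\<lambda>t. f (t + s) - f t) \<longlongrightarrow> \<alpha> * s) at_top"
    and \<delta>: "0 < \<delta>"
  obtains T C where "T0 \<le> T" "\<And>t s. T \<le> t \<Longrightarrow> 0 \<le> s \<Longrightarrow> \<bar>f (t + s) - f t - \<alpha> * s\<bar> \<le> \<delta> * s + C"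
proof -
  obtain T1 K where K: "T0 \<le> T1" "\<And>t s. T1 \<le> t \<Longrightarrow> 0 \<le> s \<Longrightarrow> s \<le> 1 \<Longrightarrow> \<bar>f (t + s) - f t\<bar> \<le> K"
    using locally_bounded_increments[OF cont lim] by blast
  have "\<forall>\<^sub>F t in at_top. \<bar>(f (t + 1) - f t) - \<alpha>\<bar> < \<delta>"
    using tendstoD[OF lim[of 1] \<delta>] by (simp add: dist_real_def)
  then obtain T2 where T2: "\<And>t. T2 \<le> t \<Longrightarrow> \<bar>f (t + 1) - f t - \<alpha>\<bar> < \<delta>"
    by (auto simp: eventually_at_top_linorder)
  define T where "T = max T1 T2"
  have "\<bar>f (t + s) - f t - \<alpha> * s\<bar> \<le> \<delta> * s + (K + \<bar>\<alpha>\<bar>)" if t: "T \<le> t" and s: "0 \<le> s" for t s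
  proof -
    have n: "\<bar>f (t + real n) - f t - \<alpha> * real n\<bar> \<le> \<delta> * real n" for n
    proof (induction n)
      case (Suc n)
      have "\<bar>f ((t + real n) + 1) - f (t + real n) - \<alpha>\<bar> < \<delta>"
        using t by (intro T2) (auto simp: T_def)
      then show ?case using Suc by (simp add: algebra_simps)
    qed simp
    define n where "n = nat \<lfloor>s\<rfloor>"
    have r: "0 \<le> s - real n" "s - real n \<le> 1" using s unfolding n_def by (simp, linarith)
    have "\<bar>f ((t + real n) + (s - real n)) - f (t + real n)\<bar> \<le> K"
      using t r by (intro K) (auto simp: T_def)
    moreover have "\<bar>\<alpha> * (s - real n)\<bar> \<le> \<bar>\<alpha>\<bar> * 1"
      using r unfolding abs_mult by (intro mult_left_mono) auto
    moreover have "\<alpha> * (s - real n) = \<alpha> * s - \<alpha> * real n" by (simp add: algebra_simps)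
    moreover have "\<delta> * real n \<le> \<delta> * s" using r \<delta> by (intro mult_left_mono) auto
    ultimately show ?thesis using n[of n] by simp
  qed
  then show ?thesis using that[of T "K + \<bar>\<alpha>\<bar>"] K(1) by (simp add: T_def)
qed

text \<open>In the coordinates \<open>f t = ln (\<theta> (exp t))\<close> regular variation becomes
  convergence of increments. The two halves of the additive bound, exponentiated, are the two
  multiplicative bounds.\<close>

lemma potter_bound:
  fixes \<theta> :: "real \<Rightarrow> real"
  assumes cont: "continuous_on {0<..} \<theta>"
    and pos: "\<forall>\<^sub>F x in at_top. 0 < \<theta> x"
    and lim: "\<And>k. 1 \<le> k \<Longrightarrow> ((\<lambda>x. \<theta> (k * x) / \<theta> x) \<longlongrightarrow> k powr \<alpha>) at_top"
    and \<delta>: "0 < \<delta>"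
  obtains B C where "0 < B" "0 < C" "\<And>x. B \<le> x \<Longrightarrow> 0 < \<theta> x"
    "\<And>x y. B \<le> x \<Longrightarrow> x \<le> y \<Longrightarrow> \<theta> y \<le> C * (y / x) powr (\<alpha> + \<delta>) * \<theta> x"
    "\<And>x y. B \<le> x \<Longrightarrow> x \<le> y \<Longrightarrow> \<theta> x \<le> C * (y / x) powr (- \<alpha> + \<delta>) * \<theta> y"
proof -
  obtain x0 where x0: "\<And>x. x0 \<le> x \<Longrightarrow> 0 < \<theta> x"
    using pos by (auto simp: eventually_at_top_linorder)
  define T0 where "T0 = ln (max x0 1)"
  have \<theta>pos: "0 < \<theta> (exp t)" if "T0 \<le> t" for t
  proof -
    have "max x0 1 \<le> exp t" using exp_le_cancel_iff[of T0 t] that by (simp add: T0_def)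
    then show ?thesis using x0 by simp
  qed
  define f where "f t = ln (\<theta> (exp t))" for t
  have f_cont: "continuous_on {T0..} f"
    unfolding f_def using \<theta>pos
    by (intro continuous_on_ln continuous_on_compose2[OF cont] continuous_intros) (auto simp: less_imp_neq[symmetric])
  have f_lim: "((\<lambda>t. f (t + s) - f t) \<longlongrightarrow> \<alpha> * s) at_top" if s: "0 \<le> s" for s
  proof -
    have "((\<lambda>t. \<theta> (exp s * exp t) / \<theta> (exp t)) \<longlongrightarrow> exp s powr \<alpha>) at_top"
      using s by (intro filterlim_compose[OF lim exp_at_top]) auto
    then have "((\<lambda>t. ln (\<theta> (exp s * exp t) / \<theta> (exp t))) \<longlongrightarrow> ln (exp s powr \<alpha>)) at_top"
      by (rule tendsto_ln) simp
    moreover have "\<forall>\<^sub>F t in at_top. ln (\<theta> (exp s * exp t) / \<theta> (exp t)) = f (t + s) - f t"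
      using eventually_ge_at_top[of T0]
    proof eventually_elim
      case (elim t)
      then have "0 < \<theta> (exp (t + s))" "0 < \<theta> (exp t)" using s by (auto intro!: \<theta>pos)
      then show ?case by (simp add: f_def ln_div exp_add mult.commute)
    qed
    ultimately show ?thesis
      by (simp add: ln_powr tendsto_cong)
  qed
  obtain T C where T: "T0 \<le> T" "\<And>t s. T \<le> t \<Longrightarrow> 0 \<le> s \<Longrightarrow> \<bar>f (t + s) - f t - \<alpha> * s\<bar> \<le> \<delta> * s + C"
    using additive_potter_bound[OF f_cont f_lim \<delta>] by blast
  have *: "\<bar>ln (\<theta> y) - ln (\<theta> x) - \<alpha> * ln (y / x)\<bar> \<le> \<delta> * ln (y / x) + C" "0 < \<theta> x" "0 < \<theta> y" "0 < x" "0 < y"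
    if "exp T \<le> x" "x \<le> y" for x y
  proof -
    show xy: "0 < x" "0 < y" using that exp_gt_zero[of T] by linarith+
    have "T \<le> ln x" "ln x \<le> ln y" using that xy by (auto simp: ln_ge_iff)
    moreover from this have "T0 \<le> ln x" "T0 \<le> ln y" using T(1) by linarith+
    ultimately show "\<bar>ln (\<theta> y) - ln (\<theta> x) - \<alpha> * ln (y / x)\<bar> \<le> \<delta> * ln (y / x) + C" "0 < \<theta> x" "0 < \<theta> y"
      using T(2)[of "ln x" "ln y - ln x"] \<theta>pos[of "ln x"] \<theta>pos[of "ln y"] T(1) xy
      by (auto simp: f_def ln_div)
  qed
  show ?thesis
  proof (rule that[of "exp T" "exp C"])
    fix x y assume xy: "exp T \<le> x" "x \<le> y"
    have p: "exp (c * ln (y / x)) = (y / x) powr c" for c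
      using *(4,5)[OF xy] by (simp add: powr_def)
    have "\<theta> y = exp (ln (\<theta> y))" using *(3)[OF xy] by simp
    also have "\<dots> \<le> exp (C + (\<alpha> + \<delta>) * ln (y / x) + ln (\<theta> x))"
      using *(1)[OF xy] by (auto simp: algebra_simps)
    also have "\<dots> = exp C * (y / x) powr (\<alpha> + \<delta>) * \<theta> x"
      using *(2)[OF xy] by (simp add: exp_add p[symmetric] del: distrib_right)
    finally show "\<theta> y \<le> exp C * (y / x) powr (\<alpha> + \<delta>) * \<theta> x" .
    have "\<theta> x = exp (ln (\<theta> x))" using *(2)[OF xy] by simp
    also have "\<dots> \<le> exp (C + (- \<alpha> + \<delta>) * ln (y / x) + ln (\<theta> y))"
      using *(1)[OF xy] by (auto simp: algebra_simps)
    also have "\<dots> = exp C * (y / x) powr (- \<alpha> + \<delta>) * \<theta> y"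
      using *(3)[OF xy] by (simp add: exp_add p[symmetric] del: distrib_right)
    finally show "\<theta> x \<le> exp C * (y / x) powr (- \<alpha> + \<delta>) * \<theta> y" .
  qed (use * in auto)
qed

section \<open>Fractional trigonometric integrals\<close>

lemma nn_integral_Gamma_scaled:
  fixes a c :: real
  assumes a: "0 < a" and c: "0 < c"
  shows "(\<integral>\<^sup>+ t. ennreal (indicator {0<..} t * (t powr (a - 1) * exp (- (c * t)))) \<partial>lborel) = ennreal (Gamma a * c powr (- a))"
proof -
  let ?J = "\<integral>\<^sup>+ t. ennreal (indicator {0<..} t * (t powr (a - 1) * exp (- (c * t)))) \<partial>lborel"
  have "ennreal (Gamma a) = (\<integral>\<^sup>+ t. ennreal (indicator {0..} t * t powr (a - 1) / exp t) \<partial>lborel)"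
    by (rule Gamma_conv_nn_integral_real[OF a])
  also have "\<dots> = (\<integral>\<^sup>+ t. ennreal (indicator {0<..} t * (t powr (a - 1) * exp (- t))) \<partial>lborel)"
  proof (rule nn_integral_cong_AE)
    have "AE t in lborel. t \<noteq> (0::real)" by (rule AE_lborel_singleton)
    then show "AE t in lborel. ennreal (indicator {0..} t * t powr (a - 1) / exp t)
        = ennreal (indicator {0<..} t * (t powr (a - 1) * exp (- t)))"
      by eventually_elim (auto simp: indicator_def exp_minus field_simps)
  qed
  also have "\<dots> = ennreal \<bar>c\<bar> * (\<integral>\<^sup>+ t. ennreal (indicator {0<..} (0 + c * t) * ((0 + c * t) powr (a - 1) * exp (- (0 + c * t)))) \<partial>lborel)"
    using c by (intro nn_integral_real_affine) auto
  also have "\<dots> = ennreal \<bar>c\<bar> * (\<integral>\<^sup>+ t. ennreal (c powr (a - 1)) * ennreal (indicator {0<..} t * (t powr (a - 1) * exp (- (c * t)))) \<partial>lborel)"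
    using c by (intro arg_cong2[where f = times] refl nn_integral_cong)
      (auto simp: indicator_def powr_mult ennreal_mult[symmetric] zero_less_mult_iff)
  also have "\<dots> = ennreal \<bar>c\<bar> * (ennreal (c powr (a - 1)) * ?J)"
    by (subst nn_integral_cmult) auto
  also have "\<dots> = ennreal (c powr a) * ?J"
    using c by (simp add: mult.assoc[symmetric] ennreal_mult[symmetric] powr_diff)
  finally have "ennreal (c powr (- a)) * ennreal (Gamma a) = (ennreal (c powr (- a)) * ennreal (c powr a)) * ?J"
    by (simp add: mult.assoc)
  also have "ennreal (c powr (- a)) * ennreal (c powr a) = 1"
    using c by (simp add: ennreal_mult[symmetric] powr_add[symmetric])
  finally show ?thesis
    using c a by (simp add: ennreal_mult[symmetric] mult.commute)
qed

text \<open>Write \<open>1 / (1 + w)\<close> as the integral of \<open>exp (- ((1 + w) * y))\<close>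
  over \<open>y > 0\<close>. Tonelli's theorem separates the double integral into
  \<open>Gamma a * Gamma (1 - a)\<close>, which the reflection formula evaluates.\<close>

lemma nn_integral_powr_divide_1_plus:
  fixes a :: real
  assumes a: "0 < a" "a < 1"
  shows "(\<integral>\<^sup>+ w. ennreal (indicator {0<..} w * (w powr (a - 1) / (1 + w))) \<partial>lborel) = ennreal (pi / sin (pi * a))"
proof -
  let ?k = "\<lambda>w y. ennreal (indicator {0<..} w * indicator {0<..} y * (w powr (a - 1) * exp (- ((1 + w) * y))))"
  have "(\<integral>\<^sup>+ w. ennreal (indicator {0<..} w * (w powr (a - 1) / (1 + w))) \<partial>lborel)
      = (\<integral>\<^sup>+ w. (\<integral>\<^sup>+ y. ?k w y \<partial>lborel) \<partial>lborel)"
  proof (rule nn_integral_cong)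
    fix w :: real
    show "ennreal (indicator {0<..} w * (w powr (a - 1) / (1 + w))) = (\<integral>\<^sup>+ y. ?k w y \<partial>lborel)"
    proof (cases "0 < w")
      case True
      have "(\<integral>\<^sup>+ y. ?k w y \<partial>lborel) = (\<integral>\<^sup>+ y. ennreal (w powr (a - 1)) * ennreal (indicator {0<..} y * (y powr (1 - 1) * exp (- ((1 + w) * y)))) \<partial>lborel)"
        using True by (intro nn_integral_cong) (auto simp: indicator_def ennreal_mult[symmetric])
      also have "\<dots> = ennreal (w powr (a - 1)) * ennreal (Gamma 1 * (1 + w) powr (- 1))"
        using True by (subst nn_integral_cmult, simp, subst nn_integral_Gamma_scaled) simp_all
      finally show ?thesis
        using True by (simp add: ennreal_mult[symmetric] powr_minus divide_inverse)
    qed (simp add: indicator_def)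
  qed
  also have "\<dots> = (\<integral>\<^sup>+ y. (\<integral>\<^sup>+ w. ?k w y \<partial>lborel) \<partial>lborel)"
    by (rule lborel_pair.Fubini') simp
  also have "\<dots> = (\<integral>\<^sup>+ y. ennreal (Gamma a) * ennreal (indicator {0<..} y * (y powr ((1 - a) - 1) * exp (- (1 * y)))) \<partial>lborel)"
  proof (rule nn_integral_cong)
    fix y :: real
    show "(\<integral>\<^sup>+ w. ?k w y \<partial>lborel) = ennreal (Gamma a) * ennreal (indicator {0<..} y * (y powr ((1 - a) - 1) * exp (- (1 * y))))"
    proof (cases "0 < y")
      case True
      have "(\<integral>\<^sup>+ w. ?k w y \<partial>lborel) = (\<integral>\<^sup>+ w. ennreal (exp (- y)) * ennreal (indicator {0<..} w * (w powr (a - 1) * exp (- (y * w)))) \<partial>lborel)"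
        using True by (intro nn_integral_cong)
          (auto simp: indicator_def ennreal_mult[symmetric] exp_add[symmetric] algebra_simps)
      also have "\<dots> = ennreal (exp (- y)) * ennreal (Gamma a * y powr (- a))"
        using True a by (subst nn_integral_cmult) (auto simp: nn_integral_Gamma_scaled)
      finally show ?thesis
        using True a by (simp add: ennreal_mult[symmetric] ac_simps)
    qed (simp add: indicator_def)
  qed
  also have "\<dots> = ennreal (Gamma a) * ennreal (Gamma (1 - a) * 1 powr (- (1 - a)))"
    using a nn_integral_Gamma_scaled[of "1 - a" 1] by (subst nn_integral_cmult) auto
  also have "\<dots> = ennreal (Gamma a * Gamma (1 - a))"
    using a by (simp add: ennreal_mult)
  also have "Gamma a * Gamma (1 - a) = pi / sin (pi * a)"
  proof -
    have "complex_of_real (Gamma a * Gamma (1 - a)) = of_real (pi / sin (pi * a))"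
      using Gamma_reflection_complex[of "of_real a"]
      by (simp add: Gamma_complex_of_real[symmetric] sin_of_real[symmetric])
    then show ?thesis by (simp only: of_real_eq_iff)
  qed
  finally show ?thesis .
qed

text \<open>The substitution \<open>t = sqrt w\<close> reduces this to the preceding integral with
  \<open>a = s / 2\<close>. The range of \<open>s\<close> contains both \<open>\<alpha> - 1\<close>
  and \<open>\<alpha>\<close>, the exponents of the real and imaginary parts later on.\<close>

lemma integral_powr_divide_1_plus_square:
  fixes s :: real
  assumes s: "0 < s" "s < 2"
  shows "set_integrable lborel {0<..} (\<lambda>t. t powr (s - 1) / (1 + t\<^sup>2))"
    and "(LBINT t:{0<..}. t powr (s - 1) / (1 + t\<^sup>2)) = pi / (2 * sin (pi * s / 2))"
proof -
  let ?g = "\<lambda>w::real. w powr (s / 2 - 1) / (1 + w)"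
  have nonneg: "0 \<le> indicator {0<..} w * ?g w" for w by (auto simp: indicator_def)
  have sin: "0 < sin (pi * (s / 2))" using s by (intro sin_gt_zero) auto
  have nn: "(\<integral>\<^sup>+ w. ennreal (indicator {0<..} w * ?g w) \<partial>lborel) = ennreal (pi / sin (pi * (s / 2)))"
    using nn_integral_powr_divide_1_plus[of "s / 2"] s by simp
  have hb: "has_bochner_integral lborel (\<lambda>w. indicator {0<..} w * ?g w) (pi / sin (pi * (s / 2)))"
    by (rule has_bochner_integral_nn_integral) (use nn nonneg sin in auto)
  have I: "set_integrable lborel {0<..} ?g" and V: "(LBINT w:{0<..}. ?g w) = pi / sin (pi * (s / 2))"
    using hb by (auto simp: set_integrable_def set_lebesgue_integral_def has_bochner_integral_iff)
  let ?f = "\<lambda>t::real. t powr (s - 1) / (1 + t\<^sup>2)"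
  let ?g' = "\<lambda>x. inverse (sqrt x) / 2"
  have ein: "einterval 0 \<infinity> = {0<..}" by (auto simp: einterval_def zero_ereal_def)
  have fg: "?f (sqrt x) * ?g' x = ?g x / 2" if "0 < x" for x
  proof -
    have "sqrt x powr (s - 1) * inverse (sqrt x) = x powr (s / 2 - 1)"
      using that by (simp add: powr_half_sqrt[symmetric] powr_powr powr_minus[symmetric] powr_add[symmetric] field_simps)
    then show ?thesis using that by (simp add: field_simps)
  qed
  have g_deriv: "DERIV sqrt x :> ?g' x" if "0 < ereal x" for x
    using that DERIV_real_sqrt[of x] by (simp add: zero_ereal_def)
  have g'_cont: "isCont ?g' x" if "0 < ereal x" for x
    using that by (intro continuous_intros) (auto simp: zero_ereal_def)
  have f_cont: "isCont ?f (sqrt x)" if "0 < ereal x" for x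
    using that by (intro continuous_intros) (auto simp: zero_ereal_def add_nonneg_eq_0_iff)
  have lim_0: "((ereal \<circ> sqrt \<circ> real_of_ereal) \<longlongrightarrow> 0) (at_right 0)"
  proof -
    have "(sqrt \<longlongrightarrow> sqrt 0) (at_right 0)"
      by (intro tendsto_intros)
    then show ?thesis by (simp add: zero_ereal_def ereal_tendsto_simps comp_assoc)
  qed
  have lim_inf: "((ereal \<circ> sqrt \<circ> real_of_ereal) \<longlongrightarrow> \<infinity>) (at_left \<infinity>)"
    using sqrt_at_top by (simp add: at_left_PInf filterlim_filtermap comp_def tendsto_PInfty_eq_at_top)
  have "set_integrable lborel {0<..} (\<lambda>x. ?g x / 2)"
    using I by (intro set_integrable_divide)
  then have fg_int: "set_integrable lborel (einterval 0 \<infinity>) (\<lambda>x. ?f (sqrt x) * ?g' x)"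
    unfolding ein by (rule set_integrable_cong[THEN iffD1, rotated 3]) (simp_all only: fg greaterThan_iff)
  note sub = interval_integral_substitution_nonneg[where f = ?f, OF _ g_deriv f_cont g'_cont _ _ lim_0 lim_inf fg_int]
  have sub: "set_integrable lborel (einterval 0 \<infinity>) ?f"
    "(LBINT t=0..\<infinity>. ?f t) = (LBINT x=0..\<infinity>. ?f (sqrt x) * ?g' x)"
    by (rule sub; simp add: zero_ereal_def)+
  show "set_integrable lborel {0<..} ?f" using sub(1) by (simp add: ein)
  have "(LBINT t:{0<..}. ?f t) = (LBINT x:{0<..}. ?f (sqrt x) * ?g' x)"
    using sub(2) by (simp only: interval_lebesgue_integral_def ein) simp
  also have "\<dots> = (LBINT x:{0<..}. ?g x / 2)"
    by (rule set_lebesgue_integral_cong, simp) (metis fg greaterThan_iff)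
  also have "\<dots> = (LBINT x:{0<..}. ?g x) / 2"
    by (rule set_integral_divide_zero)
  also have "\<dots> = pi / sin (pi * (s / 2)) / 2" by (simp only: V)
  finally show "(LBINT t:{0<..}. ?f t) = pi / (2 * sin (pi * s / 2))" by simp
qed

section \<open>Powers near the origin and near infinity, and the oscillatory integral\<close>

lemma set_integrable_lborel_if_integrable_on:
  fixes f :: "real \<Rightarrow> real"
  assumes "f integrable_on S" "\<And>x. x \<in> S \<Longrightarrow> 0 \<le> f x" "S \<in> sets borel" "f \<in> borel_measurable borel"
  shows "set_integrable lborel S f"
proof -
  have "f absolutely_integrable_on S"
    using assms by (intro nonnegative_absolutely_integrable_1) auto
  then show ?thesis
    using assms unfolding set_integrable_def by (subst (asm) integrable_completion) auto
qed

lemma set_integrable_powr_0_1: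
  assumes "-1 < (a::real)"
  shows "set_integrable lborel {0<..1} (\<lambda>x. x powr a)"
proof -
  have "(\<lambda>x. x powr a) integrable_on {0..1}"
    using assms by (intro integrable_on_powr_from_0) auto
  then have "set_integrable lborel {0..1} (\<lambda>x. x powr a)"
    by (rule set_integrable_lborel_if_integrable_on) auto
  then show ?thesis by (rule set_integrable_subset) auto
qed

lemma set_integrable_powr_1_inf:
  assumes "(a::real) < -1"
  shows "set_integrable lborel {1..} (\<lambda>x. x powr a)"
  using has_integral_powr_to_inf[of a 1] assms
  by (intro set_integrable_lborel_if_integrable_on) (auto simp: integrable_on_def)

lemma cmod_1_minus_iexp_le: "cmod (1 - iexp x) \<le> min 2 \<bar>x\<bar>"
proof -
  have "cmod (iexp x - (\<Sum>k\<le>0. (\<i> * x) ^ k / fact k)) \<le> \<bar>x\<bar> ^ Suc 0 / fact (Suc 0)"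
    by (rule iexp_approx1)
  then have "cmod (1 - iexp x) \<le> \<bar>x\<bar>" by (simp add: norm_minus_commute)
  moreover have "cmod (1 - iexp x) \<le> 2"
    by (rule norm_triangle_le_diff) simp
  ultimately show ?thesis by simp
qed

text \<open>This is the shape of the dominating function produced by the Potter bounds, with
  \<open>b = \<alpha> + \<delta>\<close> and \<open>c = \<alpha> - \<delta>\<close>. Near 0 the
  factor \<open>min 2 x\<close> gains one power, whence \<open>b < 2\<close>; at infinity it is
  constant, whence \<open>1 < c\<close>.\<close>

lemma set_integrable_min_powr:
  fixes b c :: real
  assumes "b < 2" "1 < c"
  shows "set_integrable lborel {0<..} (\<lambda>x. min 2 x * (if x \<le> 1 then x powr (- b) else x powr (- c)))"
proof -
  have "set_integrable lborel {0<..1} (\<lambda>x. min 2 x * (if x \<le> 1 then x powr (- b) else x powr (- c)))"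
  proof (rule set_integrable_cong[THEN iffD1])
    show "set_integrable lborel {0<..1} (\<lambda>x. x powr (1 - b))"
      using assms by (intro set_integrable_powr_0_1) auto
  qed (auto simp: powr_diff powr_minus field_simps)
  moreover have "set_integrable lborel {1<..} (\<lambda>x. min 2 x * (if x \<le> 1 then x powr (- b) else x powr (- c)))"
  proof (rule set_integrable_bound)
    have "set_integrable lborel {1..} (\<lambda>x. 2 * x powr (- c))"
      using assms by (intro set_integrable_mult_right set_integrable_powr_1_inf) auto
    then show "set_integrable lborel {1<..} (\<lambda>x. 2 * x powr (- c))"
      by (rule set_integrable_subset) auto
  qed (auto simp: set_borel_measurable_def abs_mult intro!: AE_I2 mult_right_mono)
  ultimately have "set_integrable lborel ({0<..1} \<union> {1<..}) (\<lambda>x. min 2 x * (if x \<le> 1 then x powr (- b) else x powr (- c)))"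
    by (rule set_integrable_Un) auto
  moreover have "{0<..1} \<union> {1<..} = {0::real<..}" by auto
  ultimately show ?thesis by simp
qed

text \<open>With \<open>x powr (- \<alpha>)\<close> replaced by its Gamma integral, the norm of the
  kernel \<open>?k x t\<close> integrates over \<open>t\<close> to \<open>Gamma \<alpha>\<close>
  times the norm of the original integrand, so Fubini's theorem applies. The inner integral over
  \<open>x\<close> is rational in \<open>t\<close> up to a power of \<open>t\<close>; its real and
  imaginary parts lead to the previous integral at \<open>\<alpha> - 1\<close> and at
  \<open>\<alpha>\<close>.\<close>

lemma integral_1_minus_iexp_powr:
  fixes \<alpha> :: real
  assumes \<alpha>: "1 < \<alpha>" "\<alpha> < 2"
  shows "set_integrable lborel {0<..} (\<lambda>x. (1 - iexp x) * of_real (x powr (- \<alpha>)))"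
    and "(CLBINT x:{0<..}. (1 - iexp x) * of_real (x powr (- \<alpha>))) =
      Complex (pi / (2 * Gamma \<alpha> * sin (pi * (\<alpha> - 1) / 2))) (- pi / (2 * Gamma \<alpha> * sin (pi * \<alpha> / 2)))"
proof -
  show I: "set_integrable lborel {0<..} (\<lambda>x. (1 - iexp x) * of_real (x powr (- \<alpha>)))"
  proof (rule set_integrable_bound[OF set_integrable_min_powr[of \<alpha> \<alpha>]])
    show "AE x in lborel. x \<in> {0<..} \<longrightarrow> norm ((1 - iexp x) * of_real (x powr (- \<alpha>)))
       \<le> norm (min 2 x * (if x \<le> 1 then x powr (- \<alpha>) else x powr (- \<alpha>)))"
    proof (intro AE_I2 impI)
      fix x :: real assume x: "x \<in> {0<..}"
      have "cmod (1 - iexp x) \<le> min 2 x"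
        using cmod_1_minus_iexp_le[of x] x by simp
      then have "cmod (1 - iexp x) * x powr (- \<alpha>) \<le> min 2 x * x powr (- \<alpha>)"
        by (rule mult_right_mono) simp
      then show "norm ((1 - iexp x) * of_real (x powr (- \<alpha>)))
         \<le> norm (min 2 x * (if x \<le> 1 then x powr (- \<alpha>) else x powr (- \<alpha>)))"
        using x by (simp add: norm_mult)
    qed
  qed (use \<alpha> in \<open>auto simp: set_borel_measurable_def\<close>)
  let ?k = "\<lambda>x t. (indicator {0<..} x * indicator {0<..} t * (t powr (\<alpha> - 1) * exp (- (x * t)))) *\<^sub>R (1 - iexp x)"
  have G: "has_bochner_integral lborel (\<lambda>t. indicator {0<..} t * (t powr (\<alpha> - 1) * exp (- (x * t)))) (Gamma \<alpha> * x powr (- \<alpha>))"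
    if "0 < x" for x
    by (rule has_bochner_integral_nn_integral)
       (use \<alpha> that nn_integral_Gamma_scaled[of \<alpha> x] in \<open>auto simp: indicator_def Gamma_real_nonneg\<close>)
  have Gx: "has_bochner_integral lborel (\<lambda>t. indicator {0<..} x * indicator {0<..} t * (t powr (\<alpha> - 1) * exp (- (x * t))))
      (indicator {0<..} x * (Gamma \<alpha> * x powr (- \<alpha>)))" for x
    using G[of x] by (cases "0 < x") (auto simp: mult.assoc)
  have int: "integrable (lborel \<Otimes>\<^sub>M lborel) (\<lambda>(x, t). ?k x t)"
  proof (rule lborel_pair.Fubini_integrable)
    have "(\<integral>t. norm (?k x t) \<partial>lborel) = Gamma \<alpha> * norm (indicator {0<..} x *\<^sub>R ((1 - iexp x) * of_real (x powr (- \<alpha>))))" for x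
    proof -
      have "norm (?k x t) = indicator {0<..} x * indicator {0<..} t * (t powr (\<alpha> - 1) * exp (- (x * t))) * norm (1 - iexp x)" for t
        by (simp add: indicator_def)
      then have "(\<integral>t. norm (?k x t) \<partial>lborel) = (indicator {0<..} x * (Gamma \<alpha> * x powr (- \<alpha>))) * norm (1 - iexp x)"
        by (simp only: integral_mult_left_zero has_bochner_integral_integral_eq[OF Gx])
      moreover have "norm (indicator {0<..} x *\<^sub>R ((1 - iexp x) * of_real (x powr (- \<alpha>))))
          = indicator {0<..} x * x powr (- \<alpha>) * norm (1 - iexp x)"
        by (simp add: norm_mult)
      ultimately show ?thesis by (simp only: ac_simps)
    qed
    moreover have "integrable lborel (\<lambda>x. Gamma \<alpha> * norm (indicator {0<..} x *\<^sub>R ((1 - iexp x) * of_real (x powr (- \<alpha>)))))"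
      using I unfolding set_integrable_def by (intro integrable_mult_right integrable_norm)
    ultimately show "integrable lborel (\<lambda>x. \<integral>t. norm (case (x, t) of (x, t) \<Rightarrow> ?k x t) \<partial>lborel)"
      by simp
    have "integrable lborel (?k x)" for x
      using Gx[of x] by (intro integrable_scaleR_left) (auto simp: has_bochner_integral_iff)
    then show "AE x in lborel. integrable lborel (\<lambda>t. case (x, t) of (x, t) \<Rightarrow> ?k x t)"
      by simp
  qed (simp add: case_prod_unfold)
  have "Gamma \<alpha> * (CLBINT x:{0<..}. (1 - iexp x) * of_real (x powr (- \<alpha>))) = (\<integral>x. (\<integral>t. ?k x t \<partial>lborel) \<partial>lborel)"
  proof -
    have "(\<integral>t. ?k x t \<partial>lborel) = Gamma \<alpha> * (indicator {0<..} x *\<^sub>R ((1 - iexp x) * of_real (x powr (- \<alpha>))))" for x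
      using has_bochner_integral_integral_eq[OF has_bochner_integral_scaleR_left[OF Gx[of x], of "1 - iexp x"]]
      by (simp add: scaleR_conv_of_real ac_simps)
    then show ?thesis by (simp only: set_lebesgue_integral_def integral_mult_right_zero)
  qed
  also have "\<dots> = (\<integral>t. (\<integral>x. ?k x t \<partial>lborel) \<partial>lborel)"
    by (rule lborel_pair.Fubini_integral[OF int, symmetric])
  also have "\<dots> = (\<integral>t. of_real (indicator {0<..} t * (t powr ((\<alpha> - 1) - 1) / (1 + t\<^sup>2))) - \<i> * of_real (indicator {0<..} t * (t powr (\<alpha> - 1) / (1 + t\<^sup>2))) \<partial>lborel)"
  proof (rule Bochner_Integration.integral_cong[OF refl])
    fix t :: real
    show "(\<integral>x. ?k x t \<partial>lborel) = of_real (indicator {0<..} t * (t powr ((\<alpha> - 1) - 1) / (1 + t\<^sup>2))) - \<i> * of_real (indicator {0<..} t * (t powr (\<alpha> - 1) / (1 + t\<^sup>2)))"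
    proof (cases "0 < t")
      case True
      \<comment> \<open>The terms 1 and \<open>iexp x\<close> become Laplace transforms at
        \<open>0\<close> and \<open>- \<i>\<close>. The exponential density carries a factor
        \<open>t\<close>, which is compensated by the division by \<open>t\<close> below.\<close>
      let ?e = "\<lambda>(z::complex) (x::real). exponential_density t x *\<^sub>R exp (- of_real x * z)"
      have ie: "integrable lborel (exponential_density t)"
        using True prob_space.emeasure_space_1[OF prob_space_exponential_density[OF True]]
        by (intro integrableI_nonneg) (auto simp: emeasure_density exponential_density_nonneg)
      have ez: "integrable lborel (?e z)" if "Re z = 0" for z
        by (rule Bochner_Integration.integrable_bound[OF ie]) (use that in \<open>auto intro!: AE_I2\<close>)
      have "(\<integral>x. ?k x t \<partial>lborel) = (\<integral>x. of_real (t powr (\<alpha> - 1) / t) * (?e 0 x - ?e (- \<i>) x) \<partial>lborel)"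
      proof (rule integral_cong_AE)
        have "AE x in lborel. x \<noteq> (0::real)" by (rule AE_lborel_singleton)
        then show "AE x in lborel. ?k x t = of_real (t powr (\<alpha> - 1) / t) * (?e 0 x - ?e (- \<i>) x)"
          by eventually_elim (use True in \<open>auto simp: indicator_def exponential_density_def scaleR_conv_of_real field_simps\<close>)
      qed simp_all
      also have "\<dots> = of_real (t powr (\<alpha> - 1) / t) * ((\<integral>x. ?e 0 x \<partial>lborel) - (\<integral>x. ?e (- \<i>) x \<partial>lborel))"
      proof -
        have "(\<integral>x. ?e 0 x - ?e (- \<i>) x \<partial>lborel) = (\<integral>x. ?e 0 x \<partial>lborel) - (\<integral>x. ?e (- \<i>) x \<partial>lborel)"
          by (intro Bochner_Integration.integral_diff ez) simp_all
        then show ?thesis by (simp only: integral_mult_right_zero)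
      qed
      also have "\<dots> = of_real (t powr (\<alpha> - 1) / t) * (of_real t / (of_real t + 0) - of_real t / (of_real t + - \<i>))"
      proof -
        have "(\<integral>x. ?e 0 x \<partial>lborel) = of_real t / (of_real t + 0)"
          by (rule integral_exponential_density_exp) (use True in auto)
        moreover have "(\<integral>x. ?e (- \<i>) x \<partial>lborel) = of_real t / (of_real t + - \<i>)"
          by (rule integral_exponential_density_exp) (use True in auto)
        ultimately show ?thesis by (simp only:)
      qed
      also have "of_real t / (of_real t + 0) - of_real t / (of_real t + - \<i>) = (1 - \<i> * of_real t) / of_real (1 + t\<^sup>2)"
      proof -
        have "of_real t - \<i> \<noteq> 0" by (auto simp: complex_eq_iff)
        moreover have "complex_of_real (1 + t\<^sup>2) = (of_real t - \<i>) * (of_real t + \<i>)"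
          by (simp add: algebra_simps power2_eq_square)
        moreover have "complex_of_real (1 + t\<^sup>2) \<noteq> 0"
          by (simp only: of_real_eq_0_iff) (simp add: add_nonneg_eq_0_iff)
        ultimately show ?thesis
          using True by (simp add: divide_simps) (simp add: algebra_simps power2_eq_square)
      qed
      also have "of_real (t powr (\<alpha> - 1) / t) * ((1 - \<i> * of_real t) / of_real (1 + t\<^sup>2)) =
          of_real (t powr ((\<alpha> - 1) - 1) / (1 + t\<^sup>2)) - \<i> * of_real (t powr (\<alpha> - 1) / (1 + t\<^sup>2))"
      proof -
        have "t powr ((\<alpha> - 1) - 1) = t powr (\<alpha> - 1) / t"
          using True powr_diff[of t "\<alpha> - 1" 1] by simp
        moreover have "(p / u) * ((1 - \<i> * u) / d) = (p / u) / d - \<i> * (p / d)" if "u \<noteq> 0" for p u d :: complex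
          using that by (simp add: diff_divide_distrib right_diff_distrib)
        from this[of "of_real t"]
        have "(p / of_real t) * ((1 - \<i> * of_real t) / d) = (p / of_real t) / d - \<i> * (p / d)" for p d
          using True by simp
        ultimately show ?thesis by (simp only: of_real_divide)
      qed
      finally show ?thesis using True by simp
    qed (simp add: indicator_def)
  qed
  also have "\<dots> = of_real (pi / (2 * sin (pi * (\<alpha> - 1) / 2))) - \<i> * of_real (pi / (2 * sin (pi * \<alpha> / 2)))"
  proof -
    have "integrable lborel (\<lambda>t. indicator {0<..} t * (t powr ((\<alpha> - 1) - 1) / (1 + t\<^sup>2)))"
      "integrable lborel (\<lambda>t. indicator {0<..} t * (t powr (\<alpha> - 1) / (1 + t\<^sup>2)))"
      "(\<integral>t. indicator {0<..} t * (t powr ((\<alpha> - 1) - 1) / (1 + t\<^sup>2)) \<partial>lborel) = pi / (2 * sin (pi * (\<alpha> - 1) / 2))"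
      "(\<integral>t. indicator {0<..} t * (t powr (\<alpha> - 1) / (1 + t\<^sup>2)) \<partial>lborel) = pi / (2 * sin (pi * \<alpha> / 2))"
      using integral_powr_divide_1_plus_square[of "\<alpha> - 1"] integral_powr_divide_1_plus_square[of \<alpha>] \<alpha>
      by (simp_all add: set_integrable_def set_lebesgue_integral_def)
    then show ?thesis
      by (subst Bochner_Integration.integral_diff) (simp_all only: integral_mult_right_zero integral_complex_of_real integrable_mult_right integrable_of_real)
  qed
  finally have *: "Gamma \<alpha> * (CLBINT x:{0<..}. (1 - iexp x) * of_real (x powr (- \<alpha>)))
     = of_real (pi / (2 * sin (pi * (\<alpha> - 1) / 2))) - \<i> * of_real (pi / (2 * sin (pi * \<alpha> / 2)))" .
  have "0 < Gamma \<alpha>" using \<alpha> by (intro Gamma_real_pos) auto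
  then have "(CLBINT x:{0<..}. (1 - iexp x) * of_real (x powr (- \<alpha>)))
     = (of_real (pi / (2 * sin (pi * (\<alpha> - 1) / 2))) - \<i> * of_real (pi / (2 * sin (pi * \<alpha> / 2)))) / Gamma \<alpha>"
    unfolding *[symmetric] by simp
  also have "\<dots> = Complex (pi / (2 * Gamma \<alpha> * sin (pi * (\<alpha> - 1) / 2))) (- pi / (2 * Gamma \<alpha> * sin (pi * \<alpha> / 2)))"
    by (simp add: complex_eq_iff Re_divide_of_real Im_divide_of_real mult.commute mult.left_commute)
  finally show "(CLBINT x:{0<..}. (1 - iexp x) * of_real (x powr (- \<alpha>))) =
      Complex (pi / (2 * Gamma \<alpha> * sin (pi * (\<alpha> - 1) / 2))) (- pi / (2 * Gamma \<alpha> * sin (pi * \<alpha> / 2)))" .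
qed

section \<open>Regularly varying exponents\<close>

lemma cos_ge_1_minus_half_square: "1 - cos y \<le> y\<^sup>2 / (2::real)"
proof -
  have "1 - cos y = 2 * (sin (y / 2))\<^sup>2"
    using cos_double_sin[of "y / 2"] by simp
  also have "(sin (y / 2))\<^sup>2 \<le> (y / 2)\<^sup>2"
    by (metis abs_le_square_iff abs_sin_x_le_abs_x)
  finally show ?thesis by (simp add: power2_eq_square)
qed

text \<open>Both right-hand sides are free of \<open>q\<close>: with \<open>0 < Re z\<close>, adding
  \<open>q\<close> enlarges the modulus of the denominator, and the quotient of its real part by its
  squared modulus stays below \<open>1 / Re z\<close>. The first bound, which keeps the cosine and
  sine contributions apart, is for low frequencies; the second is for high ones.\<close>

lemma abs_Re_1_minus_iexp_divide_le:
  assumes q: "0 \<le> q" and z: "0 < Re z"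
  shows "\<bar>Re ((1 - iexp y) / (of_real q + z))\<bar> \<le> y\<^sup>2 / (2 * Re z) + \<bar>y\<bar> * \<bar>Im (1 / z)\<bar>"
    and "\<bar>Re ((1 - iexp y) / (of_real q + z))\<bar> \<le> min 2 \<bar>y\<bar> / cmod z"
proof -
  define A where "A = q + Re z"
  define B where "B = Im z"
  have A: "0 < A" "Re z \<le> A" "0 < Re z" using q z by (auto simp: A_def)
  have D: "0 < (Re z)\<^sup>2 + B\<^sup>2" "(Re z)\<^sup>2 + B\<^sup>2 \<le> A\<^sup>2 + B\<^sup>2" "0 < A\<^sup>2 + B\<^sup>2"
    using A by (auto intro!: add_pos_nonneg power_mono)
  have Re_eq: "Re ((1 - iexp y) / (of_real q + z)) = (1 - cos y) * A / (A\<^sup>2 + B\<^sup>2) - sin y * B / (A\<^sup>2 + B\<^sup>2)"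
    by (simp add: Re_divide A_def B_def Re_exp Im_exp diff_divide_distrib[symmetric])
  have "A / (A\<^sup>2 + B\<^sup>2) \<le> A / A\<^sup>2"
    using A D by (intro divide_left_mono) auto
  also have "A / A\<^sup>2 \<le> 1 / Re z"
    using A by (simp add: power2_eq_square field_simps)
  finally have "A / (A\<^sup>2 + B\<^sup>2) \<le> 1 / Re z" .
  then have "(1 - cos y) * (A / (A\<^sup>2 + B\<^sup>2)) \<le> (y\<^sup>2 / 2) * (1 / Re z)"
    using A D by (intro mult_mono cos_ge_1_minus_half_square) auto
  then have 1: "(1 - cos y) * A / (A\<^sup>2 + B\<^sup>2) \<le> y\<^sup>2 / (2 * Re z)"
    by simp
  have num0: "0 \<le> (1 - cos y) * A / (A\<^sup>2 + B\<^sup>2)" using A D by simp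
  have "\<bar>sin y * B / (A\<^sup>2 + B\<^sup>2)\<bar> = \<bar>sin y\<bar> * (\<bar>B\<bar> / (A\<^sup>2 + B\<^sup>2))"
    using D by (simp add: abs_mult)
  also have "\<dots> \<le> \<bar>y\<bar> * (\<bar>B\<bar> / ((Re z)\<^sup>2 + B\<^sup>2))"
    using D by (intro mult_mono abs_sin_x_le_abs_x divide_left_mono) auto
  also have "\<bar>B\<bar> / ((Re z)\<^sup>2 + B\<^sup>2) = \<bar>Im (1 / z)\<bar>"
    using D by (simp add: Im_divide B_def)
  finally show "\<bar>Re ((1 - iexp y) / (of_real q + z))\<bar> \<le> y\<^sup>2 / (2 * Re z) + \<bar>y\<bar> * \<bar>Im (1 / z)\<bar>"
    unfolding Re_eq using 1 num0 by linarith
  have "cmod z \<le> cmod (of_real q + z)"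
    unfolding cmod_def using D by (simp add: A_def B_def)
  moreover have "0 < cmod z" using z by auto
  ultimately have "cmod ((1 - iexp y) / (of_real q + z)) \<le> min 2 \<bar>y\<bar> / cmod z"
    unfolding norm_divide by (intro frac_le cmod_1_minus_iexp_le) auto
  then show "\<bar>Re ((1 - iexp y) / (of_real q + z))\<bar> \<le> min 2 \<bar>y\<bar> / cmod z"
    using abs_Re_le_cmod order_trans by blast
qed

text \<open>The slowly varying function has disappeared: \<open>Re \<circ> \<Psi>\<close> itself,
  which is continuous, carries the regular variation, and \<open>\<rho>\<close> stands for
  \<open>c\<omega> / c\<theta>\<close>. The assumption \<open>double\<close> retains what is needed
  of the Levy-Khinchin form near the origin.\<close>

locale regularly_varying_exponent =
  fixes \<Psi> :: "real \<Rightarrow> complex" and \<alpha> \<rho> :: real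
  assumes cont: "continuous_on UNIV \<Psi>"
    and double: "\<And>l. Re (\<Psi> (2 * l)) \<le> 4 * Re (\<Psi> l)"
    and int_resolvent: "\<And>q. 0 < q \<Longrightarrow> set_integrable lborel {0<..} (\<lambda>l. 1 / cmod (of_real q + \<Psi> l))"
    and int_Im: "set_integrable lborel {0<..<1} (\<lambda>l. \<bar>Im (of_real l / \<Psi> l)\<bar>)"
    and \<alpha>: "1 < \<alpha>" "\<alpha> < 2"
    and pos: "\<forall>\<^sub>F l in at_top. 0 < Re (\<Psi> l)"
    and rv: "\<And>k. 0 < k \<Longrightarrow> ((\<lambda>l. Re (\<Psi> (k * l)) / Re (\<Psi> l)) \<longlongrightarrow> k powr \<alpha>) at_top"
    and ratio: "((\<lambda>l. Im (\<Psi> l) / Re (\<Psi> l)) \<longlongrightarrow> \<rho>) at_top"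
begin

lemma measurable_\<Psi> [measurable]: "\<Psi> \<in> borel_measurable borel"
  using cont by (rule borel_measurable_continuous_onI)

lemma potter:
  assumes "0 < \<delta>"
  shows "\<exists>B\<ge>1. \<exists>C>0. (\<forall>x\<ge>B. 0 < Re (\<Psi> x)) \<and>
    (\<forall>x\<ge>B. \<forall>y\<ge>x. Re (\<Psi> y) \<le> C * (y / x) powr (\<alpha> + \<delta>) * Re (\<Psi> x)) \<and>
    (\<forall>x\<ge>B. \<forall>y\<ge>x. Re (\<Psi> x) \<le> C * (y / x) powr (- \<alpha> + \<delta>) * Re (\<Psi> y))"
proof -
  have c: "continuous_on {0<..} (\<lambda>l. Re (\<Psi> l))"
    by (intro continuous_intros continuous_on_subset[OF cont]) auto
  have r: "((\<lambda>l. Re (\<Psi> (k * l)) / Re (\<Psi> l)) \<longlongrightarrow> k powr \<alpha>) at_top" if "1 \<le> k" for k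
    using that by (intro rv) auto
  show ?thesis
  proof (rule potter_bound[OF c pos r assms])
    fix B C :: real
    assume "0 < B" "0 < C" "\<And>x. B \<le> x \<Longrightarrow> 0 < Re (\<Psi> x)"
    "\<And>x y. B \<le> x \<Longrightarrow> x \<le> y \<Longrightarrow> Re (\<Psi> y) \<le> C * (y / x) powr (\<alpha> + \<delta>) * Re (\<Psi> x)"
    "\<And>x y. B \<le> x \<Longrightarrow> x \<le> y \<Longrightarrow> Re (\<Psi> x) \<le> C * (y / x) powr (- \<alpha> + \<delta>) * Re (\<Psi> y)"
    then show ?thesis
      by (intro exI[of _ "max B 1"] exI[of _ C] conjI) auto
  qed
qed

lemma Re_tendsto_top: "filterlim (\<lambda>l. Re (\<Psi> l)) at_top at_top"
proof -
  \<comment> \<open>With this choice the exponent \<open>- \<alpha> + \<delta>\<close> is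
    \<open>- 1\<close>, and the Potter bound becomes linear growth.\<close>
  define \<delta> where "\<delta> = \<alpha> - 1"
  have \<delta>: "0 < \<delta>" using \<alpha> by (simp add: \<delta>_def)
  obtain B C where B: "1 \<le> B" "0 < C" "\<forall>x\<ge>B. 0 < Re (\<Psi> x)"
    "\<forall>x\<ge>B. \<forall>y\<ge>x. Re (\<Psi> x) \<le> C * (y / x) powr (- \<alpha> + \<delta>) * Re (\<Psi> y)"
    using potter[OF \<delta>] by auto
  have "filterlim (\<lambda>l. (Re (\<Psi> B) / (C * B)) * l) at_top at_top"
    using B(1,2) B(3)
    by (intro filterlim_tendsto_pos_mult_at_top[OF tendsto_const _ filterlim_ident]) auto
  then show ?thesis
  proof (rule filterlim_at_top_mono)
    show "\<forall>\<^sub>F l in at_top. Re (\<Psi> B) / (C * B) * l \<le> Re (\<Psi> l)"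
      using eventually_ge_at_top[of B]
    proof eventually_elim
      case (elim l)
      have "Re (\<Psi> B) \<le> C * (l / B) powr (- 1) * Re (\<Psi> l)"
        using B(4) elim by (auto simp: \<delta>_def)
      moreover have "0 < l" using elim B(1) by linarith
      ultimately show ?case using B(1,2) by (simp add: powr_minus field_simps)
    qed
  qed
qed

text \<open>Doubling transports the lower bound at infinity down to the origin.\<close>

lemma Re_lower_bound:
  "\<exists>m>0. \<forall>l>0. m * min 1 (l\<^sup>2) \<le> Re (\<Psi> l)"
proof -
  have "\<forall>\<^sub>F l in at_top. 1 \<le> Re (\<Psi> l)"
    using Re_tendsto_top by (simp add: filterlim_at_top)
  then obtain B0 where B0: "\<And>l. B0 \<le> l \<Longrightarrow> 1 \<le> Re (\<Psi> l)"
    by (auto simp: eventually_at_top_linorder)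
  define B where "B = max B0 1"
  have B: "1 \<le> B" "\<And>l. B \<le> l \<Longrightarrow> 1 \<le> Re (\<Psi> l)" using B0 by (auto simp: B_def)
  have iter: "Re (\<Psi> (2 ^ n * l)) \<le> 4 ^ n * Re (\<Psi> l)" for n l
  proof (induction n)
    case (Suc n)
    then show ?case using double[of "2 ^ n * l"] by (simp add: mult.assoc)
  qed simp
  show ?thesis
  proof (intro exI[of _ "1 / (4 * B\<^sup>2)"] conjI allI impI)
    show "0 < 1 / (4 * B\<^sup>2)" using B(1) by simp
    fix l :: real assume l: "0 < l"
    show "1 / (4 * B\<^sup>2) * min 1 (l\<^sup>2) \<le> Re (\<Psi> l)"
    proof (cases "B \<le> l")
      case True
      have "1 * min 1 (l\<^sup>2) \<le> 4 * B\<^sup>2"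
        using B(1) by (intro order_trans[OF _ mult_mono[of 1 4 1 "B\<^sup>2"]]) auto
      then have "1 / (4 * B\<^sup>2) * min 1 (l\<^sup>2) \<le> 1" using B(1) by (simp add: field_simps)
      then show ?thesis using B(2)[OF True] by linarith
    next
      case False
      have "\<exists>n. B \<le> 2 ^ n * l"
      proof -
        obtain n where "B / l < 2 ^ n" using real_arch_pow[of 2 "B / l"] by auto
        then show ?thesis using l by (intro exI[of _ n]) (simp add: field_simps)
      qed
      \<comment> \<open>By minimality of \<open>n\<close> the point \<open>2 ^ n * l\<close> lies
        between \<open>B\<close> and \<open>2 * B\<close>. Hence
        \<open>4 ^ n * l\<^sup>2 \<le> 4 * B\<^sup>2\<close>, the origin of the constant
        \<open>1 / (4 * B\<^sup>2)\<close>.\<close>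
      then obtain n where n: "B \<le> 2 ^ n * l" "\<And>k. k < n \<Longrightarrow> \<not> B \<le> 2 ^ k * l"
        using exists_least_iff[of "\<lambda>n. B \<le> 2 ^ n * l"] by auto
      then have "n \<noteq> 0" using False by (intro notI) simp
      then have "2 ^ (n - 1) * l < B" using n(2)[of "n - 1"] by simp
      then have lt: "2 ^ n * l \<le> 2 * B" using \<open>n \<noteq> 0\<close> by (cases n) auto
      have "(2 ^ n * l)\<^sup>2 \<le> (2 * B)\<^sup>2" using lt l by (intro power_mono) auto
      moreover have "(2 ^ n)\<^sup>2 = (4::real) ^ n"
        by (simp add: power2_eq_square flip: power_mult_distrib)
      ultimately have "4 ^ n * l\<^sup>2 \<le> 4 * B\<^sup>2"
        by (simp add: power_mult_distrib)
      also have "\<dots> \<le> 4 * B\<^sup>2 * (4 ^ n * Re (\<Psi> l))"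
        using B(2)[OF n(1)] iter[of n l] B(1) mult_left_mono[of 1 "4 ^ n * Re (\<Psi> l)" "4 * B\<^sup>2"] by simp
      finally have "l\<^sup>2 \<le> 4 * B\<^sup>2 * Re (\<Psi> l)" by simp
      then have "1 / (4 * B\<^sup>2) * l\<^sup>2 \<le> Re (\<Psi> l)" using B(1) by (simp add: field_simps)
      moreover have "1 / (4 * B\<^sup>2) * min 1 (l\<^sup>2) \<le> 1 / (4 * B\<^sup>2) * l\<^sup>2"
        by (intro mult_left_mono) auto
      ultimately show ?thesis by linarith
    qed
  qed
qed

lemma Re_pos: "0 < l \<Longrightarrow> 0 < Re (\<Psi> l)"
  using Re_lower_bound by (metis less_le_trans min_less_iff_conj mult_pos_pos zero_less_one zero_less_power)

text \<open>Away from the origin the case \<open>q = 1\<close> of the hypothesis controls the case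
  \<open>q = 0\<close>: there \<open>cmod (\<Psi> l)\<close> is at least \<open>m\<close>, so adding
  1 changes it by at most the factor \<open>1 + 1 / m\<close>.\<close>

lemma set_integrable_inverse_\<Psi>: "set_integrable lborel {1..} (\<lambda>l. 1 / cmod (\<Psi> l))"
proof -
  obtain m where "0 < m \<and> (\<forall>l>0. m * min 1 (l\<^sup>2) \<le> Re (\<Psi> l))"
    using Re_lower_bound ..
  then have m: "0 < m" "\<And>l. 0 < l \<Longrightarrow> m * min 1 (l\<^sup>2) \<le> Re (\<Psi> l)"
    by blast+
  have "set_integrable lborel {0<..} (\<lambda>l. (1 + 1 / m) * (1 / cmod (of_real 1 + \<Psi> l)))"
    by (intro set_integrable_mult_right int_resolvent) simp
  then have "set_integrable lborel {1..} (\<lambda>l. (1 + 1 / m) * (1 / cmod (of_real 1 + \<Psi> l)))"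
    by (rule set_integrable_subset) auto
  then show ?thesis
  proof (rule set_integrable_bound)
    have "1 / cmod (\<Psi> l) \<le> (1 + 1 / m) * (1 / cmod (of_real 1 + \<Psi> l))" if l: "1 \<le> l" for l
    proof -
      have "min 1 (l\<^sup>2) = 1" using l by (simp add: min_absorb1)
      then have mR: "m \<le> cmod (\<Psi> l)" using m(2)[of l] l complex_Re_le_cmod[of "\<Psi> l"] by simp
      have "cmod (of_real 1 + \<Psi> l) \<le> 1 + cmod (\<Psi> l)" by (rule norm_triangle_le) simp
      also have "\<dots> \<le> (1 + 1 / m) * cmod (\<Psi> l)" using mR m(1) by (simp add: field_simps)
      finally have le: "cmod (of_real 1 + \<Psi> l) \<le> (1 + 1 / m) * cmod (\<Psi> l)" .
      have "0 < Re (of_real 1 + \<Psi> l)" using Re_pos[of l] l by simp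
      then have "0 < cmod (of_real 1 + \<Psi> l)" by (metis complex_Re_le_cmod less_le_trans)
      then show ?thesis using le mR m(1) by (simp add: divide_simps) (simp add: field_simps)
    qed
    then show "AE l in lborel. l \<in> {1..} \<longrightarrow> norm (1 / cmod (\<Psi> l)) \<le> norm ((1 + 1 / m) * (1 / cmod (of_real 1 + \<Psi> l)))"
      using m(1) by (auto intro!: AE_I2 simp: abs_mult)
  qed (simp_all add: set_borel_measurable_def)
qed

text \<open>A majorant of the resolvent kernel for all \<open>q \<ge> 0\<close> at once, with
  \<open>m\<close> the constant of \<open>Re_lower_bound\<close>. Below 1 that lower bound cancels
  the \<open>l\<^sup>2\<close> of the cosine term, and the \<open>l\<close> of the sine term is
  absorbed into \<open>Im (l / \<Psi> l)\<close>.\<close>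

definition kernel_bound :: "real \<Rightarrow> real \<Rightarrow> real \<Rightarrow> real" where
  "kernel_bound m x l = (if l < 1 then x\<^sup>2 / (2 * m) + \<bar>x\<bar> * \<bar>Im (of_real l / \<Psi> l)\<bar> else 2 * (1 / cmod (\<Psi> l)))"

lemma set_integrable_kernel_bound: "set_integrable lborel {0<..} (kernel_bound m x)"
proof -
  have "set_integrable lborel {0<..<1} (kernel_bound m x)"
  proof (rule set_integrable_cong[THEN iffD1])
    show "set_integrable lborel {0<..<1} (\<lambda>l. x\<^sup>2 / (2 * m) + \<bar>x\<bar> * \<bar>Im (of_real l / \<Psi> l)\<bar>)"
      by (intro set_integral_add set_integrable_mult_right int_Im) (simp add: set_integrable_def)
  qed (auto simp: kernel_bound_def)
  moreover have "set_integrable lborel {1..} (kernel_bound m x)"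
  proof (rule set_integrable_cong[THEN iffD1])
    show "set_integrable lborel {1..} (\<lambda>l. 2 * (1 / cmod (\<Psi> l)))"
      by (intro set_integrable_mult_right set_integrable_inverse_\<Psi>)
  qed (auto simp: kernel_bound_def)
  ultimately have "set_integrable lborel ({0<..<1} \<union> {1..}) (kernel_bound m x)"
    by (rule set_integrable_Un) auto
  moreover have "{0<..<1} \<union> {1..} = {0::real<..}" by auto
  ultimately show ?thesis by simp
qed

lemma abs_Re_kernel_le:
  assumes m: "0 < m" "\<And>l. 0 < l \<Longrightarrow> m * min 1 (l\<^sup>2) \<le> Re (\<Psi> l)" and q: "0 \<le> q" and l: "0 < l"
  shows "\<bar>Re ((1 - iexp (l * x)) / (of_real q + \<Psi> l))\<bar> \<le> kernel_bound m x l"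
proof (cases "l < 1")
  case True
  have "(l * x)\<^sup>2 / (2 * Re (\<Psi> l)) \<le> (l * x)\<^sup>2 / (2 * (m * l\<^sup>2))"
  proof (rule divide_left_mono)
    have "min 1 (l\<^sup>2) = l\<^sup>2" using True l by (simp add: min_absorb2 power_le_one)
    then show "2 * (m * l\<^sup>2) \<le> 2 * Re (\<Psi> l)" using m(2)[OF l] by simp
  qed (use Re_pos[OF l] m(1) l in auto)
  also have "\<dots> = x\<^sup>2 / (2 * m)" using l m(1) by (simp add: power_mult_distrib)
  finally have "(l * x)\<^sup>2 / (2 * Re (\<Psi> l)) \<le> x\<^sup>2 / (2 * m)" .
  moreover have "\<bar>l * x\<bar> * \<bar>Im (1 / \<Psi> l)\<bar> = \<bar>x\<bar> * \<bar>Im (of_real l / \<Psi> l)\<bar>"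
    using l by (simp add: Im_divide abs_mult)
  ultimately show ?thesis
    using abs_Re_1_minus_iexp_divide_le(1)[OF q Re_pos[OF l], of "l * x"] True
    by (simp add: kernel_bound_def)
next
  case False
  have "min 2 \<bar>l * x\<bar> / cmod (\<Psi> l) \<le> 2 / cmod (\<Psi> l)"
    by (intro divide_right_mono) auto
  then show ?thesis
    using abs_Re_1_minus_iexp_divide_le(2)[OF q Re_pos[OF l], of "l * x"] False
    by (simp add: kernel_bound_def)
qed

text \<open>This is \<open>\<pi>\<close> times the renormalized zero resolvent.\<close>

definition H :: "real \<Rightarrow> real" where
  "H x = (LBINT l:{0<..}. Re ((1 - iexp (l * x)) / \<Psi> l))"

lemma set_integrable_kernel:
  assumes "0 \<le> q"
  shows "set_integrable lborel {0<..} (\<lambda>l. Re ((1 - iexp (l * x)) / (of_real q + \<Psi> l)))"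
proof -
  obtain m where "0 < m \<and> (\<forall>l>0. m * min 1 (l\<^sup>2) \<le> Re (\<Psi> l))"
    using Re_lower_bound ..
  then have m: "0 < m" "\<And>l. 0 < l \<Longrightarrow> m * min 1 (l\<^sup>2) \<le> Re (\<Psi> l)"
    by blast+
  show ?thesis
  proof (rule set_integrable_bound[OF set_integrable_kernel_bound[of m x]])
    show "AE l in lborel. l \<in> {0<..} \<longrightarrow> norm (Re ((1 - iexp (l * x)) / (of_real q + \<Psi> l))) \<le> norm (kernel_bound m x l)"
      unfolding real_norm_def
      using order_trans[OF abs_Re_kernel_le[OF m assms] abs_ge_self] by (intro AE_I2 impI) simp
  qed (simp_all add: set_borel_measurable_def)
qed

lemma tendsto_H:
  "((\<lambda>q. LBINT l:{0<..}. Re ((1 - iexp (l * x)) / (of_real q + \<Psi> l))) \<longlongrightarrow> H x) (at_right 0)"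
proof -
  obtain m where "0 < m \<and> (\<forall>l>0. m * min 1 (l\<^sup>2) \<le> Re (\<Psi> l))"
    using Re_lower_bound ..
  then have m: "0 < m" "\<And>l. 0 < l \<Longrightarrow> m * min 1 (l\<^sup>2) \<le> Re (\<Psi> l)"
    by blast+
  show ?thesis
    \<comment> \<open>Replacing \<open>q\<close> by \<open>inverse q\<close> moves the limit at
      \<open>0+\<close> to infinity, where dominated convergence over a real parameter is
      applied.\<close>
    unfolding filterlim_at_right_to_top H_def set_lebesgue_integral_def
  proof (rule integral_dominated_convergence_at_top)
  show "integrable lborel (\<lambda>l. indicator {0<..} l *\<^sub>R kernel_bound m x l)"
    using set_integrable_kernel_bound by (simp add: set_integrable_def)
  show "\<forall>\<^sub>F q in at_top. AE l in lborel.
      norm (indicator {0<..} l *\<^sub>R Re ((1 - iexp (l * x)) / (of_real (inverse q) + \<Psi> l))) \<le> indicator {0<..} l *\<^sub>R kernel_bound m x l"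
    using eventually_ge_at_top[of 0]
  proof eventually_elim
    case (elim q)
    then have "0 \<le> inverse q" by simp
    from abs_Re_kernel_le[OF m this, of _ x] show ?case
      by (intro AE_I2) (simp add: indicator_def del: of_real_inverse)
  qed
  show "AE l in lborel. ((\<lambda>q. indicator {0<..} l *\<^sub>R Re ((1 - iexp (l * x)) / (of_real (inverse q) + \<Psi> l)))
     \<longlongrightarrow> indicator {0<..} l *\<^sub>R Re ((1 - iexp (l * x)) / \<Psi> l)) at_top"
  proof (rule AE_I2)
    fix l :: real
    show "((\<lambda>q. indicator {0<..} l *\<^sub>R Re ((1 - iexp (l * x)) / (of_real (inverse q) + \<Psi> l)))
     \<longlongrightarrow> indicator {0<..} l *\<^sub>R Re ((1 - iexp (l * x)) / \<Psi> l)) at_top"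
    proof (cases "0 < l")
      case True
      then have "\<Psi> l \<noteq> 0" using Re_pos[OF True] by auto
      moreover have "((\<lambda>q::real. of_real (inverse q)) \<longlongrightarrow> complex_of_real 0) at_top"
        by (intro tendsto_of_real tendsto_inverse_0_at_top filterlim_ident)
      then have "((\<lambda>q::real. of_real (inverse q) + \<Psi> l) \<longlongrightarrow> 0 + \<Psi> l) at_top"
        by (intro tendsto_add tendsto_const) simp
      ultimately show ?thesis
        by (intro tendsto_intros) auto
    qed simp
  qed
qed simp_all
qed

end

section \<open>Scaling limit of \<open>H\<close> at the origin\<close>

context regularly_varying_exponent
begin

text \<open>The Potter bound from the fixed base point \<open>B\<close> gives growth at most
  \<open>s powr (\<alpha> + \<delta>)\<close>, with an exponent below 2. This makes the low
  frequencies negligible after scaling.\<close>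

lemma tendsto_Re_divide_square: "((\<lambda>s. Re (\<Psi> s) / s\<^sup>2) \<longlongrightarrow> 0) at_top"
proof -
  define \<delta> where "\<delta> = (2 - \<alpha>) / 2"
  have \<delta>: "0 < \<delta>" "\<alpha> + \<delta> < 2" using \<alpha> by (auto simp: \<delta>_def field_simps)
  obtain B C where B: "1 \<le> B" "0 < C" "\<forall>x\<ge>B. 0 < Re (\<Psi> x)"
    "\<forall>x\<ge>B. \<forall>y\<ge>x. Re (\<Psi> y) \<le> C * (y / x) powr (\<alpha> + \<delta>) * Re (\<Psi> x)"
    using potter[OF \<delta>(1)] by auto
  define K where "K = C * B powr (- (\<alpha> + \<delta>)) * Re (\<Psi> B)"
  have "((\<lambda>s. K * s powr (\<alpha> + \<delta> - 2)) \<longlongrightarrow> 0) at_top"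
    using \<delta> by (intro tendsto_mult_right_zero tendsto_neg_powr filterlim_ident) auto
  then show ?thesis
  proof (rule tendsto_sandwich[OF _ _ tendsto_const, rotated 2])
    show "\<forall>\<^sub>F s in at_top. Re (\<Psi> s) / s\<^sup>2 \<le> K * s powr (\<alpha> + \<delta> - 2)"
      using eventually_ge_at_top[of B]
    proof eventually_elim
      case (elim s)
      then have s: "0 < s" using B(1) by linarith
      have "Re (\<Psi> s) \<le> C * (s / B) powr (\<alpha> + \<delta>) * Re (\<Psi> B)" using B(4) elim by auto
      also have "\<dots> = K * s powr (\<alpha> + \<delta>)"
        using s B(1) by (simp add: K_def powr_divide powr_minus_divide del: minus_add_distrib)
      finally have "Re (\<Psi> s) / s\<^sup>2 \<le> K * s powr (\<alpha> + \<delta>) / s\<^sup>2"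
        using s by (intro divide_right_mono) auto
      then show ?case using s by (simp add: powr_diff)
    qed
    show "\<forall>\<^sub>F s in at_top. 0 \<le> Re (\<Psi> s) / s\<^sup>2"
      using eventually_gt_at_top[of 0] by eventually_elim (use Re_pos in \<open>simp add: less_imp_le\<close>)
  qed
qed

text \<open>The integrand is at most \<open>B * \<bar>x\<bar>\<close> times the majorant at
  \<open>x = 1\<close>. Below 1 this uses \<open>x\<^sup>2 \<le> \<bar>x\<bar>\<close>, and between
  1 and \<open>B\<close> it uses \<open>\<bar>l * x\<bar> \<le> B * \<bar>x\<bar>\<close>.\<close>

lemma near_part_bound:
  assumes B: "1 \<le> B"
  shows "\<exists>K. \<forall>x. \<bar>x\<bar> \<le> 1 \<longrightarrow> \<bar>LBINT l:{0<..<B}. Re ((1 - iexp (l * x)) / \<Psi> l)\<bar> \<le> K * \<bar>x\<bar>"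
proof -
  obtain m where "0 < m \<and> (\<forall>l>0. m * min 1 (l\<^sup>2) \<le> Re (\<Psi> l))"
    using Re_lower_bound ..
  then have m: "0 < m" "\<And>l. 0 < l \<Longrightarrow> m * min 1 (l\<^sup>2) \<le> Re (\<Psi> l)"
    by blast+
  have I: "set_integrable lborel {0<..<B} (kernel_bound m 1)"
    using set_integrable_kernel_bound by (rule set_integrable_subset) auto
  have "\<bar>LBINT l:{0<..<B}. Re ((1 - iexp (l * x)) / \<Psi> l)\<bar> \<le> (B * (LBINT l:{0<..<B}. kernel_bound m 1 l)) * \<bar>x\<bar>"
    if x: "\<bar>x\<bar> \<le> 1" for x
  proof -
    have I1: "set_integrable lborel {0<..<B} (\<lambda>l. Re ((1 - iexp (l * x)) / \<Psi> l))"
      by (rule set_integrable_subset[of lborel "{0<..}"]) (use set_integrable_kernel[of 0 x] in auto)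
    have "\<bar>LBINT l:{0<..<B}. Re ((1 - iexp (l * x)) / \<Psi> l)\<bar> \<le> (LBINT l:{0<..<B}. \<bar>Re ((1 - iexp (l * x)) / \<Psi> l)\<bar>)"
      using set_integral_norm_bound[OF I1] by simp
    also have "\<dots> \<le> (LBINT l:{0<..<B}. (B * \<bar>x\<bar>) * kernel_bound m 1 l)"
    proof (rule set_integral_mono)
      show "set_integrable lborel {0<..<B} (\<lambda>l. \<bar>Re ((1 - iexp (l * x)) / \<Psi> l)\<bar>)"
        using set_integrable_norm[OF I1] by simp
      show "set_integrable lborel {0<..<B} (\<lambda>l. (B * \<bar>x\<bar>) * kernel_bound m 1 l)"
        using I by (rule set_integrable_mult_right)
      fix l assume l: "l \<in> {0<..<B}"
      show "\<bar>Re ((1 - iexp (l * x)) / \<Psi> l)\<bar> \<le> (B * \<bar>x\<bar>) * kernel_bound m 1 l"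
      proof (cases "l < 1")
        case True
        have "\<bar>Re ((1 - iexp (l * x)) / \<Psi> l)\<bar> \<le> x\<^sup>2 / (2 * m) + \<bar>x\<bar> * \<bar>Im (of_real l / \<Psi> l)\<bar>"
          using abs_Re_kernel_le[OF m order_refl, of l x] l True by (simp add: kernel_bound_def)
        also have "x\<^sup>2 / (2 * m) \<le> \<bar>x\<bar> / (2 * m)"
          using x m(1) mult_right_mono[OF x, of "\<bar>x\<bar>"]
          by (intro divide_right_mono) (auto simp: power2_eq_square)
        also have "\<bar>x\<bar> / (2 * m) + \<bar>x\<bar> * \<bar>Im (of_real l / \<Psi> l)\<bar> = 1 * (\<bar>x\<bar> * (1 / (2 * m) + \<bar>Im (of_real l / \<Psi> l)\<bar>))"
          by (simp add: algebra_simps)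
        also have "\<dots> \<le> B * (\<bar>x\<bar> * (1 / (2 * m) + \<bar>Im (of_real l / \<Psi> l)\<bar>))"
          using B m(1) by (intro mult_right_mono) auto
        finally show ?thesis using True by (simp add: kernel_bound_def mult.assoc)
      next
        case False
        have "\<bar>Re ((1 - iexp (l * x)) / (of_real 0 + \<Psi> l))\<bar> \<le> min 2 \<bar>l * x\<bar> / cmod (\<Psi> l)"
          using l by (intro abs_Re_1_minus_iexp_divide_le(2) Re_pos) auto
        also have "\<dots> \<le> (B * \<bar>x\<bar> * 2) / cmod (\<Psi> l)"
        proof (rule divide_right_mono)
          have "\<bar>l * x\<bar> \<le> B * \<bar>x\<bar>" unfolding abs_mult using l by (intro mult_right_mono) auto
          moreover have "0 \<le> B * \<bar>x\<bar>" using B by simp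
          ultimately show "min 2 \<bar>l * x\<bar> \<le> B * \<bar>x\<bar> * 2" by linarith
        qed simp
        finally show ?thesis using False by (simp add: kernel_bound_def mult.assoc)
      qed
    qed
    also have "\<dots> = (B * (LBINT l:{0<..<B}. kernel_bound m 1 l)) * \<bar>x\<bar>"
      by simp
    finally show ?thesis .
  qed
  then show ?thesis by blast
qed

lemma tendsto_Re_divide_\<Psi>: "((\<lambda>l. of_real (Re (\<Psi> l)) / \<Psi> l) \<longlongrightarrow> 1 / (1 + \<i> * of_real \<rho>)) at_top"
proof -
  have nz: "1 + \<i> * of_real \<rho> \<noteq> 0" by (auto simp: complex_eq_iff)
  have "((\<lambda>l. 1 / (1 + \<i> * of_real (Im (\<Psi> l) / Re (\<Psi> l)))) \<longlongrightarrow> 1 / (1 + \<i> * of_real \<rho>)) at_top"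
    by (intro tendsto_intros ratio nz)
  then show ?thesis
  proof (rule Lim_transform_eventually)
    show "\<forall>\<^sub>F l in at_top. 1 / (1 + \<i> * of_real (Im (\<Psi> l) / Re (\<Psi> l))) = of_real (Re (\<Psi> l)) / \<Psi> l"
      using pos
    proof eventually_elim
      case (elim l)
      have "\<Psi> l = of_real (Re (\<Psi> l)) * (1 + \<i> * of_real (Im (\<Psi> l) / Re (\<Psi> l)))"
        using elim by (simp add: complex_eq_iff)
      then show ?case using elim
        by (metis divide_divide_eq_left' div_self of_real_eq_0_iff less_irrefl mult.commute)
    qed
  qed
qed

text \<open>The pointwise limit comes from factoring \<open>Re (\<Psi> s) / \<Psi> (s * u)\<close>
  through \<open>Re (\<Psi> (s * u))\<close>: one factor tends to \<open>u powr (- \<alpha>)\<close>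
  by regular variation, the other to \<open>1 / (1 + \<i> * \<rho>)\<close>. The indicator confines
  \<open>s * u\<close> to the range where the Potter bounds hold.\<close>

lemma tendsto_far_part:
  assumes \<sigma>: "\<bar>\<sigma>\<bar> = 1" and \<delta>: "0 < \<delta>" "\<alpha> + \<delta> < 2" "1 < \<alpha> - \<delta>"
    and B: "1 \<le> B" "0 < C" "\<forall>x\<ge>B. 0 < Re (\<Psi> x)"
    "\<forall>x\<ge>B. \<forall>y\<ge>x. Re (\<Psi> y) \<le> C * (y / x) powr (\<alpha> + \<delta>) * Re (\<Psi> x)"
    "\<forall>x\<ge>B. \<forall>y\<ge>x. Re (\<Psi> x) \<le> C * (y / x) powr (- \<alpha> + \<delta>) * Re (\<Psi> y)"
  shows "((\<lambda>s. LBINT u:{0<..}. indicator {B..} (s * u) * Re ((1 - iexp (\<sigma> * u)) * (of_real (Re (\<Psi> s)) / \<Psi> (s * u))))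
    \<longlongrightarrow> (LBINT u:{0<..}. Re ((1 - iexp (\<sigma> * u)) * (of_real (u powr (- \<alpha>)) * (1 / (1 + \<i> * of_real \<rho>)))))) at_top"
proof -
  define w where "w u = C * (min 2 u * (if u \<le> 1 then u powr (- (\<alpha> + \<delta>)) else u powr (- (\<alpha> - \<delta>))))" for u
  show ?thesis
    unfolding set_lebesgue_integral_def
  proof (rule integral_dominated_convergence_at_top)
  have "set_integrable lborel {0<..} w"
    unfolding w_def by (intro set_integrable_mult_right set_integrable_min_powr \<delta>)
  then show "integrable lborel (\<lambda>u. indicator {0<..} u *\<^sub>R w u)"
    by (simp add: set_integrable_def)
  show "\<forall>\<^sub>F s in at_top. AE u in lborel. norm (indicator {0<..} u *\<^sub>R (indicator {B..} (s * u) * Re ((1 - iexp (\<sigma> * u)) * (of_real (Re (\<Psi> s)) / \<Psi> (s * u)))))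
     \<le> indicator {0<..} u *\<^sub>R w u"
    using eventually_ge_at_top[of B]
  proof eventually_elim
    case (elim s)
    have s0: "0 < s" "0 < Re (\<Psi> s)" using elim B(1,3) by (linarith, auto)
    have "\<bar>Re ((1 - iexp (\<sigma> * u)) * (of_real (Re (\<Psi> s)) / \<Psi> (s * u)))\<bar> \<le> w u"
      if u: "0 < u" "B \<le> s * u" for u
    proof -
      have su: "0 < Re (\<Psi> (s * u))" using B(3) u by auto
      have "\<bar>Re ((1 - iexp (\<sigma> * u)) * (of_real (Re (\<Psi> s)) / \<Psi> (s * u)))\<bar>
          \<le> cmod (1 - iexp (\<sigma> * u)) * (Re (\<Psi> s) / cmod (\<Psi> (s * u)))"
        using abs_Re_le_cmod[of "(1 - iexp (\<sigma> * u)) * (of_real (Re (\<Psi> s)) / \<Psi> (s * u))"] s0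
        by (simp add: norm_mult norm_divide)
      also have "\<dots> \<le> min 2 u * (Re (\<Psi> s) / Re (\<Psi> (s * u)))"
      proof (rule mult_mono)
        show "cmod (1 - iexp (\<sigma> * u)) \<le> min 2 u"
          using cmod_1_minus_iexp_le[of "\<sigma> * u"] \<sigma> u by (simp add: abs_mult)
        show "Re (\<Psi> s) / cmod (\<Psi> (s * u)) \<le> Re (\<Psi> s) / Re (\<Psi> (s * u))"
          using s0 su complex_Re_le_cmod[of "\<Psi> (s * u)"]
          by (intro divide_left_mono) (auto intro!: mult_pos_pos)
      qed (use u s0 in auto)
      \<comment> \<open>Which Potter bound applies depends on the order of \<open>s * u\<close> and
        \<open>s\<close>. For \<open>u \<le> 1\<close> it is the upper bound with base point
        \<open>s * u\<close>, for \<open>u > 1\<close> the lower bound with base point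
        \<open>s\<close>.\<close>
      also have "Re (\<Psi> s) / Re (\<Psi> (s * u)) \<le> C * (if u \<le> 1 then u powr (- (\<alpha> + \<delta>)) else u powr (- (\<alpha> - \<delta>)))"
      proof (cases "u \<le> 1")
        case True
        then have "s * u \<le> s" using s0 by simp
        then have "Re (\<Psi> s) \<le> C * (s / (s * u)) powr (\<alpha> + \<delta>) * Re (\<Psi> (s * u))"
          using B(4)[rule_format, of "s * u" s] u by simp
        also have "s / (s * u) = 1 / u" using s0 by simp
        also have "(1 / u) powr (\<alpha> + \<delta>) = u powr (- (\<alpha> + \<delta>))"
          using u by (simp add: powr_divide powr_minus_divide del: minus_add_distrib)
        finally show ?thesis using True su by (simp add: pos_divide_le_eq)
      next
        case False
        then have "s \<le> s * u" using s0 by simp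
        then have "Re (\<Psi> s) \<le> C * (s * u / s) powr (- \<alpha> + \<delta>) * Re (\<Psi> (s * u))"
          using B(5)[rule_format, of s "s * u"] elim by simp
        also have "s * u / s = u" using s0 by simp
        finally show ?thesis using False su by (simp add: pos_divide_le_eq)
      qed
      finally show ?thesis using u unfolding w_def by (simp add: mult_left_mono ac_simps)
    qed
    moreover have "0 \<le> w u" if "0 < u" for u using that B(2) by (simp add: w_def)
    ultimately show ?case
      by (intro AE_I2) (auto simp: indicator_def)
  qed
  show "AE u in lborel. ((\<lambda>s. indicator {0<..} u *\<^sub>R (indicator {B..} (s * u) * Re ((1 - iexp (\<sigma> * u)) * (of_real (Re (\<Psi> s)) / \<Psi> (s * u)))))
     \<longlongrightarrow> indicator {0<..} u *\<^sub>R Re ((1 - iexp (\<sigma> * u)) * (of_real (u powr (- \<alpha>)) * (1 / (1 + \<i> * of_real \<rho>))))) at_top"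
  proof (rule AE_I2)
    fix u :: real
    show "((\<lambda>s. indicator {0<..} u *\<^sub>R (indicator {B..} (s * u) * Re ((1 - iexp (\<sigma> * u)) * (of_real (Re (\<Psi> s)) / \<Psi> (s * u)))))
     \<longlongrightarrow> indicator {0<..} u *\<^sub>R Re ((1 - iexp (\<sigma> * u)) * (of_real (u powr (- \<alpha>)) * (1 / (1 + \<i> * of_real \<rho>))))) at_top"
    proof (cases "0 < u")
      case True
      have su: "filterlim (\<lambda>s. s * u) at_top at_top"
        using True by (intro filterlim_at_top_mult_tendsto_pos[OF tendsto_const _ filterlim_ident]) auto
      have "((\<lambda>s. inverse (Re (\<Psi> (u * s)) / Re (\<Psi> s))) \<longlongrightarrow> inverse (u powr \<alpha>)) at_top"
        using True by (intro tendsto_inverse rv) auto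
      then have "((\<lambda>s. Re (\<Psi> s) / Re (\<Psi> (s * u))) \<longlongrightarrow> u powr (- \<alpha>)) at_top"
        by (simp add: powr_minus mult.commute)
      then have lim: "((\<lambda>s. (1 - iexp (\<sigma> * u)) * (of_real (Re (\<Psi> s) / Re (\<Psi> (s * u))) * (of_real (Re (\<Psi> (s * u))) / \<Psi> (s * u))))
         \<longlongrightarrow> (1 - iexp (\<sigma> * u)) * (of_real (u powr (- \<alpha>)) * (1 / (1 + \<i> * of_real \<rho>)))) at_top"
        by (intro tendsto_mult tendsto_const tendsto_of_real filterlim_compose[OF tendsto_Re_divide_\<Psi> su])
      have "\<forall>\<^sub>F s in at_top. Re ((1 - iexp (\<sigma> * u)) * (of_real (Re (\<Psi> s) / Re (\<Psi> (s * u))) * (of_real (Re (\<Psi> (s * u))) / \<Psi> (s * u))))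
        = indicator {B..} (s * u) * Re ((1 - iexp (\<sigma> * u)) * (of_real (Re (\<Psi> s)) / \<Psi> (s * u)))"
        using filterlim_at_top[THEN iffD1, OF su, rule_format, of B]
      proof eventually_elim
        case (elim s)
        then have "0 < Re (\<Psi> (s * u))" using B(3) by auto
        then have "of_real (Re (\<Psi> s) / Re (\<Psi> (s * u))) * (of_real (Re (\<Psi> (s * u))) / \<Psi> (s * u)) = of_real (Re (\<Psi> s)) / \<Psi> (s * u)"
          by simp
        then show ?case using elim by (simp only:) simp
      qed
      from Lim_transform_eventually[OF tendsto_Re[OF lim] this] show ?thesis
        using True by simp
    qed simp
  qed
qed simp_all
qed

text \<open>Here \<open>\<sigma>\<close> is the sign of \<open>x\<close> and
  \<open>s = 1 / \<bar>x\<bar>\<close>. The near part is of order \<open>1 / s\<close>, so after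
  scaling it is bounded by a multiple of \<open>Re (\<Psi> s) / s\<^sup>2\<close>, and only the far
  part survives.\<close>

lemma tendsto_H_scaled:
  assumes \<sigma>: "\<bar>\<sigma>\<bar> = 1"
  shows "((\<lambda>s. H (\<sigma> / s) * Re (\<Psi> s) / s)
    \<longlongrightarrow> (LBINT u:{0<..}. Re ((1 - iexp (\<sigma> * u)) * (of_real (u powr (- \<alpha>)) * (1 / (1 + \<i> * of_real \<rho>)))))) at_top"
    (is "(_ \<longlongrightarrow> ?L) _")
proof -
  \<comment> \<open>Half the distance from \<open>\<alpha>\<close> to the nearer of 1 and 2 keeps
    both \<open>\<alpha> - \<delta>\<close> and \<open>\<alpha> + \<delta>\<close> strictly between
    them.\<close>
  define \<delta> where "\<delta> = min (2 - \<alpha>) (\<alpha> - 1) / 2"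
  have \<delta>: "0 < \<delta>" "\<alpha> + \<delta> < 2" "1 < \<alpha> - \<delta>" using \<alpha> by (auto simp: \<delta>_def min_def field_simps)
  obtain B C where B: "1 \<le> B" "0 < C" "\<forall>x\<ge>B. 0 < Re (\<Psi> x)"
    "\<forall>x\<ge>B. \<forall>y\<ge>x. Re (\<Psi> y) \<le> C * (y / x) powr (\<alpha> + \<delta>) * Re (\<Psi> x)"
    "\<forall>x\<ge>B. \<forall>y\<ge>x. Re (\<Psi> x) \<le> C * (y / x) powr (- \<alpha> + \<delta>) * Re (\<Psi> y)"
    using potter[OF \<delta>(1)] by auto
  obtain K where K: "\<And>x. \<bar>x\<bar> \<le> 1 \<Longrightarrow> \<bar>LBINT l:{0<..<B}. Re ((1 - iexp (l * x)) / \<Psi> l)\<bar> \<le> K * \<bar>x\<bar>"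
    using near_part_bound[OF B(1)] by blast
  let ?near = "\<lambda>s. LBINT l:{0<..<B}. Re ((1 - iexp (l * (\<sigma> / s))) / \<Psi> l)"
  let ?far = "\<lambda>s. LBINT u:{0<..}. indicator {B..} (s * u) * Re ((1 - iexp (\<sigma> * u)) * (of_real (Re (\<Psi> s)) / \<Psi> (s * u)))"
  have eq: "H (\<sigma> / s) * Re (\<Psi> s) / s = ?near s * Re (\<Psi> s) / s + ?far s" if s: "0 < s" for s
  proof -
    let ?k = "\<lambda>l. Re ((1 - iexp (l * (\<sigma> / s))) / \<Psi> l)"
    have I: "set_integrable lborel {0<..} ?k" using set_integrable_kernel[of 0 "\<sigma> / s"] by simp
    have "{0<..} = {0<..<B} \<union> {B..}" using B(1) by auto
    then have "H (\<sigma> / s) = (LBINT l:{0<..<B} \<union> {B..}. ?k l)" by (simp add: H_def)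
    also have "\<dots> = ?near s + (LBINT l:{B..}. ?k l)"
    proof (rule set_integral_Un)
      show "set_integrable lborel {0<..<B} ?k"
        by (rule set_integrable_subset[OF I]) auto
      show "set_integrable lborel {B..} ?k"
        by (rule set_integrable_subset[OF I]) (use B(1) in auto)
    qed auto
    finally have H: "H (\<sigma> / s) = ?near s + (LBINT l:{B..}. ?k l)" .
    \<comment> \<open>The substitution \<open>l = s * u\<close> produces a factor \<open>s\<close>,
      which the division by \<open>s\<close> in the scaling removes.\<close>
    have far: "(LBINT l:{B..}. ?k l) = s * (\<integral>u. indicator {B..} (s * u) * ?k (s * u) \<partial>lborel)"
      unfolding set_lebesgue_integral_def
      using s by (subst lborel_integral_real_affine[where c = s and t = 0]) auto
    have "(LBINT l:{B..}. ?k l) * Re (\<Psi> s) / s = (\<integral>u. Re (\<Psi> s) * (indicator {B..} (s * u) * ?k (s * u)) \<partial>lborel)"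
      unfolding far using s by simp
    also have "\<dots> = ?far s"
      unfolding set_lebesgue_integral_def
    proof (rule Bochner_Integration.integral_cong[OF refl])
      fix u
      have rm: "r * Re z = Re (of_real r * z)" for r z by simp
      have "s * u * (\<sigma> / s) = \<sigma> * u" using s by simp
      then have "Re (\<Psi> s) * ?k (s * u) = Re (of_real (Re (\<Psi> s)) * ((1 - iexp (\<sigma> * u)) / \<Psi> (s * u)))"
        by (simp only: rm)
      also have "of_real (Re (\<Psi> s)) * ((1 - iexp (\<sigma> * u)) / \<Psi> (s * u)) = (1 - iexp (\<sigma> * u)) * (of_real (Re (\<Psi> s)) / \<Psi> (s * u))"
        by (simp only: times_divide_eq_right mult.commute)
      finally have "Re (\<Psi> s) * ?k (s * u) = Re ((1 - iexp (\<sigma> * u)) * (of_real (Re (\<Psi> s)) / \<Psi> (s * u)))" .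
      moreover have "indicator {B..} (s * u) = (0::real)" if "u \<le> 0"
      proof -
        have "s * u \<le> 0" using s that by (simp add: mult_nonneg_nonpos)
        then show ?thesis using B(1) by simp
      qed
      ultimately show "Re (\<Psi> s) * (indicator {B..} (s * u) * ?k (s * u)) =
        indicator {0<..} u *\<^sub>R (indicator {B..} (s * u) * Re ((1 - iexp (\<sigma> * u)) * (of_real (Re (\<Psi> s)) / \<Psi> (s * u))))"
        by (cases "0 < u") (simp_all add: mult.left_commute)
    qed
    finally show ?thesis unfolding H by (simp add: add_divide_distrib distrib_right)
  qed
  have "((\<lambda>s. ?near s * Re (\<Psi> s) / s) \<longlongrightarrow> 0) at_top"
  proof (rule Lim_null_comparison)
    show "((\<lambda>s. K * (Re (\<Psi> s) / s\<^sup>2)) \<longlongrightarrow> 0) at_top"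
      by (intro tendsto_mult_right_zero tendsto_Re_divide_square)
    show "\<forall>\<^sub>F s in at_top. norm (?near s * Re (\<Psi> s) / s) \<le> K * (Re (\<Psi> s) / s\<^sup>2)"
      using eventually_ge_at_top[of 1]
    proof eventually_elim
      case (elim s)
      then have "0 < Re (\<Psi> s)" by (intro Re_pos) auto
      have "\<bar>?near s\<bar> \<le> K * \<bar>\<sigma> / s\<bar>"
        using elim \<sigma> by (intro K) (simp add: abs_divide)
      also have "\<bar>\<sigma> / s\<bar> = 1 / s" using elim \<sigma> by (simp add: abs_divide)
      finally have "\<bar>?near s\<bar> * (Re (\<Psi> s) / s) \<le> K * (1 / s) * (Re (\<Psi> s) / s)"
        using elim \<open>0 < Re (\<Psi> s)\<close> by (intro mult_right_mono) auto
      moreover have "norm (?near s * Re (\<Psi> s) / s) = \<bar>?near s\<bar> * (Re (\<Psi> s) / s)"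
        using elim \<open>0 < Re (\<Psi> s)\<close> by (simp add: abs_mult)
      ultimately show ?case by (simp add: power2_eq_square)
    qed
  qed
  from tendsto_add[OF this tendsto_far_part[OF \<sigma> \<delta> B]]
  have "((\<lambda>s. ?near s * Re (\<Psi> s) / s + ?far s) \<longlongrightarrow> ?L) at_top"
    by simp
  then show ?thesis
  proof (rule Lim_transform_eventually)
    show "\<forall>\<^sub>F s in at_top. ?near s * Re (\<Psi> s) / s + ?far s = H (\<sigma> / s) * Re (\<Psi> s) / s"
      using eventually_gt_at_top[of 0] by eventually_elim (simp only: eq)
  qed
qed

end

section \<open>The renormalized zero resolvent\<close>

lemma integral_even_function:
  fixes f :: "real \<Rightarrow> real"
  assumes f: "set_integrable lborel {0<..} f" and even: "\<And>x. f (- x) = f x" and m: "f \<in> borel_measurable borel"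
  shows "integrable lborel f" and "(\<integral>x. f x \<partial>lborel) = 2 * (LBINT x:{0<..}. f x)"
proof -
  have "has_bochner_integral lborel (\<lambda>x. indicator {0<..} x *\<^sub>R f x) (LBINT x:{0<..}. f x)"
    using f by (simp add: set_integrable_def set_lebesgue_integral_def has_bochner_integral_iff)
  moreover have "AE x in lborel. indicator {0<..} x *\<^sub>R f x = indicator {0..} x *\<^sub>R f x"
    using AE_lborel_singleton[of "0::real"] by eventually_elim (auto simp: indicator_def)
  ultimately have "has_bochner_integral lborel (\<lambda>x. indicator {0..} x *\<^sub>R f x) (LBINT x:{0<..}. f x)"
    using m by (subst has_bochner_integral_cong_AE[where g = "\<lambda>x. indicator {0<..} x *\<^sub>R f x"]) auto
  from has_bochner_integral_even_function[OF this even]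
  show "integrable lborel f" "(\<integral>x. f x \<partial>lborel) = 2 * (LBINT x:{0<..}. f x)"
    by (auto simp: has_bochner_integral_iff)
qed

text \<open>Since \<open>\<Psi> (- l)\<close> is conjugate to \<open>\<Psi> l\<close>, the modulus
  and the real part of the kernel are even in \<open>l\<close>. Thus the hypothesis on the half-line
  gives integrability on the whole line, and the inversion integral folds to twice a half-line
  integral.\<close>

lemma (in regularly_varying_exponent) resolvent_density_diff:
  assumes X: "levy_process M X" and E: "levy_exponent M X \<Psi>" and q: "0 < q"
  shows "resolvent_density M X q 0 - resolvent_density M X q (- x) =
    1 / pi * (LBINT l:{0<..}. Re ((1 - iexp (l * x)) / (of_real q + \<Psi> l)))"
proof -
  obtain a b \<nu> where LK: "0 \<le> a" "levy_measure \<nu>" "\<Psi> = levy_khinchin a b \<nu>"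
    using levy_exponentD[OF E] .
  then have sym: "\<Psi> (- l) = cnj (\<Psi> l)" for l by (simp add: levy_khinchin_uminus)
  have "cmod (of_real q + \<Psi> (- l)) = cmod (of_real q + \<Psi> l)" for l
    unfolding sym by (metis complex_cnj_add complex_cnj_complex_of_real complex_mod_cnj)
  then have "integrable lborel (\<lambda>l. 1 / cmod (of_real q + \<Psi> l))"
    by (intro integral_even_function(1) int_resolvent q) auto
  then have int: "integrable lborel (\<lambda>l. 1 / (of_real q + \<Psi> l))"
    by (rule Bochner_Integration.integrable_bound) (auto simp: norm_divide)
  have int': "integrable lborel (\<lambda>l. iexp (l * x) / (of_real q + \<Psi> l))"
    by (rule Bochner_Integration.integrable_bound[OF int]) (auto simp: norm_divide)
  have "resolvent_density M X q 0 - resolvent_density M X q (- x)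
    = 1 / (2 * pi) * (Re (\<integral>l. 1 / (of_real q + \<Psi> l) \<partial>lborel) - Re (\<integral>l. iexp (l * x) / (of_real q + \<Psi> l) \<partial>lborel))"
    using resolvent_density_eq[OF X E q int] by (simp add: right_diff_distrib)
  also have "Re (\<integral>l. 1 / (of_real q + \<Psi> l) \<partial>lborel) - Re (\<integral>l. iexp (l * x) / (of_real q + \<Psi> l) \<partial>lborel)
    = Re (\<integral>l. (1 - iexp (l * x)) / (of_real q + \<Psi> l) \<partial>lborel)"
    using Bochner_Integration.integral_diff[OF int int'] by (simp add: diff_divide_distrib)
  also have "\<dots> = (\<integral>l. Re ((1 - iexp (l * x)) / (of_real q + \<Psi> l)) \<partial>lborel)"
  proof (rule integral_Re[symmetric])
    show "integrable lborel (\<lambda>l. (1 - iexp (l * x)) / (of_real q + \<Psi> l))"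
      using Bochner_Integration.integrable_diff[OF int int'] by (simp add: diff_divide_distrib)
  qed
  also have "\<dots> = 2 * (LBINT l:{0<..}. Re ((1 - iexp (l * x)) / (of_real q + \<Psi> l)))"
  proof (rule integral_even_function(2))
    show "set_integrable lborel {0<..} (\<lambda>l. Re ((1 - iexp (l * x)) / (of_real q + \<Psi> l)))"
      using q by (intro set_integrable_kernel) simp
    fix l
    have "(1 - iexp (- l * x)) / (of_real q + \<Psi> (- l)) = cnj ((1 - iexp (l * x)) / (of_real q + \<Psi> l))"
      by (simp add: sym exp_cnj)
    then show "Re ((1 - iexp (- l * x)) / (of_real q + \<Psi> (- l))) = Re ((1 - iexp (l * x)) / (of_real q + \<Psi> l))"
      by (simp only: cnj.simps(1))
  qed simp
  finally show ?thesis by simp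
qed

lemma (in regularly_varying_exponent) renormalized_zero_resolvent_eq:
  assumes X: "levy_process M X" and E: "levy_exponent M X \<Psi>"
  shows "renormalized_zero_resolvent M X x = H x / pi"
  unfolding renormalized_zero_resolvent_def
proof (rule tendsto_Lim)
  have "((\<lambda>q. 1 / pi * (LBINT l:{0<..}. Re ((1 - iexp (l * x)) / (of_real q + \<Psi> l)))) \<longlongrightarrow> 1 / pi * H x) (at_right 0)"
    by (intro tendsto_mult tendsto_const tendsto_H)
  then have "((\<lambda>q. resolvent_density M X q 0 - resolvent_density M X q (- x)) \<longlongrightarrow> 1 / pi * H x) (at_right 0)"
  proof (rule Lim_transform_eventually)
    show "\<forall>\<^sub>F q in at_right 0. 1 / pi * (LBINT l:{0<..}. Re ((1 - iexp (l * x)) / (of_real q + \<Psi> l)))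
      = resolvent_density M X q 0 - resolvent_density M X q (- x)"
      using eventually_at_right_less[of 0] by eventually_elim (simp only: resolvent_density_diff[OF X E])
  qed
  then show "((\<lambda>q. resolvent_density M X q 0 - resolvent_density M X q (- x)) \<longlongrightarrow> H x / pi) (at_right 0)"
    by simp
qed simp

section \<open>Evaluation of the constants\<close>

lemma Re_integral_1_minus_iexp_powr:
  assumes \<alpha>: "1 < \<alpha>" "\<alpha> < 2"
  shows "(LBINT u:{0<..}. Re ((1 - iexp u) * (of_real (u powr (- \<alpha>)) * W))) =
    pi / (2 * Gamma \<alpha> * sin (pi * (\<alpha> - 1) / 2)) * Re W + pi / (2 * Gamma \<alpha> * sin (pi * \<alpha> / 2)) * Im W"
proof -
  let ?f = "\<lambda>u::real. (1 - iexp u) * of_real (u powr (- \<alpha>))"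
  have I: "integrable lborel (\<lambda>u. (indicator {0<..} u *\<^sub>R ?f u) * W)"
    using integral_1_minus_iexp_powr(1)[OF \<alpha>] unfolding set_integrable_def by (rule integrable_mult_left)
  have "(LBINT u:{0<..}. Re ((1 - iexp u) * (of_real (u powr (- \<alpha>)) * W))) = (\<integral>u. Re ((indicator {0<..} u *\<^sub>R ?f u) * W) \<partial>lborel)"
    unfolding set_lebesgue_integral_def
    by (intro Bochner_Integration.integral_cong) (auto simp: indicator_def mult.assoc)
  also have "\<dots> = Re (\<integral>u. (indicator {0<..} u *\<^sub>R ?f u) * W \<partial>lborel)"
    by (rule integral_Re[OF I])
  also have "(\<integral>u. (indicator {0<..} u *\<^sub>R ?f u) * W \<partial>lborel) = (CLBINT u:{0<..}. ?f u) * W"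
    unfolding set_lebesgue_integral_def by (rule integral_mult_left_zero)
  finally show ?thesis
    unfolding integral_1_minus_iexp_powr(2)[OF \<alpha>] by simp
qed

text \<open>The first identity is the case \<open>W = 1\<close> of the preceding lemma. As
  \<open>sin (pi * (\<alpha> - 1) / 2) = - cos (pi * \<alpha> / 2)\<close>, multiplication by the
  cotangent exchanges cosine for sine; this is how the imaginary part of the fractional integral
  produces the cotangent in the result.\<close>

lemma C_const_eq:
  assumes \<alpha>: "1 < \<alpha>" "\<alpha> < 2"
  shows "C_const \<alpha> = 1 / (2 * Gamma \<alpha> * sin (pi * (\<alpha> - 1) / 2))"
    and "C_const \<alpha> * cot (pi * \<alpha> / 2) = - (1 / (2 * Gamma \<alpha> * sin (pi * \<alpha> / 2)))"
proof -
  have "(LBINT x:{0<..}. (1 - cos x) / x powr \<alpha>) = (LBINT u:{0<..}. Re ((1 - iexp u) * (of_real (u powr (- \<alpha>)) * 1)))"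
  proof (rule set_lebesgue_integral_cong, simp, intro allI impI)
    fix x :: real
    have "Re ((1 - iexp x) * (of_real p * 1)) = (1 - cos x) * p" for p
      by (simp add: Re_exp)
    then show "(1 - cos x) / x powr \<alpha> = Re ((1 - iexp x) * (of_real (x powr (- \<alpha>)) * 1))"
      by (simp only: powr_minus_divide times_divide_eq_right mult_1_right)
  qed
  then show C: "C_const \<alpha> = 1 / (2 * Gamma \<alpha> * sin (pi * (\<alpha> - 1) / 2))"
    unfolding C_const_def Re_integral_1_minus_iexp_powr[OF \<alpha>] by simp
  have "sin (pi * (\<alpha> - 1) / 2) = sin (pi * \<alpha> / 2 - pi / 2)"
    by (simp add: right_diff_distrib diff_divide_distrib)
  also have "\<dots> = - cos (pi * \<alpha> / 2)" by (simp add: sin_diff)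
  finally have s: "sin (pi * (\<alpha> - 1) / 2) = - cos (pi * \<alpha> / 2)" .
  have "0 < sin (pi * (\<alpha> - 1) / 2)" using \<alpha> by (intro sin_gt_zero) auto
  then have "cos (pi * \<alpha> / 2) \<noteq> 0" using s by auto
  then show "C_const \<alpha> * cot (pi * \<alpha> / 2) = - (1 / (2 * Gamma \<alpha> * sin (pi * \<alpha> / 2)))"
    unfolding C s by (simp add: cot_def)
qed

text \<open>In the quotients the common factor \<open>l powr \<alpha> * L l\<close> cancels, or
  leaves \<open>L (k * l) / L l\<close>, which tends to 1.\<close>

lemma regularly_varying_exponentI:
  assumes \<Psi>: "levy_exponent M X \<Psi>"
    and int: "\<And>q :: real. q > 0 \<Longrightarrow> set_integrable lborel {0<..} (\<lambda>l. 1 / cmod (of_real q + \<Psi> l))"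
    and Im: "set_integrable lborel {0<..<1} (\<lambda>l. \<bar>Im (of_real l / \<Psi> l)\<bar>)"
    and L: "slowly_varying L"
    and \<alpha>: "1 < \<alpha>" "\<alpha> < 2" and c: "c\<theta> > 0"
    and \<theta>: "((\<lambda>l. Re (\<Psi> l) / (l powr \<alpha> * L l)) \<longlongrightarrow> c\<theta>) at_top"
    and \<omega>: "((\<lambda>l. Im (\<Psi> l) / (l powr \<alpha> * L l)) \<longlongrightarrow> c\<omega>) at_top"
  shows "regularly_varying_exponent \<Psi> \<alpha> (c\<omega> / c\<theta>)"
proof
  obtain a b \<nu> where LK: "0 \<le> a" "levy_measure \<nu>" "\<Psi> = levy_khinchin a b \<nu>"
    using levy_exponentD[OF \<Psi>] .
  show "continuous_on UNIV \<Psi>" "\<And>l. Re (\<Psi> (2 * l)) \<le> 4 * Re (\<Psi> l)"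
    using LK continuous_levy_khinchin Re_levy_khinchin_double by auto
  have nonneg: "0 \<le> Re (\<Psi> l)" for l using LK by (simp add: Re_levy_khinchin_nonneg)
  let ?G = "\<lambda>l. l powr \<alpha> * L l"
  \<comment> \<open>The quotient is eventually positive because \<open>c\<theta> > 0\<close>. As
    division by 0 gives 0, neither numerator nor denominator vanishes, and the real part is known to
    be non-negative.\<close>
  have pos: "\<forall>\<^sub>F l in at_top. 0 < Re (\<Psi> l) \<and> ?G l \<noteq> 0"
    using order_tendstoD(1)[OF \<theta> c]
    by eventually_elim (use nonneg in \<open>auto simp: less_le\<close>)
  then show "\<forall>\<^sub>F l in at_top. 0 < Re (\<Psi> l)"
    by eventually_elim simp
  show "((\<lambda>l. Re (\<Psi> (k * l)) / Re (\<Psi> l)) \<longlongrightarrow> k powr \<alpha>) at_top" if k: "0 < k" for k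
  proof -
    have kl: "filterlim (\<lambda>l. k * l) at_top at_top"
      using k by (intro filterlim_tendsto_pos_mult_at_top[OF tendsto_const _ filterlim_ident]) auto
    have "((\<lambda>l. L (k * l) / L l) \<longlongrightarrow> 1) at_top" using L k by (simp add: slowly_varying_def)
    then have "((\<lambda>l. (Re (\<Psi> (k * l)) / ?G (k * l)) * (k powr \<alpha> * (L (k * l) / L l)) / (Re (\<Psi> l) / ?G l))
      \<longlongrightarrow> c\<theta> * (k powr \<alpha> * 1) / c\<theta>) at_top"
      using c by (intro tendsto_intros filterlim_compose[OF \<theta> kl] \<theta>) auto
    then have "((\<lambda>l. (Re (\<Psi> (k * l)) / ?G (k * l)) * (k powr \<alpha> * (L (k * l) / L l)) / (Re (\<Psi> l) / ?G l))
      \<longlongrightarrow> k powr \<alpha>) at_top" using c by simp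
    then show ?thesis
    proof (rule Lim_transform_eventually)
      show "\<forall>\<^sub>F l in at_top. (Re (\<Psi> (k * l)) / ?G (k * l)) * (k powr \<alpha> * (L (k * l) / L l)) / (Re (\<Psi> l) / ?G l)
         = Re (\<Psi> (k * l)) / Re (\<Psi> l)"
        using pos eventually_gt_at_top[of 0] eventually_compose_filterlim[OF pos kl]
      proof eventually_elim
        case (elim l)
        have "?G (k * l) = k powr \<alpha> * l powr \<alpha> * L (k * l)"
          using k elim by (simp add: powr_mult)
        then show ?case using elim k by (simp add: field_simps)
      qed
    qed
  qed
  have "((\<lambda>l. (Im (\<Psi> l) / ?G l) / (Re (\<Psi> l) / ?G l)) \<longlongrightarrow> c\<omega> / c\<theta>) at_top"
    using c by (intro tendsto_divide \<theta> \<omega>) auto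
  then show "((\<lambda>l. Im (\<Psi> l) / Re (\<Psi> l)) \<longlongrightarrow> c\<omega> / c\<theta>) at_top"
  proof (rule Lim_transform_eventually)
    show "\<forall>\<^sub>F l in at_top. (Im (\<Psi> l) / ?G l) / (Re (\<Psi> l) / ?G l) = Im (\<Psi> l) / Re (\<Psi> l)"
      using pos by eventually_elim simp
  qed
qed (use int Im \<alpha> in auto)

theorem theorem1p2:
  fixes M :: "'a measure" and X :: "real \<Rightarrow> 'a \<Rightarrow> real" and \<Psi> :: "real \<Rightarrow> complex"
    and L :: "real \<Rightarrow> real" and \<alpha> c\<theta> c\<omega> :: real
  assumes "levy_process M X"
    and "levy_exponent M X \<Psi>"
    and "\<And>q :: real. q > 0 \<Longrightarrow>
           set_integrable lborel {0<..} (\<lambda>l. 1 / cmod (of_real q + \<Psi> l))"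
    and "set_integrable lborel {0<..<1} (\<lambda>l. \<bar>Im (of_real l / \<Psi> l)\<bar>)"
    and "slowly_varying L"
    and "1 < \<alpha>" and "\<alpha> < 2" and "c\<theta> > 0"
    and "asymp_const (\<lambda>l. Re (\<Psi> l)) c\<theta> (\<lambda>l. l powr \<alpha> * L l) at_top"
    and "asymp_const (\<lambda>l. Im (\<Psi> l)) c\<omega> (\<lambda>l. l powr \<alpha> * L l) at_top"
  shows "asymp_const (renormalized_zero_resolvent M X)
           (C_const \<alpha> / (c\<theta>\<^sup>2 + c\<omega>\<^sup>2) * (c\<theta> + c\<omega> * cot (pi * \<alpha> / 2)))
           (\<lambda>x. \<bar>x\<bar> powr (\<alpha> - 1) * inverse (L (1 / \<bar>x\<bar>))) (at_right 0)
       \<and> asymp_const (renormalized_zero_resolvent M X)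
           (C_const \<alpha> / (c\<theta>\<^sup>2 + c\<omega>\<^sup>2) * (c\<theta> - c\<omega> * cot (pi * \<alpha> / 2)))
           (\<lambda>x. \<bar>x\<bar> powr (\<alpha> - 1) * inverse (L (1 / \<bar>x\<bar>))) (at_left 0)
       \<and> C_const \<alpha> = 1 / (2 * Gamma \<alpha> * sin (pi * (\<alpha> - 1) / 2))"
proof (intro conjI)
  note \<alpha> = \<open>1 < \<alpha>\<close> \<open>\<alpha> < 2\<close>
  note \<theta> = assms(9)[unfolded asymp_const_def]
  interpret regularly_varying_exponent \<Psi> \<alpha> "c\<omega> / c\<theta>"
    using assms by (intro regularly_varying_exponentI) (auto simp: asymp_const_def)
  \<comment> \<open>\<open>W\<close> is the limit of \<open>Re (\<Psi> l) / \<Psi> l\<close>;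
    \<open>P\<close> and \<open>- Q\<close> are the real and imaginary parts of the fractional
    integral.\<close>
  define W where "W = 1 / (1 + \<i> * of_real (c\<omega> / c\<theta>))"
  define P where "P = pi / (2 * Gamma \<alpha> * sin (pi * (\<alpha> - 1) / 2))"
  define Q where "Q = pi / (2 * Gamma \<alpha> * sin (pi * \<alpha> / 2))"
  have PC: "P = pi * C_const \<alpha>" and QC: "Q = - (pi * (C_const \<alpha> * cot (pi * \<alpha> / 2)))"
    unfolding C_const_eq(2)[OF \<alpha>] unfolding C_const_eq(1)[OF \<alpha>] P_def Q_def by simp_all
  have sq: "0 < c\<theta>\<^sup>2 + c\<omega>\<^sup>2" using \<open>c\<theta> > 0\<close> by (simp add: add_pos_nonneg)
  have W: "Re W = c\<theta>\<^sup>2 / (c\<theta>\<^sup>2 + c\<omega>\<^sup>2)" "Im W = - (c\<theta> * c\<omega>) / (c\<theta>\<^sup>2 + c\<omega>\<^sup>2)"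
    using \<open>c\<theta> > 0\<close> sq
    by (simp_all add: W_def Re_divide Im_divide power2_eq_square field_simps)
  \<comment> \<open>Division by \<open>Re (\<Psi> s) / (s powr \<alpha> * L s)\<close>, which tends
    to \<open>c\<theta>\<close>, exchanges the normalisation by \<open>Re (\<Psi> s)\<close> for the
    one by \<open>L\<close>.\<close>
  have lim: "((\<lambda>s. renormalized_zero_resolvent M X (\<sigma> / s) / ((1 / s) powr (\<alpha> - 1) * inverse (L s)))
      \<longlongrightarrow> 1 / pi * (LBINT u:{0<..}. Re ((1 - iexp (\<sigma> * u)) * (of_real (u powr (- \<alpha>)) * W))) / c\<theta>) at_top"
    if \<sigma>: "\<bar>\<sigma>\<bar> = 1" for \<sigma>
  proof -
    have "((\<lambda>s. 1 / pi * (H (\<sigma> / s) * Re (\<Psi> s) / s) / (Re (\<Psi> s) / (s powr \<alpha> * L s)))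
      \<longlongrightarrow> 1 / pi * (LBINT u:{0<..}. Re ((1 - iexp (\<sigma> * u)) * (of_real (u powr (- \<alpha>)) * W))) / c\<theta>) at_top"
      unfolding W_def using \<open>c\<theta> > 0\<close>
      by (intro tendsto_divide tendsto_mult tendsto_const tendsto_H_scaled[OF \<sigma>] \<theta>) auto
    then show ?thesis
    proof (rule Lim_transform_eventually)
      show "\<forall>\<^sub>F s in at_top. 1 / pi * (H (\<sigma> / s) * Re (\<Psi> s) / s) / (Re (\<Psi> s) / (s powr \<alpha> * L s))
        = renormalized_zero_resolvent M X (\<sigma> / s) / ((1 / s) powr (\<alpha> - 1) * inverse (L s))"
        using eventually_gt_at_top[of 0]
      proof eventually_elim
        case (elim s)
        have "s powr \<alpha> = s * s powr (\<alpha> - 1)" using elim by (simp add: powr_diff)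
        moreover have "(1 / s) powr (\<alpha> - 1) = inverse (s powr (\<alpha> - 1))"
          using elim by (simp add: powr_divide inverse_eq_divide)
        ultimately show ?case
          using elim Re_pos[OF elim]
          by (simp add: renormalized_zero_resolvent_eq[OF assms(1,2)] divide_inverse ac_simps)
      qed
    qed
  qed
  \<comment> \<open>One computation serves both sides of 0: \<open>V = W\<close> with
    \<open>e = 1\<close> on the right, \<open>V = cnj W\<close> with \<open>e = - 1\<close> on the
    left.\<close>
  have val: "1 / pi * (P * Re V + Q * Im V) / c\<theta> = C_const \<alpha> / (c\<theta>\<^sup>2 + c\<omega>\<^sup>2) * (c\<theta> + e * c\<omega> * cot (pi * \<alpha> / 2))"
    if "Re V = c\<theta>\<^sup>2 / (c\<theta>\<^sup>2 + c\<omega>\<^sup>2)" "Im V = e * (- (c\<theta> * c\<omega>) / (c\<theta>\<^sup>2 + c\<omega>\<^sup>2))" for V e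
  proof -
    have "1 / pi * (pi * A * r + - (pi * B) * i) = A * r - B * i" for A B r i
      by (simp add: field_simps)
    then have "1 / pi * (P * Re V + Q * Im V) = C_const \<alpha> * Re V - C_const \<alpha> * cot (pi * \<alpha> / 2) * Im V"
      by (simp only: PC QC)
    also have "\<dots> / c\<theta> = C_const \<alpha> / (c\<theta>\<^sup>2 + c\<omega>\<^sup>2) * (c\<theta> + e * c\<omega> * cot (pi * \<alpha> / 2))"
      unfolding that using \<open>c\<theta> > 0\<close> sq by (simp add: power2_eq_square divide_simps) (simp add: algebra_simps)
    finally show ?thesis .
  qed
  show "asymp_const (renormalized_zero_resolvent M X)
           (C_const \<alpha> / (c\<theta>\<^sup>2 + c\<omega>\<^sup>2) * (c\<theta> + c\<omega> * cot (pi * \<alpha> / 2)))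
           (\<lambda>x. \<bar>x\<bar> powr (\<alpha> - 1) * inverse (L (1 / \<bar>x\<bar>))) (at_right 0)"
  proof -
    have "(LBINT u:{0<..}. Re ((1 - iexp (1 * u)) * (of_real (u powr (- \<alpha>)) * W))) = P * Re W + Q * Im W"
      using Re_integral_1_minus_iexp_powr[OF \<alpha>, of W] by (simp add: P_def Q_def)
    with lim[of 1] val[of W 1] W
    have "((\<lambda>s. renormalized_zero_resolvent M X (1 / s) / ((1 / s) powr (\<alpha> - 1) * inverse (L s)))
      \<longlongrightarrow> C_const \<alpha> / (c\<theta>\<^sup>2 + c\<omega>\<^sup>2) * (c\<theta> + c\<omega> * cot (pi * \<alpha> / 2))) at_top"
      by simp
    then show ?thesis
      unfolding asymp_const_def filterlim_at_right_to_top
    proof (rule Lim_transform_eventually)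
      show "\<forall>\<^sub>F s in at_top. renormalized_zero_resolvent M X (1 / s) / ((1 / s) powr (\<alpha> - 1) * inverse (L s))
        = renormalized_zero_resolvent M X (inverse s) / (\<bar>inverse s\<bar> powr (\<alpha> - 1) * inverse (L (1 / \<bar>inverse s\<bar>)))"
        using eventually_gt_at_top[of 0] by eventually_elim (simp add: inverse_eq_divide)
    qed
  qed
  show "asymp_const (renormalized_zero_resolvent M X)
           (C_const \<alpha> / (c\<theta>\<^sup>2 + c\<omega>\<^sup>2) * (c\<theta> - c\<omega> * cot (pi * \<alpha> / 2)))
           (\<lambda>x. \<bar>x\<bar> powr (\<alpha> - 1) * inverse (L (1 / \<bar>x\<bar>))) (at_left 0)"
  proof -
    \<comment> \<open>Conjugation leaves the real part unchanged, so reversing the sign of the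
      frequency amounts to replacing \<open>W\<close> by \<open>cnj W\<close>.\<close>
    have "Re ((1 - iexp (- 1 * u)) * (of_real (u powr (- \<alpha>)) * W)) = Re ((1 - iexp u) * (of_real (u powr (- \<alpha>)) * cnj W))" for u
    proof -
      have "(1 - iexp (- 1 * u)) * (of_real (u powr (- \<alpha>)) * W) = cnj ((1 - iexp u) * (of_real (u powr (- \<alpha>)) * cnj W))"
        by (simp add: exp_cnj)
      then show ?thesis by (simp only: cnj.simps(1))
    qed
    then have "(LBINT u:{0<..}. Re ((1 - iexp (- 1 * u)) * (of_real (u powr (- \<alpha>)) * W))) = P * Re (cnj W) + Q * Im (cnj W)"
      using Re_integral_1_minus_iexp_powr[OF \<alpha>, of "cnj W"] by (simp only: P_def Q_def)
    with lim[of "- 1"] val[of "cnj W" "- 1"] W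
    have "((\<lambda>s. renormalized_zero_resolvent M X (- 1 / s) / ((1 / s) powr (\<alpha> - 1) * inverse (L s)))
      \<longlongrightarrow> C_const \<alpha> / (c\<theta>\<^sup>2 + c\<omega>\<^sup>2) * (c\<theta> - c\<omega> * cot (pi * \<alpha> / 2))) at_top"
      by simp
    then show ?thesis
      unfolding asymp_const_def filterlim_at_left_to_right minus_zero filterlim_at_right_to_top
    proof (rule Lim_transform_eventually)
      show "\<forall>\<^sub>F s in at_top. renormalized_zero_resolvent M X (- 1 / s) / ((1 / s) powr (\<alpha> - 1) * inverse (L s))
        = renormalized_zero_resolvent M X (- inverse s) / (\<bar>- inverse s\<bar> powr (\<alpha> - 1) * inverse (L (1 / \<bar>- inverse s\<bar>)))"
        using eventually_gt_at_top[of 0] by eventually_elim (simp add: inverse_eq_divide)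
    qed
  qed
  show "C_const \<alpha> = 1 / (2 * Gamma \<alpha> * sin (pi * (\<alpha> - 1) / 2))"
    by (rule C_const_eq(1)[OF \<alpha>])
qed

end
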